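(* Let $\mathbb{U}$ be the Urysohn space and let $\mathrm{Iso}(\mathbb{U})$ be its group of (surjective) isometries with the topology of pointwise convergence. Then $\mathrm{Iso}(\mathbb{U})$ has the automatic continuity property, the small index property, and uncountable cofinality.
   Context: The Urysohn space is the unique, up to isometry, Polish metric space that is universal (every Polish metric space embeds isometrically into it) and homogeneous (every isometry between finite subspaces extends to an isometry of the whole space onto itself). A topological group $G$ has: the automatic continuity property if every homomorphism from $G$ into a separable topological group is continuous; the small index property if every subgroup $H\le G$ with $[G:H]<2^{\omega}$ is open in $G$; uncountable cofinality if there is no countably infinite chain $G_1\le G_2\le\ldots\le G$ of proper subgroups of $G$ with $G=\bigcup_k G_k$. *)

theory Defs
  imports "HOL-Analysis.Analysis" "HOL-Algebra.Coset"
begin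

section \<open>The Urysohn space\<close>

text \<open>
  A separable metric space has at most continuum many points, so a Polish metric space is,
  up to isometry, one whose points are real numbers (with an arbitrary metric). Testing
  universality on the type \<^typ>\<open>real metric\<close> therefore covers all Polish metric spaces;
  lemma \<open>universal_polish_embeds\<close> below makes this explicit.
\<close>

definition universal_polish :: "'u::polish_space itself \<Rightarrow> bool" where
  "universal_polish _ \<longleftrightarrow>
     (\<forall>m :: real metric. mcomplete_of m \<and> separable_space (mtopology_of m) \<longrightarrow>
        (\<exists>f :: real \<Rightarrow> 'u. \<forall>x\<in>mspace m. \<forall>y\<in>mspace m. dist (f x) (f y) = mdist m x y))"

definition isometries :: "('u::metric_space \<Rightarrow> 'u) set" where
  "isometries = {g. bij g \<and> (\<forall>x y. dist (g x) (g y) = dist x y)}"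

definition homogeneous_metric :: "'u::metric_space itself \<Rightarrow> bool" where
  "homogeneous_metric _ \<longleftrightarrow>
     (\<forall>(A :: 'u set) f. finite A \<and> (\<forall>x\<in>A. \<forall>y\<in>A. dist (f x) (f y) = dist x y) \<longrightarrow>
        (\<exists>g\<in>isometries. \<forall>x\<in>A. g x = f x))"

definition urysohn_space :: "'u::polish_space itself \<Rightarrow> bool" where
  "urysohn_space U \<longleftrightarrow> universal_polish U \<and> homogeneous_metric U"

definition Iso :: "('u::metric_space \<Rightarrow> 'u) monoid" where
  "Iso = \<lparr>carrier = isometries, mult = (\<circ>), one = id\<rparr>"

text \<open>The product topology on all functions is the topology of pointwise convergence.\<close>

definition Iso_topology :: "('u::metric_space \<Rightarrow> 'u) topology" where
  "Iso_topology = subtopology (product_topology (\<lambda>_. euclidean) UNIV) isometries"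


section \<open>Topological groups\<close>

definition topological_group :: "('g, 'm) monoid_scheme \<Rightarrow> 'g topology \<Rightarrow> bool" where
  "topological_group G T \<longleftrightarrow>
     group G \<and> topspace T = carrier G \<and>
     continuous_map (prod_topology T T) T (\<lambda>(x, y). x \<otimes>\<^bsub>G\<^esub> y) \<and>
     continuous_map T T (\<lambda>x. inv\<^bsub>G\<^esub> x)"

text \<open>
  HOL cannot quantify over types inside a formula, so the type of the elements of the target
  groups is a parameter; the property in full is the validity for every type \<^typ>\<open>'h\<close>.
\<close>

definition automatic_continuity_property ::
    "'h itself \<Rightarrow> ('g, 'm) monoid_scheme \<Rightarrow> 'g topology \<Rightarrow> bool" where
  "automatic_continuity_property _ G T \<longleftrightarrow>
     (\<forall>(H :: 'h monoid) S. topological_group H S \<and> separable_space S \<longrightarrow>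
        (\<forall>\<phi>\<in>hom G H. continuous_map T S \<phi>))"

definition small_index_property :: "('g, 'm) monoid_scheme \<Rightarrow> 'g topology \<Rightarrow> bool" where
  "small_index_property G T \<longleftrightarrow>
     (\<forall>H. subgroup H G \<and> rcosets\<^bsub>G\<^esub> H \<prec> (UNIV :: nat set set) \<longrightarrow> openin T H)"

definition uncountable_cofinality :: "('g, 'm) monoid_scheme \<Rightarrow> bool" where
  "uncountable_cofinality G \<longleftrightarrow>
     \<not> (\<exists>C :: nat \<Rightarrow> 'g set.
          (\<forall>n. subgroup (C n) G \<and> C n \<noteq> carrier G) \<and>
          (\<forall>n. C n \<subseteq> C (Suc n)) \<and>
          (\<Union>n. C n) = carrier G)"


section \<open>Sanity checks\<close>

lemma separable_metric_lepoll:
  fixes m :: "'b metric"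
  assumes "separable_space (mtopology_of m)"
  shows "mspace m \<lesssim> (UNIV :: real set)"
proof -
  interpret Metric_space "mspace m" "mdist m" by simp
  obtain D where D: "countable D" "D \<subseteq> mspace m" "mtopology closure_of D = mspace m"
    using assms unfolding separable_space_def mtopology_of_def by auto
  define F where "F x = {(q, r) \<in> D \<times> \<rat>. mdist m q x < r}" for x
  have inj: "inj_on F (mspace m)"
  proof (rule inj_onI, rule ccontr)
    fix x y assume xy: "x \<in> mspace m" "y \<in> mspace m" "F x = F y" "x \<noteq> y"
    define e where "e = mdist m x y / 2"
    have e: "e > 0" using xy by (simp add: e_def mdist_pos_eq)
    have "x \<in> mtopology closure_of D" using D xy by simp
    then obtain q where q: "q \<in> D" "q \<in> mball x e"
      using e by (auto simp: metric_closure_of)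
    hence qe: "mdist m q x < e" "q \<in> mspace m" by (auto simp: commute)
    then obtain r where r: "r \<in> \<rat>" "mdist m q x < r" "r < e"
      using Rats_dense_in_real by blast
    hence "(q, r) \<in> F y" using q xy(3) by (auto simp: F_def)
    hence "mdist m q y < e" using r by (auto simp: F_def)
    moreover have "mdist m x y \<le> mdist m q x + mdist m q y"
      using triangle[of x q y] xy qe by (simp add: commute)
    ultimately show False using qe by (simp add: e_def)
  qed
  have "countable (D \<times> (\<rat> :: real set))"
    using D countable_rat by auto
  then obtain c :: "'b \<times> real \<Rightarrow> nat" where c: "inj_on c (D \<times> \<rat>)"
    by (auto simp: countable_def)
  have "inj_on (\<lambda>x. c ` F x) (mspace m)"
  proof (rule inj_onI)
    fix x y assume xy: "x \<in> mspace m" "y \<in> mspace m" "c ` F x = c ` F y"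
    have "F x = F y"
      using inj_on_image_eq_iff[OF c, of "F x" "F y"] xy(3) by (auto simp: F_def)
    thus "x = y" using inj xy by (auto dest: inj_onD)
  qed
  hence "mspace m \<lesssim> (UNIV :: nat set set)"
    by (auto simp: lepoll_def)
  thus ?thesis
    using nat_sets_eqpoll_reals lepoll_trans2 by blast
qed

lemma universal_polish_embeds:
  fixes m :: "'b metric"
  assumes "universal_polish TYPE('u::polish_space)"
    and "mcomplete_of m" "separable_space (mtopology_of m)"
  shows "\<exists>f :: 'b \<Rightarrow> 'u. \<forall>x\<in>mspace m. \<forall>y\<in>mspace m. dist (f x) (f y) = mdist m x y"
proof -
  obtain h :: "'b \<Rightarrow> real" where h: "inj_on h (mspace m)"
    using separable_metric_lepoll[OF assms(3)] by (auto simp: lepoll_def)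
  define M d k where "M = mspace m" and "d = mdist m" and "k = inv_into M h"
  have kh [simp]: "k (h x) = x" if "x \<in> M" for x
    using that h by (simp add: M_def k_def)
  interpret A: Metric_space M d by (simp add: M_def d_def)
  define N e where "N = h ` M" and "e = (\<lambda>x y. d (k x) (k y))"
  define e' where "e' = (\<lambda>x y. if x \<in> N \<and> y \<in> N then e x y else 0)"
  interpret B: Metric_space N e'
  proof
    show "0 \<le> e' x y" for x y by (simp add: e'_def e_def)
    show "e' x y = e' y x" for x y by (simp add: e'_def e_def A.commute)
    show "(e' x y = 0) = (x = y)" if "x \<in> N" "y \<in> N" for x y
      using that by (auto simp: e'_def e_def N_def)
    show "e' x z \<le> e' x y + e' y z" if "x \<in> N" "y \<in> N" "z \<in> N" for x y z
      using that by (auto simp: e'_def e_def N_def A.triangle)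
  qed
  interpret AB: Metric_space12 M d N e' ..
  have iso: "e' (h x) (h y) = d x y" if "x \<in> M" "y \<in> M" for x y
    using that by (simp add: e'_def e_def N_def)
  have "homeomorphic_map A.mtopology B.mtopology h"
    by (rule AB.isometry_imp_homeomorphic_map) (auto simp: N_def iso)
  hence "A.mtopology homeomorphic_space B.mtopology"
    using homeomorphic_map_imp_homeomorphic_space by blast
  moreover have "separable_space A.mtopology"
    using assms(3) by (simp add: mtopology_of_def M_def d_def)
  ultimately have sep: "separable_space B.mtopology"
    using homeomorphic_separable_space by blast
  have A: "A.mcomplete"
    using assms(2) by (simp add: mcomplete_of_def M_def d_def)
  have "B.mcomplete"
    unfolding B.mcomplete_def
  proof (intro allI impI)
    fix s assume s: "B.MCauchy s"
    have sN: "s n \<in> N" for n using s by (auto simp: B.MCauchy_def)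
    have kM: "k (s n) \<in> M" for n using sN[of n] by (auto simp: N_def)
    have dk: "d (k (s i)) (k (s j)) = e' (s i) (s j)" for i j
      using sN by (simp add: e'_def e_def)
    have "A.MCauchy (\<lambda>n. k (s n))"
      using s kM by (auto simp: A.MCauchy_def B.MCauchy_def dk)
    then obtain l where "limitin A.mtopology (\<lambda>n. k (s n)) l sequentially"
      using A by (auto simp: A.mcomplete_def)
    hence l: "l \<in> M" "\<And>\<epsilon>. \<epsilon> > 0 \<Longrightarrow> \<forall>\<^sub>F n in sequentially. d (k (s n)) l < \<epsilon>"
      by (auto simp: A.limitin_metric elim: eventually_mono)
    have "e' (s n) (h l) = d (k (s n)) l" for n
      using sN[of n] l(1) by (auto simp: e'_def e_def N_def)
    hence "limitin B.mtopology s (h l) sequentially"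
      unfolding B.limitin_metric using l sN by (auto simp: N_def[symmetric]) (simp add: N_def)
    thus "\<exists>x. limitin B.mtopology s x sequentially" ..
  qed
  hence "mcomplete_of (metric (N, e'))" "separable_space (mtopology_of (metric (N, e')))"
    using sep by auto
  then obtain f :: "real \<Rightarrow> 'u"
    where f: "\<forall>x\<in>N. \<forall>y\<in>N. dist (f x) (f y) = e' x y"
    using assms(1) unfolding universal_polish_def
    by (metis B.mdist_metric B.mspace_metric)
  hence "\<forall>x\<in>mspace m. \<forall>y\<in>mspace m. dist (f (h x)) (f (h y)) = mdist m x y"
    using iso by (auto simp: N_def M_def d_def)
  thus ?thesis by (intro exI[of _ "\<lambda>x. f (h x)"])
qed

lemma group_Iso: "group Iso"
proof (rule groupI)
  fix g :: "'u::metric_space \<Rightarrow> 'u" assume g: "g \<in> carrier Iso"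
  hence b: "bij g" and d: "dist (g x) (g y) = dist x y" for x y
    by (auto simp: Iso_def isometries_def)
  have "dist (inv_into UNIV g x) (inv_into UNIV g y) = dist x y" for x y
    using d[of "inv_into UNIV g x" "inv_into UNIV g y"] b
    by (simp add: bij_is_surj surj_f_inv_f)
  thus "\<exists>h\<in>carrier Iso. h \<otimes>\<^bsub>Iso\<^esub> g = \<one>\<^bsub>Iso\<^esub>"
    using b by (intro bexI[of _ "inv_into UNIV g"])
      (auto simp: Iso_def isometries_def bij_imp_bij_inv bij_is_inj)
qed (auto simp: Iso_def isometries_def bij_comp o_assoc)

lemma topspace_Iso_topology: "topspace Iso_topology = carrier Iso"
  by (simp add: Iso_topology_def Iso_def)

lemma continuous_map_into_Iso:
  "continuous_map T Iso_topology F \<longleftrightarrow>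
     F ` topspace T \<subseteq> isometries \<and> (\<forall>a. continuous_map T euclidean (\<lambda>p. F p a))"
  by (auto simp: Iso_topology_def continuous_map_in_subtopology continuous_map_componentwise_UNIV)

lemma continuous_map_euclidean_dist:
  fixes F :: "'a \<Rightarrow> 'u::metric_space"
  assumes "\<And>p \<epsilon>. p \<in> topspace T \<Longrightarrow> \<epsilon> > 0 \<Longrightarrow>
     \<exists>V. openin T V \<and> p \<in> V \<and> (\<forall>q\<in>V. dist (F q) (F p) < \<epsilon>)"
  shows "continuous_map T euclidean F"
proof -
  have "\<exists>V. openin T V \<and> p \<in> V \<and> (\<forall>q\<in>V. F q \<in> W)"
    if p: "p \<in> topspace T" and W: "open W" "F p \<in> W" for p W
  proof -
    obtain \<epsilon> where "\<epsilon> > 0" "ball (F p) \<epsilon> \<subseteq> W" using W openE by blast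
    thus ?thesis using assms[OF p, of \<epsilon>] by (fastforce simp: dist_commute)
  qed
  thus ?thesis by (simp add: continuous_map_eq_topcontinuous_at topcontinuous_at_def)
qed

lemma openin_Iso_eval:
  "openin Iso_topology {g \<in> isometries. dist (g a) b < \<epsilon>}"
proof -
  have "continuous_map Iso_topology euclidean (\<lambda>g. g a)"
    using continuous_map_into_Iso[of Iso_topology id]
    by (auto simp: continuous_map_id[unfolded id_def] id_def)
  from openin_continuous_map_preimage[OF this, of "ball b \<epsilon>"] show ?thesis
    by (simp add: topspace_Iso_topology Iso_def dist_commute)
qed

lemma topological_group_Iso:
  "topological_group (Iso :: ('u::metric_space \<Rightarrow> 'u) monoid) Iso_topology"
proof -
  have mult: "continuous_map (prod_topology Iso_topology Iso_topology) Iso_topology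
          (\<lambda>(g :: 'u \<Rightarrow> 'u, h). g \<otimes>\<^bsub>Iso\<^esub> h)"
    unfolding continuous_map_into_Iso
  proof (intro conjI allI)
    show "(\<lambda>(g :: 'u \<Rightarrow> 'u, h). g \<otimes>\<^bsub>Iso\<^esub> h) ` topspace (prod_topology Iso_topology Iso_topology)
            \<subseteq> isometries"
      by (auto simp: topspace_Iso_topology Iso_def isometries_def bij_comp)
    fix a :: 'u
    show "continuous_map (prod_topology Iso_topology Iso_topology) euclidean
            (\<lambda>p. (case p of (g, h) \<Rightarrow> g \<otimes>\<^bsub>Iso\<^esub> h) a)"
    proof (rule continuous_map_euclidean_dist)
      fix p :: "('u \<Rightarrow> 'u) \<times> ('u \<Rightarrow> 'u)" and \<epsilon> :: real
      assume "p \<in> topspace (prod_topology Iso_topology Iso_topology)" and \<epsilon>: "\<epsilon> > 0"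
      then obtain g h where p: "p = (g, h)" "g \<in> isometries" "h \<in> isometries"
        by (auto simp: topspace_Iso_topology Iso_def)
      define V where "V = {g' \<in> isometries. dist (g' (h a)) (g (h a)) < \<epsilon>/2}
                          \<times> {h' \<in> isometries. dist (h' a) (h a) < \<epsilon>/2}"
      have "openin (prod_topology Iso_topology Iso_topology) V"
        unfolding V_def openin_prod_Times_iff using openin_Iso_eval by blast
      moreover have "p \<in> V" using p \<epsilon> by (simp add: V_def)
      moreover have "dist (g' (h' a)) (g (h a)) < \<epsilon>" if "(g', h') \<in> V" for g' h'
      proof -
        have "dist (g' (h' a)) (g' (h a)) = dist (h' a) (h a)"
          using that by (auto simp: V_def isometries_def)
        thus ?thesis
          using that dist_triangle_half_r[of "g' (h a)" "g' (h' a)" \<epsilon> "g (h a)"]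
          by (auto simp: V_def dist_commute)
      qed
      ultimately show "\<exists>V. openin (prod_topology Iso_topology Iso_topology) V \<and> p \<in> V \<and>
          (\<forall>q\<in>V. dist ((case q of (g, h) \<Rightarrow> g \<otimes>\<^bsub>Iso\<^esub> h) a)
                       ((case p of (g, h) \<Rightarrow> g \<otimes>\<^bsub>Iso\<^esub> h) a) < \<epsilon>)"
        using p by (intro exI[of _ V]) (auto simp: Iso_def)
    qed
  qed
  interpret group "Iso :: ('u \<Rightarrow> 'u) monoid" by (rule group_Iso)
  have inv_Iso: "g ((inv\<^bsub>Iso\<^esub> g) x) = x" "inv\<^bsub>Iso\<^esub> g \<in> isometries"
    if "g \<in> isometries" for g :: "'u \<Rightarrow> 'u" and x
    using r_inv[of g] inv_closed[of g] that by (auto simp: Iso_def o_def id_def fun_eq_iff)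
  have inv: "continuous_map Iso_topology Iso_topology (\<lambda>g :: 'u \<Rightarrow> 'u. inv\<^bsub>Iso\<^esub> g)"
    unfolding continuous_map_into_Iso
  proof (intro conjI allI)
    show "(\<lambda>g :: 'u \<Rightarrow> 'u. inv\<^bsub>Iso\<^esub> g) ` topspace Iso_topology \<subseteq> isometries"
      using inv_Iso(2) by (auto simp: topspace_Iso_topology Iso_def)
    fix a :: 'u
    show "continuous_map Iso_topology euclidean (\<lambda>g. (inv\<^bsub>Iso\<^esub> g) a)"
    proof (rule continuous_map_euclidean_dist)
      fix g :: "'u \<Rightarrow> 'u" and \<epsilon> :: real
      assume "g \<in> topspace Iso_topology" and \<epsilon>: "\<epsilon> > 0"
      hence g: "g \<in> isometries" by (simp add: topspace_Iso_topology Iso_def)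
      define b where "b = (inv\<^bsub>Iso\<^esub> g) a"
      have gb: "g b = a" using inv_Iso(1)[OF g] by (simp add: b_def)
      have "dist ((inv\<^bsub>Iso\<^esub> h) a) b < \<epsilon>" if h: "h \<in> isometries" "dist (h b) a < \<epsilon>" for h
      proof -
        have "dist ((inv\<^bsub>Iso\<^esub> h) a) b = dist (h ((inv\<^bsub>Iso\<^esub> h) a)) (h b)"
          using h by (simp add: isometries_def)
        thus ?thesis using h inv_Iso(1)[OF h(1)] by (simp add: dist_commute)
      qed
      thus "\<exists>V. openin Iso_topology V \<and> g \<in> V \<and>
              (\<forall>h\<in>V. dist ((inv\<^bsub>Iso\<^esub> h) a) ((inv\<^bsub>Iso\<^esub> g) a) < \<epsilon>)"
        using g gb \<epsilon> openin_Iso_eval[of b a \<epsilon>]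
        by (intro exI[of _ "{h \<in> isometries. dist (h b) a < \<epsilon>}"]) (auto simp: b_def)
    qed
  qed
  show ?thesis
    unfolding topological_group_def
    using group_Iso topspace_Iso_topology mult inv by blast
qed

end

theory Submission
  imports Defs
begin

text \<open>
  Each of the three properties follows once a certain increasing chain
  \<open>V 0 \<subseteq> V 1 \<subseteq> \<dots>\<close> of symmetric sets of isometries is shown to contain a
  neighbourhood of the identity, up to a bounded number of factors: \<open>npow (V m) n\<close> consists of the
  products of \<open>n\<close> elements of \<open>V m\<close>. For a homomorphism into a separable group,
  \<open>V\<close> is the preimage of a small symmetric neighbourhood of the identity; for a subgroup of small index, it
  is the subgroup; for a countable chain of subgroups, it is the chain. What these chains share is the property
  \<open>large_in\<close>: among isometries \<open>h \<alpha>\<close> indexed by all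
  \<open>\<alpha> :: nat \<Rightarrow> bool\<close> there are two whose sequences first differ at some
  \<open>n\<close> and whose quotient lies in \<open>V n\<close>. In each case it follows from a colouring of the
  sequences that cannot be injective. The proof that largeness suffices, theorem
  \<open>moves_less_subset_npow_urysohn\<close>, has three steps.

  First, some \<open>npow (V m) 6\<close> contains the pointwise stabilizer of a finite set
  (\<open>fixator_subset_npow_urysohn\<close>). Otherwise every pair of \<open>m\<close> and a finite set has a witness
  against this. A closing-off argument gives a countable dense set \<open>D\<close> that is invariant under the
  witnesses for its finite subsets and has the one-point extension property for distances in a countable set
  \<open>S\<close>, so that one may work in the Polish group \<open>P\<close> of the isometries that preserve
  \<open>D\<close>. Call a finite system of such isometries tame if it has many finite invariant sets and realizes every
  finite extension of its action on them. By back-and-forth, tame systems are homogeneous: a partial conjugacy between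
  finite invariant sets extends to a conjugacy (\<open>tame_conjugate\<close>). They are also generic: if
  \<open>z\<close> is tame, then a comeager set of \<open>y\<close> makes \<open>(z, y)\<close> tame
  (\<open>comeager_tame\<close>). This rests on the theorem of Solecki and Vershik that every finite metric space embeds
  into a finite one in which all its partial isometries extend to isometries (\<open>metric_extension_property\<close>),
  and on amalgamation. By a perfect set construction, largeness puts generic elements into every neighbourhood of the
  identity in some \<open>V m\<close>, while the witnesses keep some generic elements out of
  \<open>npow (V m) 3\<close>. Generic elements are conjugate, so there are \<open>x n \<in> V m\<close>,
  \<open>y n \<notin> npow (V m) 3\<close> with \<open>n \<le> m\<close>, and \<open>f n\<close> conjugating
  \<open>y n\<close> to \<open>x n\<close>; they are chosen one after another so that each \<open>f n\<close>
  commutes with all earlier elements and so that the infinite products of the \<open>f n\<close> with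
  \<open>\<alpha> n\<close> converge to isometries \<open>h \<alpha>\<close>. If \<open>\<alpha>\<close> and
  \<open>\<beta>\<close> first differ at \<open>n\<close>, then the quotient of \<open>h \<alpha>\<close> and
  \<open>h \<beta>\<close>, or its inverse, conjugates \<open>x n\<close> to \<open>y n\<close>. Largeness puts such
  a quotient into \<open>V n\<close>, and then \<open>y n\<close> is a product of three elements of
  \<open>V m\<close>, a contradiction.

  Secondly, passing from the stabilizer of a finite set \<open>c\<close> to a neighbourhood of the identity uses the
  geometry of the Urysohn space. A double coset of the stabilizer consists of all isometries that put \<open>c\<close>
  into a given position relative to \<open>c\<close>. There is a path of copies of \<open>c\<close> along which the
  relative position depends only on the difference of the parameters (\<open>path_of_copies\<close>); by largeness, some
  \<open>g \<in> V m\<close> moves \<open>c\<close> into such a position. If \<open>h\<close> moves \<open>c\<close>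
  only slightly, then some \<open>k\<close> is in this position relative to \<open>c\<close> and to
  \<open>h ` c\<close> at the same time, and \<open>h\<close> is the product of \<open>k\<close> and an inverse of an
  isometry in the same position (\<open>moves_less_subset_npow\<close>).

  Thirdly, a subgroup that contains a neighbourhood of the identity is the whole group, because the path of copies can
  be followed in small steps to a position in which all distances agree (\<open>subgroup_containing_moves_less\<close>).
  So for chains of subgroups largeness even yields the whole group.
\<close>

section \<open>Extension of partial isometries of finite metric spaces\<close>

definition metric_on :: "'a set \<Rightarrow> ('a \<Rightarrow> 'a \<Rightarrow> real) \<Rightarrow> bool" where
  "metric_on E \<delta> \<longleftrightarrow>
     (\<forall>x\<in>E. \<forall>y\<in>E. 0 \<le> \<delta> x y \<and> \<delta> x y = \<delta> y x \<and> (\<delta> x y = 0 \<longleftrightarrow> x = y)) \<and>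
     (\<forall>x\<in>E. \<forall>y\<in>E. \<forall>z\<in>E. \<delta> x z \<le> \<delta> x y + \<delta> y z)"

definition partial_isometry :: "'a set \<Rightarrow> ('a \<Rightarrow> 'a \<Rightarrow> real) \<Rightarrow> 'a set \<Rightarrow> ('a \<Rightarrow> 'a) \<Rightarrow> bool" where
  "partial_isometry A \<delta> C p \<longleftrightarrow>
     C \<subseteq> A \<and> p ` C \<subseteq> A \<and> (\<forall>x\<in>C. \<forall>y\<in>C. \<delta> (p x) (p y) = \<delta> x y)"

text \<open>
  Edge-labelled graphs, with label 0 for a missing edge. No triangle inequality is required: the finite metric space in
  which partial isometries extend is obtained as the path metric of such a graph.
\<close>

definition labelling :: "'e set \<Rightarrow> ('e \<Rightarrow> 'e \<Rightarrow> real) \<Rightarrow> bool" where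
  "labelling E l \<longleftrightarrow> (\<forall>x\<in>E. \<forall>y\<in>E. l x y = l y x \<and> 0 \<le> l x y \<and> l x x = 0)"

definition distances :: "'a set \<Rightarrow> ('a \<Rightarrow> 'a \<Rightarrow> real) \<Rightarrow> real set" where
  "distances A \<delta> = (\<lambda>(a, b). \<delta> a b) ` (A \<times> A)"

definition partial_isometries_extend ::
    "'a set \<Rightarrow> ('a \<Rightarrow> 'a \<Rightarrow> real) \<Rightarrow> 'e set \<Rightarrow> ('e \<Rightarrow> 'e \<Rightarrow> real) \<Rightarrow> ('a \<Rightarrow> 'e) \<Rightarrow> bool" where
  "partial_isometries_extend A \<delta> E l \<iota> \<longleftrightarrow>
     (\<forall>C p. partial_isometry A \<delta> C p \<longrightarrow>
        (\<exists>\<theta>. bij_betw \<theta> E E \<and> (\<forall>x\<in>E. \<forall>y\<in>E. l (\<theta> x) (\<theta> y) = l x y) \<and>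
             (\<forall>a\<in>C. \<theta> (\<iota> a) = \<iota> (p a))))"

text \<open>
  The approximations to the extension theorem: a finite edge-labelled graph that contains the metric space
  \<open>A\<close>, uses only its distances as labels, and has enough automorphisms.
\<close>

definition extension_graph ::
    "'a set \<Rightarrow> ('a \<Rightarrow> 'a \<Rightarrow> real) \<Rightarrow> 'e set \<Rightarrow> ('e \<Rightarrow> 'e \<Rightarrow> real) \<Rightarrow> ('a \<Rightarrow> 'e) \<Rightarrow> bool" where
  "extension_graph A \<delta> E l \<iota> \<longleftrightarrow>
     finite E \<and> \<iota> ` A \<subseteq> E \<and> labelling E l \<and>
     (\<forall>x\<in>E. \<forall>y\<in>E. l x y \<in> insert 0 (distances A \<delta>)) \<and>
     (\<forall>a\<in>A. \<forall>b\<in>A. l (\<iota> a) (\<iota> b) = \<delta> a b) \<and>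
     partial_isometries_extend A \<delta> E l \<iota>"

lemma extension_graphD:
  assumes "extension_graph A \<delta> E l \<iota>"
  shows "finite E" "\<iota> ` A \<subseteq> E" "labelling E l"
    "\<And>x y. x \<in> E \<Longrightarrow> y \<in> E \<Longrightarrow> l x y \<in> insert 0 (distances A \<delta>)"
    "\<And>a b. a \<in> A \<Longrightarrow> b \<in> A \<Longrightarrow> l (\<iota> a) (\<iota> b) = \<delta> a b"
    "\<And>C p. partial_isometry A \<delta> C p \<Longrightarrow>
      \<exists>\<theta>. bij_betw \<theta> E E \<and> (\<forall>x\<in>E. \<forall>y\<in>E. l (\<theta> x) (\<theta> y) = l x y) \<and>
             (\<forall>a\<in>C. \<theta> (\<iota> a) = \<iota> (p a))"
  using assms unfolding extension_graph_def partial_isometries_extend_def by blast+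

fun walk_length :: "('e \<Rightarrow> 'e \<Rightarrow> real) \<Rightarrow> 'e list \<Rightarrow> real" where
  "walk_length l (x # y # w) = l x y + walk_length l (y # w)"
| "walk_length l w = 0"

fun walk :: "('e \<Rightarrow> 'e \<Rightarrow> real) \<Rightarrow> 'e list \<Rightarrow> bool" where
  "walk l (x # y # w) \<longleftrightarrow> 0 < l x y \<and> walk l (y # w)"
| "walk l w \<longleftrightarrow> True"

text \<open>
  The triangle inequality for walks with at most \<open>k\<close> vertices. A missing closing edge has label 0 and
  satisfies it trivially, so the condition forbids short cycles that are not metric.
\<close>

definition no_shortcuts :: "'e set \<Rightarrow> ('e \<Rightarrow> 'e \<Rightarrow> real) \<Rightarrow> nat \<Rightarrow> bool" where
  "no_shortcuts E l k \<longleftrightarrow>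
     (\<forall>w. set w \<subseteq> E \<and> w \<noteq> [] \<and> length w \<le> k \<and> walk l w \<longrightarrow>
        l (hd w) (last w) \<le> walk_length l w)"

lemma walk_split: "walk l (u @ b # v) \<longleftrightarrow> walk l (u @ [b]) \<and> walk l (b # v)"
  by (induction l u rule: walk.induct) auto

lemma walk_length_split: "walk_length l (u @ b # v) = walk_length l (u @ [b]) + walk_length l (b # v)"
  by (induction l u rule: walk.induct) auto

lemma walk_length_nonneg: "walk l w \<Longrightarrow> 0 \<le> walk_length l w"
  by (induction l w rule: walk.induct) auto

lemma walk_length_ge:
  assumes "walk l w" "\<And>x y. x \<in> set w \<Longrightarrow> y \<in> set w \<Longrightarrow> 0 < l x y \<Longrightarrow> \<mu> \<le> l x y"
  shows "real (length w - 1) * \<mu> \<le> walk_length l w"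
  using assms
proof (induction l w rule: walk.induct)
  case (1 l x y w)
  have "real (length (y # w) - 1) * \<mu> \<le> walk_length l (y # w)" using 1 by auto
  moreover have "\<mu> \<le> l x y" using 1 by auto
  ultimately show ?case by (simp add: algebra_simps)
qed auto

lemma walk_map:
  assumes "\<And>x y. x \<in> set w \<Longrightarrow> y \<in> set w \<Longrightarrow> l' (f x) (f y) = l x y"
  shows "walk l' (map f w) = walk l w" "walk_length l' (map f w) = walk_length l w"
  using assms by (induction l w rule: walk.induct) auto

lemma no_shortcuts_2:
  assumes "labelling E l" shows "no_shortcuts E l 2"
  unfolding no_shortcuts_def
proof (intro allI impI)
  fix w assume w: "set w \<subseteq> E \<and> w \<noteq> [] \<and> length w \<le> 2 \<and> walk l w"
  show "l (hd w) (last w) \<le> walk_length l w"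
    using w assms by (cases "(l, w)" rule: walk.cases) (auto simp: labelling_def)
qed

lemma extension_graph_transfer:
  fixes E :: "'e set"
  assumes "extension_graph A \<delta> E l \<iota>" "no_shortcuts E l k"
  shows "\<exists>(E' :: nat set) l' \<iota>'. extension_graph A \<delta> E' l' \<iota>' \<and> no_shortcuts E' l' k"
proof -
  note a = extension_graphD(1-5)[OF assms(1)] and ext = extension_graphD(6)[OF assms(1)]
  obtain f :: "'e \<Rightarrow> nat" where f: "inj_on f E"
    using a(1) finite_imp_inj_to_nat_seg by blast
  define g where "g = inv_into E f"
  have gf [simp]: "g (f x) = x" if "x \<in> E" for x using that f by (simp add: g_def)
  have gE: "g y \<in> E" "f (g y) = y" if "y \<in> f ` E" for y using that by auto
  define l' where "l' = (\<lambda>x y. l (g x) (g y))"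
  have "extension_graph A \<delta> (f ` E) l' (f \<circ> \<iota>)"
    unfolding extension_graph_def partial_isometries_extend_def
  proof (intro conjI allI impI)
    show "finite (f ` E)" using a(1) by auto
    show "(f \<circ> \<iota>) ` A \<subseteq> f ` E" using a(2) by auto
    show "labelling (f ` E) l'" using a(3) by (auto simp: labelling_def l'_def)
    show "\<forall>x\<in>f ` E. \<forall>y\<in>f ` E. l' x y \<in> insert 0 (distances A \<delta>)"
      using a(4) by (auto simp: l'_def)
    show "\<forall>x\<in>A. \<forall>b\<in>A. l' ((f \<circ> \<iota>) x) ((f \<circ> \<iota>) b) = \<delta> x b"
      using a(2,5) by (auto simp: l'_def image_subset_iff)
    fix C p assume C: "partial_isometry A \<delta> C p"
    from ext[OF this] obtain \<theta> where \<theta>: "bij_betw \<theta> E E" "\<forall>x\<in>E. \<forall>y\<in>E. l (\<theta> x) (\<theta> y) = l x y"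
      "\<forall>a\<in>C. \<theta> (\<iota> a) = \<iota> (p a)" by blast
    have \<theta>E: "\<theta> x \<in> E" if "x \<in> E" for x using \<theta>(1) that by (auto simp: bij_betw_def)
    have fb: "bij_betw f E (f ` E)" using f by (simp add: bij_betw_def)
    have gb: "bij_betw g (f ` E) E" unfolding g_def using fb by (rule bij_betw_inv_into)
    show "\<exists>\<theta>. bij_betw \<theta> (f ` E) (f ` E) \<and> (\<forall>x\<in>f ` E. \<forall>y\<in>f ` E. l' (\<theta> x) (\<theta> y) = l' x y) \<and>
           (\<forall>a\<in>C. \<theta> ((f \<circ> \<iota>) a) = (f \<circ> \<iota>) (p a))"
    proof (intro exI[of _ "f \<circ> \<theta> \<circ> g"] conjI)
      show "bij_betw (f \<circ> \<theta> \<circ> g) (f ` E) (f ` E)"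
        using bij_betw_trans[OF gb bij_betw_trans[OF \<theta>(1) fb]] by (simp add: o_assoc)
      show "\<forall>x\<in>f ` E. \<forall>y\<in>f ` E. l' ((f \<circ> \<theta> \<circ> g) x) ((f \<circ> \<theta> \<circ> g) y) = l' x y"
        using \<theta>(2) \<theta>E by (auto simp: l'_def)
      have "\<iota> a \<in> E" if "a \<in> C" for a using that C a(2) by (auto simp: partial_isometry_def)
      thus "\<forall>a\<in>C. (f \<circ> \<theta> \<circ> g) ((f \<circ> \<iota>) a) = (f \<circ> \<iota>) (p a)" using \<theta>(3) by auto
    qed
  qed
  moreover have "no_shortcuts (f ` E) l' k"
    unfolding no_shortcuts_def
  proof (intro allI impI)
    fix w assume w: "set w \<subseteq> f ` E \<and> w \<noteq> [] \<and> length w \<le> k \<and> walk l' w"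
    have 1: "walk l (map g w) = walk l' w" "walk_length l (map g w) = walk_length l' w"
      by (rule walk_map; simp add: l'_def)+
    have "set (map g w) \<subseteq> E" using w by auto
    hence "l (hd (map g w)) (last (map g w)) \<le> walk_length l (map g w)"
      using assms(2) w 1 unfolding no_shortcuts_def by (metis length_map map_is_Nil_conv)
    thus "l' (hd w) (last w) \<le> walk_length l' w"
      using w 1 by (simp add: l'_def hd_map last_map)
  qed
  ultimately show ?thesis by blast
qed

text \<open>
  Domain and image of an injection have complements of the same size.
\<close>

lemma extend_partial_permutation:
  assumes "finite A" "C \<subseteq> A" "p ` C \<subseteq> A" "inj_on p C"
  shows "\<exists>\<pi>. bij_betw \<pi> A A \<and> (\<forall>a\<in>C. \<pi> a = p a)"
proof -
  have "card (A - C) = card (A - p ` C)"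
    using assms by (simp add: card_Diff_subset finite_subset card_image)
  then obtain q where q: "bij_betw q (A - C) (A - p ` C)"
    using assms by (meson finite_Diff finite_same_card_bij)
  define \<pi> where "\<pi> a = (if a \<in> C then p a else q a)" for a
  have 1: "bij_betw \<pi> C (p ` C)"
    using assms by (simp add: \<pi>_def bij_betw_def inj_on_def)
  have 2: "bij_betw \<pi> (A - C) (A - p ` C)"
    using q by (rule bij_betw_cong[THEN iffD1, rotated]) (auto simp: \<pi>_def)
  have "bij_betw \<pi> (C \<union> (A - C)) (p ` C \<union> (A - p ` C))"
    by (rule bij_betw_combine[OF 1 2]) blast
  hence "bij_betw \<pi> A A" by (simp only: Un_Diff_cancel Un_absorb1[OF assms(2)] Un_absorb1[OF assms(3)])
  moreover have "\<forall>a\<in>C. \<pi> a = p a" by (simp add: \<pi>_def)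
  ultimately show ?thesis by blast
qed

definition symdiff :: "'a set \<Rightarrow> 'a set \<Rightarrow> 'a set" where
  "symdiff a b = sym_diff a b"

lemma symdiff_commute: "symdiff a b = symdiff b a"
  and symdiff_cancel: "symdiff a (symdiff a b) = b"
  and symdiff_cancel2: "symdiff (symdiff a c) (symdiff b c) = symdiff a b"
  and symdiff_cancel_right: "symdiff a c = symdiff b c \<longleftrightarrow> a = b"
  and symdiff_subset: "a \<subseteq> c \<Longrightarrow> b \<subseteq> c \<Longrightarrow> symdiff a b \<subseteq> c"
  by (auto simp: symdiff_def)

lemma symdiff_swap: "symdiff a b = symdiff c d \<Longrightarrow> symdiff a c = symdiff b d"
  by (auto simp: symdiff_def set_eq_iff)

text \<open>
  A vertex is a point \<open>i\<close> of \<open>A\<close> with a valuation, a set of distances for every point of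
  \<open>A\<close>; \<open>(i, \<kappa>)\<close> and \<open>(j, \<kappa>')\<close> are joined by an edge of length
  \<open>s\<close> if \<open>\<kappa> j\<close> and \<open>\<kappa>' i\<close> differ in exactly the element
  \<open>s\<close>. The lengths are thus encoded in differences of valuations and survive when both valuations are
  changed by the same set. A partial isometry, extended to a permutation of \<open>A\<close>, acts on the first
  coordinates; the valuations are then corrected by a symmetric family of sets so that points of \<open>A\<close> go to
  points of \<open>A\<close>.
\<close>

lemma extension_graph_exists:
  fixes A :: "'a set"
  assumes fin: "finite A" and met: "metric_on A \<delta>"
  shows "\<exists>(E :: nat set) l \<iota>. extension_graph A \<delta> E l \<iota> \<and> no_shortcuts E l 2"
proof -
  define \<Lambda> where "\<Lambda> = distances A \<delta>"
  have fin\<Lambda>: "finite \<Lambda>" using fin by (simp add: \<Lambda>_def distances_def)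
  have d\<Lambda>: "\<delta> a b \<in> \<Lambda>" if "a \<in> A" "b \<in> A" for a b using that by (auto simp: \<Lambda>_def distances_def)
  have \<Lambda>0: "0 \<le> s" if "s \<in> \<Lambda>" for s
    using that met by (auto simp: \<Lambda>_def distances_def metric_on_def)
  obtain r :: "'a \<Rightarrow> nat" where r: "inj_on r A"
    using fin finite_imp_inj_to_nat_seg by blast
  define E :: "('a \<times> ('a \<Rightarrow> real set)) set" where "E = A \<times> (A \<rightarrow>\<^sub>E Pow \<Lambda>)"
  define l :: "'a \<times> ('a \<Rightarrow> real set) \<Rightarrow> 'a \<times> ('a \<Rightarrow> real set) \<Rightarrow> real" where
    "l = (\<lambda>(i, \<kappa>) (j, \<kappa>'). if i \<noteq> j \<and> (\<exists>s\<in>\<Lambda>. symdiff (\<kappa> j) (\<kappa>' i) = {s})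
                         then the_elem (symdiff (\<kappa> j) (\<kappa>' i)) else 0)"
  \<comment> \<open>the injection r orients each pair of points: its distance is put into the valuation of one of them\<close>
  define X where "X i = (\<lambda>j\<in>A. if r i < r j then {\<delta> i j} else {})" for i
  define \<iota> where "\<iota> i = (i, X i)" for i
  have X\<Lambda>: "X i j \<subseteq> \<Lambda>" if "i \<in> A" "j \<in> A" for i j
    using that d\<Lambda> by (auto simp: X_def)
  have finE: "finite E" unfolding E_def using fin fin\<Lambda> by (auto intro!: finite_PiE)
  have \<iota>E: "\<iota> a \<in> E" if "a \<in> A" for a
    using that d\<Lambda> by (auto simp: \<iota>_def E_def X_def)
  have Xsd: "symdiff (X i j) (X j i) = {\<delta> i j}" if "i \<in> A" "j \<in> A" "i \<noteq> j" for i j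
  proof -
    have "r i \<noteq> r j" using r that by (auto dest: inj_onD)
    moreover have "\<delta> i j = \<delta> j i" using met that by (auto simp: metric_on_def)
    ultimately show ?thesis using that by (auto simp: X_def symdiff_def)
  qed
  have lsym: "l x y = l y x" for x y
    by (cases x; cases y) (auto simp: l_def symdiff_commute)
  have "extension_graph A \<delta> E l \<iota>"
    unfolding extension_graph_def partial_isometries_extend_def
  proof (intro conjI allI impI ballI)
    show "finite E" by fact
    show "\<iota> ` A \<subseteq> E" using \<iota>E by auto
    show "labelling E l"
      unfolding labelling_def
    proof (intro ballI conjI)
      fix x y show "l x y = l y x" by (rule lsym)
      show "0 \<le> l x y" using \<Lambda>0 by (cases x; cases y) (auto simp: l_def)
      show "l x x = 0" by (cases x) (auto simp: l_def)
    qed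
    show "l x y \<in> insert 0 (distances A \<delta>)" for x y
      by (cases x; cases y) (auto simp: l_def \<Lambda>_def)
    show "l (\<iota> a) (\<iota> b) = \<delta> a b" if ab: "a \<in> A" "b \<in> A" for a b
    proof (cases "a = b")
      case True thus ?thesis using met ab by (auto simp: l_def \<iota>_def metric_on_def)
    next
      case False
      thus ?thesis using Xsd[OF ab False] d\<Lambda>[OF ab] by (simp add: l_def \<iota>_def)
    qed
    fix C p assume p: "partial_isometry A \<delta> C p"
    have pinj: "inj_on p C"
    proof (rule inj_onI)
      fix x y assume xy: "x \<in> C" "y \<in> C" "p x = p y"
      hence A: "x \<in> A" "y \<in> A" "p x \<in> A" using p by (auto simp: partial_isometry_def)
      have "\<delta> (p x) (p y) = \<delta> x y" using p xy(1,2) unfolding partial_isometry_def by blast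
      moreover have "\<delta> (p x) (p y) = 0" using A met xy(3) by (simp add: metric_on_def)
      ultimately show "x = y" using A met unfolding metric_on_def by metis
    qed
    obtain \<pi> where \<pi>: "bij_betw \<pi> A A" "\<forall>a\<in>C. \<pi> a = p a"
      using extend_partial_permutation[OF fin, of C p] p pinj by (auto simp: partial_isometry_def)
    define \<rho> where "\<rho> = inv_into A \<pi>"
    have \<pi>A: "\<pi> a \<in> A" if "a \<in> A" for a using \<pi>(1) that by (auto simp: bij_betw_def)
    have \<rho>A: "\<rho> a \<in> A" "\<pi> (\<rho> a) = a" if "a \<in> A" for a
      using \<pi>(1) that by (auto simp: \<rho>_def bij_betw_def inv_into_into f_inv_into_f)
    have \<rho>\<pi> [simp]: "\<rho> (\<pi> a) = a" if "a \<in> A" for a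
      using \<pi>(1) that by (auto simp: \<rho>_def bij_betw_def)
    have CA: "C \<subseteq> A" using p by (auto simp: partial_isometry_def)
    \<comment> \<open>F i j corrects the valuation of i at j; where i and j both belong to C the two
        definitions agree because p preserves distances\<close>
    define F where "F i j = (if i = j then {} else if i \<in> C then symdiff (X i j) (X (\<pi> i) (\<pi> j))
       else if j \<in> C then symdiff (X j i) (X (\<pi> j) (\<pi> i)) else {})" for i j
    have Fsym: "F i j = F j i" if ij: "i \<in> A" "j \<in> A" for i j
    proof (cases "i \<in> C \<and> j \<in> C \<and> i \<noteq> j")
      case True
      have "\<pi> i \<noteq> \<pi> j" using True ij \<pi>(1) by (auto simp: bij_betw_def dest: inj_onD)
      hence "symdiff (X (\<pi> i) (\<pi> j)) (X (\<pi> j) (\<pi> i)) = {\<delta> (\<pi> i) (\<pi> j)}"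
        using Xsd ij \<pi>A by blast
      moreover have "\<delta> (\<pi> i) (\<pi> j) = \<delta> i j" using True \<pi> p by (auto simp: partial_isometry_def)
      moreover have "symdiff (X i j) (X j i) = {\<delta> i j}" using True Xsd ij by blast
      ultimately have "symdiff (X i j) (X j i) = symdiff (X (\<pi> i) (\<pi> j)) (X (\<pi> j) (\<pi> i))" by simp
      hence "symdiff (X i j) (X (\<pi> i) (\<pi> j)) = symdiff (X j i) (X (\<pi> j) (\<pi> i))" by (rule symdiff_swap)
      thus ?thesis using True by (auto simp: F_def)
    qed (auto simp: F_def)
    have F\<Lambda>: "F i j \<subseteq> \<Lambda>" if "i \<in> A" "j \<in> A" for i j
      using that \<pi>A X\<Lambda> by (simp add: F_def symdiff_subset)
    define \<theta> where "\<theta> = (\<lambda>(i, \<kappa>). (\<pi> i, \<lambda>j\<in>A. symdiff (\<kappa> (\<rho> j)) (F i (\<rho> j))))"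
    have \<theta>E: "\<theta> x \<in> E" if "x \<in> E" for x
    proof -
      obtain i \<kappa> where x: "x = (i, \<kappa>)" "i \<in> A" "\<kappa> \<in> A \<rightarrow>\<^sub>E Pow \<Lambda>" using \<open>x \<in> E\<close> unfolding E_def by blast
      have "symdiff (\<kappa> (\<rho> j)) (F i (\<rho> j)) \<subseteq> \<Lambda>" if "j \<in> A" for j
        using PiE_mem[OF x(3) \<rho>A(1)[OF that]] F\<Lambda>[OF x(2) \<rho>A(1)[OF that]]
        by (simp add: symdiff_subset)
      thus ?thesis using x \<pi>A by (auto simp: \<theta>_def E_def)
    qed
    have inj: "inj_on \<theta> E"
    proof (rule inj_onI)
      fix x y assume xy: "x \<in> E" "y \<in> E" "\<theta> x = \<theta> y"
      obtain i \<kappa> j \<kappa>' where x: "x = (i, \<kappa>)" "i \<in> A" "\<kappa> \<in> A \<rightarrow>\<^sub>E Pow \<Lambda>"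
          "y = (j, \<kappa>')" "j \<in> A" "\<kappa>' \<in> A \<rightarrow>\<^sub>E Pow \<Lambda>"
        using xy unfolding E_def by blast
      have "\<pi> i = \<pi> j" using xy x by (auto simp: \<theta>_def)
      hence ij: "i = j" using x \<pi>(1) by (auto simp: bij_betw_def dest: inj_onD)
      have "\<kappa> a = \<kappa>' a" if a: "a \<in> A" for a
      proof -
        have "(\<lambda>j\<in>A. symdiff (\<kappa> (\<rho> j)) (F i (\<rho> j))) (\<pi> a) = (\<lambda>j\<in>A. symdiff (\<kappa>' (\<rho> j)) (F i (\<rho> j))) (\<pi> a)"
          using xy(3) x ij by (auto simp: \<theta>_def)
        hence "symdiff (\<kappa> a) (F i a) = symdiff (\<kappa>' a) (F i a)"
          using \<pi>A a by simp
        thus ?thesis by (simp add: symdiff_cancel_right)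
      qed
      hence "\<kappa> = \<kappa>'" using x by (auto intro: PiE_ext)
      thus "x = y" using x ij by simp
    qed
    show "\<exists>\<theta>. bij_betw \<theta> E E \<and> (\<forall>x\<in>E. \<forall>y\<in>E. l (\<theta> x) (\<theta> y) = l x y) \<and>
             (\<forall>a\<in>C. \<theta> (\<iota> a) = \<iota> (p a))"
    proof (intro exI[of _ \<theta>] conjI ballI)
      show "bij_betw \<theta> E E"
        using inj \<theta>E finE by (simp add: bij_betw_def endo_inj_surj image_subsetI)
      fix x y assume xy: "x \<in> E" "y \<in> E"
      obtain i \<kappa> j \<kappa>' where x: "x = (i, \<kappa>)" "i \<in> A" "y = (j, \<kappa>')" "j \<in> A"
        using xy unfolding E_def by blast
      have "\<pi> i = \<pi> j \<longleftrightarrow> i = j" using x \<pi>(1) by (auto simp: bij_betw_def dest: inj_onD)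
      moreover have "symdiff (symdiff (\<kappa> j) (F i j)) (symdiff (\<kappa>' i) (F j i)) = symdiff (\<kappa> j) (\<kappa>' i)"
        using Fsym[of i j] x by (simp add: symdiff_cancel2)
      ultimately show "l (\<theta> x) (\<theta> y) = l x y"
        using x \<pi>A by (simp add: l_def \<theta>_def)
    next
      fix a assume a: "a \<in> C"
      have "symdiff (X a (\<rho> j)) (F a (\<rho> j)) = X (\<pi> a) j" if j: "j \<in> A" for j
      proof (cases "a = \<rho> j")
        case True
        hence "\<pi> a = j" using j \<rho>A by auto
        thus ?thesis using True a CA j by (auto simp: F_def X_def symdiff_def)
      next
        case False
        hence "F a (\<rho> j) = symdiff (X a (\<rho> j)) (X (\<pi> a) j)" using a j \<rho>A by (simp add: F_def)
        thus ?thesis by (simp add: symdiff_cancel)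
      qed
      hence "(\<lambda>j\<in>A. symdiff (X a (\<rho> j)) (F a (\<rho> j))) = X (\<pi> a)"
        by (auto simp: X_def fun_eq_iff)
      thus "\<theta> (\<iota> a) = \<iota> (p a)" using a \<pi> by (simp add: \<theta>_def \<iota>_def)
    qed
  qed
  moreover from this have "no_shortcuts E l 2" by (auto simp: extension_graph_def intro: no_shortcuts_2)
  ultimately show ?thesis by (rule extension_graph_transfer)
qed

lemma walk_Cons: "w \<noteq> [] \<Longrightarrow> walk l (x # w) \<longleftrightarrow> 0 < l x (hd w) \<and> walk l w"
  and walk_length_Cons: "w \<noteq> [] \<Longrightarrow> walk_length l (x # w) = l x (hd w) + walk_length l w"
  by (cases w; simp)+

text \<open>
  The shortcuts that remain are the walks in \<open>W\<close>: \<open>k\<close> edges that together are shorter than the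
  edge between their ends. Take a double cover along each of them. A vertex of the new graph is a vertex of the old one
  with a choice of one of two sheets for every \<open>w \<in> W\<close>; an edge within \<open>w\<close> stays on its
  sheet unless it joins the ends of \<open>w\<close>, in which case it changes the sheet. A lift of \<open>w\<close>
  therefore starts and ends on the same sheet and is not closed by an edge.
\<close>

lemma extension_graph_unwind:
  fixes E :: "'e set"
  assumes met: "metric_on A \<delta>" and ext: "extension_graph A \<delta> E l \<iota>"
    and short: "no_shortcuts E l k" and k: "1 \<le> k"
  shows "\<exists>(E' :: nat set) l' \<iota>'. extension_graph A \<delta> E' l' \<iota>' \<and> no_shortcuts E' l' (Suc k)"
proof -
  note a = extension_graphD(1-5)[OF ext] and autom = extension_graphD(6)[OF ext]
  have \<iota>E: "\<iota> a \<in> E" if "a \<in> A" for a using a(2) that by auto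
  have lsym: "l x y = l y x" and lnn: "0 \<le> l x y" and l0: "l x x = 0"
    if "x \<in> E" "y \<in> E" for x y using a(3) that by (auto simp: labelling_def)
  define W where "W = {w. set w \<subseteq> E \<and> length w = Suc k \<and> walk l w \<and> walk_length l w < l (hd w) (last w)}"
  have finW: "finite W"
    by (rule finite_subset[OF _ finite_lists_length_eq[OF a(1), of "Suc k"]]) (auto simp: W_def)
  have WE: "set w \<subseteq> E" "w \<noteq> []" "hd w \<in> E" "last w \<in> E" "walk l w"
      "walk_length l w < l (hd w) (last w)" "length w = Suc k" if "w \<in> W" for w
  proof -
    show 1: "set w \<subseteq> E" "w \<noteq> []" "walk l w" "walk_length l w < l (hd w) (last w)" "length w = Suc k"
      using that by (auto simp: W_def)
    show "hd w \<in> E" "last w \<in> E" using 1 by auto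
  qed
  define admissible :: "'e \<times> ('e list \<Rightarrow> bool) \<Rightarrow> 'e \<times> ('e list \<Rightarrow> bool) \<Rightarrow> bool" where
    "admissible = (\<lambda>(v, \<kappa>) (v', \<kappa>'). \<forall>w\<in>W. v \<in> set w \<and> v' \<in> set w \<longrightarrow>
      ((\<kappa> w \<noteq> \<kappa>' w) \<longleftrightarrow> {v, v'} = {hd w, last w}))"
  have admD: "(snd x w \<noteq> snd y w) \<longleftrightarrow> {fst x, fst y} = {hd w, last w}"
    if "admissible x y" "w \<in> W" "fst x \<in> set w" "fst y \<in> set w" for x y w
    using that unfolding admissible_def case_prod_beta by blast
  define E' :: "('e \<times> ('e list \<Rightarrow> bool)) set" where "E' = E \<times> (W \<rightarrow>\<^sub>E UNIV)"
  define l' where "l' x y = (if admissible x y then l (fst x) (fst y) else 0)"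
    for x y :: "'e \<times> ('e list \<Rightarrow> bool)"
  \<comment> \<open>the sheets on which A is placed: of two ends of w in A, only the last one is on the marked sheet\<close>
  define X where "X a = (\<lambda>w\<in>W. \<iota> a = last w \<and> hd w \<in> \<iota> ` A)" for a
  define \<iota>' where "\<iota>' a = (\<iota> a, X a)" for a
  have adm_sym: "admissible x y = admissible y x" for x y
    by (cases x; cases y) (simp only: admissible_def prod.case insert_commute conj_commute eq_commute)
  have \<iota>'E: "\<iota>' a \<in> E'" if "a \<in> A" for a using \<iota>E that by (auto simp: \<iota>'_def E'_def X_def)
  have \<iota>inj: "a = b" if "a \<in> A" "b \<in> A" "\<iota> a = \<iota> b" for a b
  proof -
    have "\<delta> a b = 0" using a(5)[OF that(1,2)] that l0[OF \<iota>E \<iota>E, of a a] by simp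
    thus ?thesis using met that unfolding metric_on_def by blast
  qed
  \<comment> \<open>if both ends of w are in A, a third point of A on w would split w into two walks with at most k
      vertices; these are no shortcuts, so neither is w by the triangle inequality in A\<close>
  have three: False
    if t: "w \<in> W" "hd w = \<iota> a" "last w = \<iota> b" "\<iota> c \<in> set w" "a \<in> A" "b \<in> A" "c \<in> A"
       "c \<noteq> a" "c \<noteq> b" for w a b c
  proof -
    obtain u v where w: "w = u @ \<iota> c # v" using split_list[OF t(4)] by blast
    have "u \<noteq> []" using w that \<iota>inj by (cases u) auto
    have "v \<noteq> []" using w that \<iota>inj by (cases v rule: rev_cases) auto
    note ww = WE[OF that(1)]
    have walks: "walk l (u @ [\<iota> c])" "walk l (\<iota> c # v)" using ww(5) w walk_split by metis+
    have "set (u @ [\<iota> c]) \<subseteq> E \<and> u @ [\<iota> c] \<noteq> [] \<and> length (u @ [\<iota> c]) \<le> k \<and> walk l (u @ [\<iota> c])"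
      using ww w walks \<open>v \<noteq> []\<close> by (cases v) auto
    hence "l (hd (u @ [\<iota> c])) (last (u @ [\<iota> c])) \<le> walk_length l (u @ [\<iota> c])"
      using short unfolding no_shortcuts_def by blast
    moreover have "hd (u @ [\<iota> c]) = \<iota> a" using w \<open>u \<noteq> []\<close> that by auto
    ultimately have 1: "\<delta> a c \<le> walk_length l (u @ [\<iota> c])" using a(5) that by simp
    have "set (\<iota> c # v) \<subseteq> E \<and> \<iota> c # v \<noteq> [] \<and> length (\<iota> c # v) \<le> k \<and> walk l (\<iota> c # v)"
      using ww w walks \<open>u \<noteq> []\<close> by (cases u) auto
    hence "l (hd (\<iota> c # v)) (last (\<iota> c # v)) \<le> walk_length l (\<iota> c # v)"
      using short unfolding no_shortcuts_def by blast
    moreover have "last (\<iota> c # v) = \<iota> b" using w that by auto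
    ultimately have 2: "\<delta> c b \<le> walk_length l (\<iota> c # v)" using a(5) that by simp
    have "\<delta> a b \<le> \<delta> a c + \<delta> c b" using met that unfolding metric_on_def by blast
    hence "l (hd w) (last w) \<le> walk_length l w"
      using 1 2 a(5) that w walk_length_split[of l u "\<iota> c" v] by simp
    thus False using ww(6) by simp
  qed
  have Xadm: "admissible (\<iota>' a) (\<iota>' b)" if ab: "a \<in> A" "b \<in> A" "a \<noteq> b" for a b
  proof -
    have "(X a w \<noteq> X b w) \<longleftrightarrow> {\<iota> a, \<iota> b} = {hd w, last w}"
      if w: "w \<in> W" "\<iota> a \<in> set w" "\<iota> b \<in> set w" for w
    proof (cases "last w = \<iota> a \<and> hd w \<in> \<iota> ` A")
      case True
      then obtain c where c: "c \<in> A" "hd w = \<iota> c" by blast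
      have "c \<noteq> a" using WE(6)[OF w(1)] True c l0[OF \<iota>E \<iota>E, of a a] walk_length_nonneg[OF WE(5)[OF w(1)]] ab
        by auto
      moreover have "c = b \<or> b = a" using three[of w c a b] w ab c True by auto
      ultimately have "c = b" using ab by auto
      thus ?thesis using True c w \<iota>inj[OF ab(1,2)] ab by (auto simp: X_def)
    next
      case False
      show ?thesis
      proof (cases "last w = \<iota> b \<and> hd w \<in> \<iota> ` A")
        case True
        then obtain c where c: "c \<in> A" "hd w = \<iota> c" by blast
        have "c \<noteq> b" using WE(6)[OF w(1)] True c l0[OF \<iota>E \<iota>E, of b b] walk_length_nonneg[OF WE(5)[OF w(1)]] ab
          by auto
        moreover have "c = a \<or> a = b" using three[of w c b a] w ab c True by auto
        ultimately have "c = a" using ab by auto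
        thus ?thesis using True c w \<iota>inj[OF ab(1,2)] ab by (auto simp: X_def)
      next
        case F2: False
        have "\<not> X a w" "\<not> X b w" using False F2 w by (auto simp: X_def)
        moreover have "{\<iota> a, \<iota> b} \<noteq> {hd w, last w}"
          unfolding doubleton_eq_iff
          using False F2 imageI[OF ab(1), of \<iota>] imageI[OF ab(2), of \<iota>] by metis
        ultimately show ?thesis by simp
      qed
    qed
    thus ?thesis by (auto simp: admissible_def \<iota>'_def)
  qed
  have "extension_graph A \<delta> E' l' \<iota>'"
    unfolding extension_graph_def partial_isometries_extend_def
  proof (intro conjI allI impI ballI)
    show "finite E'" unfolding E'_def using a(1) finW by (auto intro!: finite_PiE)
    show "\<iota>' ` A \<subseteq> E'" using \<iota>'E by auto
    show "labelling E' l'"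
      using lsym lnn l0 by (auto simp: labelling_def l'_def adm_sym E'_def)
    show "l' x y \<in> insert 0 (distances A \<delta>)" if "x \<in> E'" "y \<in> E'" for x y
      using a(4)[of "fst x" "fst y"] that by (auto simp: l'_def E'_def)
    show "l' (\<iota>' a) (\<iota>' b) = \<delta> a b" if ab: "a \<in> A" "b \<in> A" for a b
    proof (cases "a = b")
      case True
      hence "\<delta> a b = 0" using met ab unfolding metric_on_def by blast
      thus ?thesis using True l0[OF \<iota>E \<iota>E, of a a] ab by (simp add: l'_def \<iota>'_def)
    next
      case False thus ?thesis using Xadm ab a(5) by (simp add: l'_def) (simp add: \<iota>'_def)
    qed
    fix C p assume p: "partial_isometry A \<delta> C p"
    from autom[OF p] obtain \<theta> where \<theta>: "bij_betw \<theta> E E" "\<forall>x\<in>E. \<forall>y\<in>E. l (\<theta> x) (\<theta> y) = l x y"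
      "\<forall>a\<in>C. \<theta> (\<iota> a) = \<iota> (p a)" by blast
    have CA: "C \<subseteq> A" "p ` C \<subseteq> A" using p by (auto simp: partial_isometry_def)
    define \<rho> where "\<rho> = inv_into E \<theta>"
    have \<theta>E: "\<theta> x \<in> E" if "x \<in> E" for x using \<theta>(1) that by (auto simp: bij_betw_def)
    have \<rho>E: "\<rho> x \<in> E" "\<theta> (\<rho> x) = x" if "x \<in> E" for x
      using \<theta>(1) that by (auto simp: \<rho>_def bij_betw_def inv_into_into f_inv_into_f)
    have \<rho>\<theta>: "\<rho> (\<theta> x) = x" if "x \<in> E" for x
      using \<theta>(1) that by (auto simp: \<rho>_def bij_betw_def)
    have l\<rho>: "l (\<rho> x) (\<rho> y) = l x y" if "x \<in> E" "y \<in> E" for x y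
      using \<theta>(2) \<rho>E that by metis
    have W\<theta>: "map \<theta> w \<in> W" if "w \<in> W" for w
    proof -
      note ww = WE[OF that]
      have "walk l (map \<theta> w) = walk l w" "walk_length l (map \<theta> w) = walk_length l w"
        by (rule walk_map; use \<theta>(2) ww(1) in blast)+
      thus ?thesis using ww \<theta>(2) \<theta>E by (auto simp: W_def hd_map last_map)
    qed
    have W\<rho>: "map \<rho> w \<in> W" if "w \<in> W" for w
    proof -
      note ww = WE[OF that]
      have "walk l (map \<rho> w) = walk l w" "walk_length l (map \<rho> w) = walk_length l w"
        by (rule walk_map; use l\<rho> ww(1) in blast)+
      thus ?thesis using ww l\<rho> \<rho>E by (auto simp: W_def hd_map last_map)
    qed
    have \<theta>\<rho>w: "map \<theta> (map \<rho> w) = w" and \<rho>\<theta>w: "map \<rho> (map \<theta> w) = w" if "w \<in> W" for w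
      using WE(1)[OF that] \<rho>E \<rho>\<theta> by (auto simp: subset_iff intro!: map_idI)
    \<comment> \<open>the sheets over w are exchanged if the image of some point of C on w requires it; all such
        points agree, because whether two of them lie on the same sheet depends only on whether
        they are the ends of w, and \<theta> preserves this\<close>
    define flip where "flip w \<longleftrightarrow> (\<exists>a\<in>C. \<iota> a \<in> set w \<and> X a w \<noteq> X (p a) (map \<theta> w))" for w
    have flip: "flip w \<longleftrightarrow> X a w \<noteq> X (p a) (map \<theta> w)" if w: "w \<in> W" "a \<in> C" "\<iota> a \<in> set w" for a w
    proof -
      have "(X a w \<noteq> X (p a) (map \<theta> w)) = (X b w \<noteq> X (p b) (map \<theta> w))"
        if b: "b \<in> C" "\<iota> b \<in> set w" for b
      proof (cases "a = b")
        case False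
        have ab: "a \<in> A" "b \<in> A" "p a \<in> A" "p b \<in> A" using w b CA by auto
        have pab: "p a \<noteq> p b"
        proof
          assume "p a = p b"
          hence "\<theta> (\<iota> a) = \<theta> (\<iota> b)" using \<theta>(3) w b by simp
          hence "\<iota> a = \<iota> b" using \<rho>\<theta> \<iota>E ab by metis
          thus False using \<iota>inj ab False by blast
        qed
        have 1: "(X a w \<noteq> X b w) \<longleftrightarrow> {\<iota> a, \<iota> b} = {hd w, last w}"
          using Xadm[OF ab(1,2) False] w b by (auto simp: admissible_def \<iota>'_def)
        have m: "\<iota> (p a) \<in> set (map \<theta> w)" "\<iota> (p b) \<in> set (map \<theta> w)"
          using w b \<theta>(3) by force+
        have 2: "(X (p a) (map \<theta> w) \<noteq> X (p b) (map \<theta> w)) \<longleftrightarrow>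
            {\<iota> (p a), \<iota> (p b)} = {hd (map \<theta> w), last (map \<theta> w)}"
          using Xadm[OF ab(3,4) pab] W\<theta>[OF w(1)] m unfolding admissible_def \<iota>'_def prod.case by blast
        have "{\<iota> (p a), \<iota> (p b)} = \<theta> ` {\<iota> a, \<iota> b}" using \<theta>(3) w b by auto
        moreover have "{hd (map \<theta> w), last (map \<theta> w)} = \<theta> ` {hd w, last w}"
          using WE[OF w(1)] by (simp add: hd_map last_map)
        moreover have "\<theta> ` {\<iota> a, \<iota> b} = \<theta> ` {hd w, last w} \<longleftrightarrow> {\<iota> a, \<iota> b} = {hd w, last w}"
          by (rule inj_on_image_eq_iff[of \<theta> E]) (use \<theta>(1) \<iota>E ab WE[OF w(1)] in \<open>auto simp: bij_betw_def\<close>)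
        ultimately have "{\<iota> (p a), \<iota> (p b)} = {hd (map \<theta> w), last (map \<theta> w)} \<longleftrightarrow>
            {\<iota> a, \<iota> b} = {hd w, last w}" by simp
        thus ?thesis using 1 2 by blast
      qed simp
      thus ?thesis using w unfolding flip_def by blast
    qed
    define \<Theta> where "\<Theta> = (\<lambda>(v, \<kappa>). (\<theta> v, \<lambda>w\<in>W. \<kappa> (map \<rho> w) \<noteq> (\<theta> v \<in> set w \<and> flip (map \<rho> w))))"
    have \<Theta>E: "\<Theta> x \<in> E'" if "x \<in> E'" for x
      using that \<theta>E by (auto simp: \<Theta>_def E'_def)
    have inj: "inj_on \<Theta> E'"
    proof (rule inj_onI)
      fix x y assume xy: "x \<in> E'" "y \<in> E'" "\<Theta> x = \<Theta> y"
      obtain i \<kappa> j \<kappa>' where x: "x = (i, \<kappa>)" "i \<in> E" "\<kappa> \<in> W \<rightarrow>\<^sub>E UNIV"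
          "y = (j, \<kappa>')" "j \<in> E" "\<kappa>' \<in> W \<rightarrow>\<^sub>E UNIV"
        using xy unfolding E'_def by blast
      have "\<theta> i = \<theta> j" using xy x by (auto simp: \<Theta>_def)
      hence ij: "i = j" using x \<rho>\<theta> by metis
      have "\<kappa> w = \<kappa>' w" if w: "w \<in> W" for w
      proof -
        have "snd (\<Theta> x) (map \<theta> w) = snd (\<Theta> y) (map \<theta> w)" using xy by simp
        thus ?thesis using W\<theta>[OF w] \<rho>\<theta>w[OF w] x ij by (auto simp: \<Theta>_def simp del: map_map)
      qed
      hence "\<kappa> = \<kappa>'" using x by (auto intro: PiE_ext)
      thus "x = y" using x ij by simp
    qed
    show "\<exists>\<theta>. bij_betw \<theta> E' E' \<and> (\<forall>x\<in>E'. \<forall>y\<in>E'. l' (\<theta> x) (\<theta> y) = l' x y) \<and>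
             (\<forall>a\<in>C. \<theta> (\<iota>' a) = \<iota>' (p a))"
    proof (intro exI[of _ \<Theta>] conjI ballI)
      have "finite E'" unfolding E'_def using a(1) finW by (auto intro!: finite_PiE)
      thus "bij_betw \<Theta> E' E'"
        using inj \<Theta>E by (simp add: bij_betw_def endo_inj_surj image_subsetI)
      fix x y assume xy: "x \<in> E'" "y \<in> E'"
      obtain i \<kappa> j \<kappa>' where x: "x = (i, \<kappa>)" "i \<in> E" "y = (j, \<kappa>')" "j \<in> E"
        using xy unfolding E'_def by blast
      define R where "R w \<longleftrightarrow> (i \<in> set w \<and> j \<in> set w \<longrightarrow> ((\<kappa> w \<noteq> \<kappa>' w) \<longleftrightarrow> {i, j} = {hd w, last w}))" for w
      define R' where "R' w \<longleftrightarrow> (\<theta> i \<in> set w \<and> \<theta> j \<in> set w \<longrightarrow>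
          ((snd (\<Theta> x) w \<noteq> snd (\<Theta> y) w) \<longleftrightarrow> {\<theta> i, \<theta> j} = {hd w, last w}))" for w
      have RR: "R' (map \<theta> w) = R w" if w: "w \<in> W" for w
      proof -
        have inj\<theta>: "inj_on \<theta> E" using \<theta>(1) by (simp add: bij_betw_def)
        have m: "\<theta> v \<in> set (map \<theta> w) \<longleftrightarrow> v \<in> set w" if "v \<in> E" for v
          using inj_on_image_mem_iff[OF inj\<theta> that WE(1)[OF w]] by simp
        have e: "{\<theta> i, \<theta> j} = {hd (map \<theta> w), last (map \<theta> w)} \<longleftrightarrow> \<theta> ` {i, j} = \<theta> ` {hd w, last w}"
          using WE(2)[OF w] by (simp add: hd_map last_map)
        have e': "\<theta> ` {i, j} = \<theta> ` {hd w, last w} \<longleftrightarrow> {i, j} = {hd w, last w}"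
          by (rule inj_on_image_eq_iff[OF inj\<theta>]) (use x WE[OF w] in auto)
        have s: "snd (\<Theta> x) (map \<theta> w) = (\<kappa> w \<noteq> (i \<in> set w \<and> flip w))"
            "snd (\<Theta> y) (map \<theta> w) = (\<kappa>' w \<noteq> (j \<in> set w \<and> flip w))"
          using W\<theta>[OF w] \<rho>\<theta>w[OF w] x m by (simp_all add: \<Theta>_def del: map_map set_map)
        show ?thesis unfolding R_def R'_def m[OF x(2)] m[OF x(4)] e e' s by argo
      qed
      have "admissible (\<Theta> x) (\<Theta> y) \<longleftrightarrow> (\<forall>w\<in>W. R' w)"
        using x by (simp add: admissible_def \<Theta>_def R'_def)
      also have "\<dots> \<longleftrightarrow> (\<forall>w\<in>W. R w)" using RR W\<theta> W\<rho> \<theta>\<rho>w by metis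
      also have "\<dots> \<longleftrightarrow> admissible x y" using x by (simp add: admissible_def R_def)
      finally show "l' (\<Theta> x) (\<Theta> y) = l' x y"
        using x \<theta>(2) by (simp add: l'_def) (simp add: \<Theta>_def)
    next
      fix a assume aC: "a \<in> C"
      have "(X a (map \<rho> w) \<noteq> (\<theta> (\<iota> a) \<in> set w \<and> flip (map \<rho> w))) = X (p a) w" if w: "w \<in> W" for w
      proof (cases "\<theta> (\<iota> a) \<in> set w")
        case True
        have "\<rho> (\<theta> (\<iota> a)) \<in> \<rho> ` set w" using True by blast
        hence "\<iota> a \<in> set (map \<rho> w)" using \<rho>\<theta> \<iota>E CA aC by auto
        from flip[OF W\<rho>[OF w] aC this] show ?thesis using True \<theta>\<rho>w[OF w] by auto
      next
        case False
        have "\<iota> (p a) \<noteq> last w" using False \<theta>(3) aC WE(2)[OF w] by auto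
        moreover have "\<iota> a \<noteq> last (map \<rho> w)"
        proof
          assume "\<iota> a = last (map \<rho> w)"
          hence "\<theta> (\<iota> a) = last w" using WE[OF w] \<rho>E(2) by (simp add: last_map)
          thus False using False WE(2)[OF w] by auto
        qed
        ultimately show ?thesis using False w W\<rho>[OF w] by (simp add: X_def)
      qed
      hence "(\<lambda>w\<in>W. X a (map \<rho> w) \<noteq> (\<theta> (\<iota> a) \<in> set w \<and> flip (map \<rho> w))) = X (p a)"
        by (auto simp: X_def fun_eq_iff)
      thus "\<Theta> (\<iota>' a) = \<iota>' (p a)" using aC \<theta>(3) by (simp add: \<Theta>_def \<iota>'_def)
    qed
  qed
  moreover have "no_shortcuts E' l' (Suc k)"
    unfolding no_shortcuts_def
  proof (intro allI impI, rule ccontr)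
    fix V assume V: "set V \<subseteq> E' \<and> V \<noteq> [] \<and> length V \<le> Suc k \<and> walk l' V"
      and bad: "\<not> l' (hd V) (last V) \<le> walk_length l' V"
    have proj: "walk l (map fst U) \<and> walk_length l (map fst U) = walk_length l' U" if "walk l' U" for U
      using that
    proof (induction U)
      case (Cons x U)
      show ?case
      proof (cases U)
        case (Cons y U')
        thus ?thesis using Cons.IH Cons.prems by (auto simp: l'_def split: if_splits)
      qed simp
    qed simp
    let ?w = "map fst V"
    have adm: "admissible (hd V) (last V)" and lw: "l' (hd V) (last V) = l (hd ?w) (last ?w)"
    proof -
      have "0 < l' (hd V) (last V)" using bad walk_length_nonneg[of l' V] V by auto
      thus "admissible (hd V) (last V)" by (auto simp: l'_def split: if_splits)
      thus "l' (hd V) (last V) = l (hd ?w) (last ?w)" using V by (simp add: l'_def hd_map last_map)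
    qed
    have wE: "set ?w \<subseteq> E" using V by (auto simp: E'_def)
    have wbad: "walk_length l ?w < l (hd ?w) (last ?w)" using bad lw proj[of V] V by auto
    have "length ?w = Suc k"
    proof (rule ccontr)
      assume "length ?w \<noteq> Suc k"
      hence "set ?w \<subseteq> E \<and> ?w \<noteq> [] \<and> length ?w \<le> k \<and> walk l ?w" using V wE proj[of V] by auto
      thus False using short wbad unfolding no_shortcuts_def by fastforce
    qed
    hence wW: "?w \<in> W" using wE wbad proj[of V] V by (auto simp: W_def)
    \<comment> \<open>along the walk the sheet does not change, but its closing edge changes it\<close>
    have const: "snd (hd U) ?w = snd (last U) ?w"
      if "walk l' U" "U \<noteq> []" "fst ` set U \<subseteq> set ?w" "walk_length l (map fst U) < l (hd ?w) (last ?w)" for U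
      using that
    proof (induction U)
      case (Cons x U)
      show ?case
      proof (cases "U = []")
        case False
        have p: "walk l (map fst (x # U))" using proj Cons.prems by blast
        have 1: "0 < l' x (hd U)" "walk l' U" using Cons.prems False by (auto simp: walk_Cons)
        have 2: "l (fst x) (fst (hd U)) + walk_length l (map fst U) < l (hd ?w) (last ?w)"
          using Cons.prems(4) False by (simp add: walk_length_Cons hd_map)
        have 3: "0 < l (fst x) (fst (hd U))" "walk l (map fst U)"
          using p False by (auto simp: walk_Cons hd_map)
        have 4: "fst x \<in> set ?w" "fst (hd U) \<in> set ?w" using Cons.prems(3) False by auto
        have "{fst x, fst (hd U)} \<noteq> {hd ?w, last ?w}"
        proof
          assume "{fst x, fst (hd U)} = {hd ?w, last ?w}"
          hence "l (fst x) (fst (hd U)) = l (hd ?w) (last ?w)"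
            using lsym[of "hd ?w" "last ?w"] WE(3,4)[OF wW] by (auto simp: doubleton_eq_iff)
          thus False using 2 walk_length_nonneg[OF 3(2)] by linarith
        qed
        moreover have "admissible x (hd U)" using 1 by (auto simp: l'_def split: if_splits)
        ultimately have "snd x ?w = snd (hd U) ?w"
          using admD[of x "hd U", OF _ wW 4] by blast
        moreover have "snd (hd U) ?w = snd (last U) ?w"
          using Cons.IH 1 2 3 False Cons.prems by auto
        ultimately show ?thesis using False by simp
      qed simp
    qed simp
    have "snd (hd V) ?w = snd (last V) ?w"
      by (rule const) (use V wbad in auto)
    moreover have "fst (hd V) = hd ?w" "fst (last V) = last ?w" using V by (auto simp: hd_map last_map)
    moreover have "hd ?w \<in> set ?w" "last ?w \<in> set ?w"
      using hd_in_set[of ?w] last_in_set[of ?w] V by (simp_all del: set_map)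
    ultimately show False using admD[of "hd V" "last V", OF adm wW] by simp
  qed
  ultimately show ?thesis by (rule extension_graph_transfer)
qed

lemma finite_positive_gap:
  fixes \<delta> :: "'a \<Rightarrow> 'a \<Rightarrow> real"
  assumes "finite M"
  obtains \<mu> where "0 < \<mu>" "\<And>x y. x \<in> M \<Longrightarrow> y \<in> M \<Longrightarrow> 0 < \<delta> x y \<Longrightarrow> \<mu> \<le> \<delta> x y"
proof -
  \<comment> \<open>1 serves as the gap if no value is positive\<close>
  let ?W = "insert 1 {d \<in> (\<lambda>(x, y). \<delta> x y) ` (M \<times> M). 0 < d}"
  have fin: "finite ?W" using assms by simp
  have pos: "0 < Min ?W" using fin by (subst Min_gr_iff) auto
  have "Min ?W \<le> \<delta> x y" if "x \<in> M" "y \<in> M" "0 < \<delta> x y" for x y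
    by (rule Min_le[OF fin]) (use that in force)
  thus thesis using that[of "Min ?W"] pos by blast
qed

lemma multiple_above:
  fixes S :: "real set"
  assumes "finite W" and S: "0 \<in> S" "\<And>s t. s \<in> S \<Longrightarrow> t \<in> S \<Longrightarrow> s + t \<in> S" "s0 \<in> S" "0 < s0"
  obtains M where "M \<in> S" "0 < M" "\<And>w. w \<in> W \<Longrightarrow> w < M"
proof -
  have mult: "real n * s0 \<in> S" for n
    by (induction n) (use S in \<open>auto simp: algebra_simps\<close>)
  obtain n :: nat where n: "Max (insert 0 W) / s0 < real n" using reals_Archimedean2 by blast
  hence M: "Max (insert 0 W) < real n * s0" using S(4) by (simp add: field_simps)
  have "w < real n * s0" if "w \<in> insert 0 W" for w
    by (rule le_less_trans[OF Max_ge M]) (use assms(1) that in auto)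
  thus thesis using that[of "real n * s0"] mult by blast
qed

lemma walk_rev:
  assumes "\<And>x y. x \<in> set w \<Longrightarrow> y \<in> set w \<Longrightarrow> l x y = l y x"
  shows "walk l (rev w) = walk l w \<and> walk_length l (rev w) = walk_length l w"
  using assms
proof (induction l w rule: walk.induct)
  case (1 l x y w)
  have "rev (x # y # w) = rev w @ y # [x]" by simp
  moreover have "walk l (rev (y # w)) = walk l (y # w) \<and> walk_length l (rev (y # w)) = walk_length l (y # w)"
    using 1 by auto
  moreover have "l x y = l y x" using 1 by auto
  ultimately show ?case
    using walk_split[of l "rev w" y "[x]"] walk_length_split[of l "rev w" y "[x]"] by auto
qed auto

lemma extension_graph_no_shortcuts:
  assumes "finite A" "metric_on A \<delta>"
  shows "\<exists>(E :: nat set) l \<iota>. extension_graph A \<delta> E l \<iota> \<and> no_shortcuts E l (k + 2)"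
proof (induction k)
  case 0
  show ?case using extension_graph_exists[OF assms] by (simp only: add_0)
next
  case (Suc k)
  then obtain E :: "nat set" and l \<iota> where "extension_graph A \<delta> E l \<iota>" "no_shortcuts E l (k + 2)" by blast
  from extension_graph_unwind[OF assms(2) this] show ?case by (simp only: add_Suc le_add2[of 1] one_le_numeral trans_le_add2 simp_thms)
qed

text \<open>
  The path metric of an extension graph, capped at a value \<open>M\<close> above all distances in \<open>A\<close>.
  Since positive labels are at least \<open>\<mu>\<close>, walks with \<open>k\<close> edges are at least as long as the
  cap once \<open>k * \<mu> \<ge> M\<close>, so finitely many unwindings remove every shortcut that could shrink a
  distance of \<open>A\<close>. The cap keeps the metric finite on a graph that may be disconnected, and it lies in
  \<open>S\<close>, as do all lengths of walks.
\<close>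

theorem metric_extension_property:
  fixes A :: "'a set"
  assumes fin: "finite A" and met: "metric_on A \<delta>"
    and S: "distances A \<delta> \<subseteq> S" "0 \<in> S" "\<And>s t. s \<in> S \<Longrightarrow> t \<in> S \<Longrightarrow> s + t \<in> S"
    and s0: "s0 \<in> S" "0 < s0"
  shows "\<exists>(E :: nat set) \<epsilon> \<iota>. finite E \<and> metric_on E \<epsilon> \<and> distances E \<epsilon> \<subseteq> S \<and> \<iota> ` A \<subseteq> E \<and>
     (\<forall>a\<in>A. \<forall>b\<in>A. \<epsilon> (\<iota> a) (\<iota> b) = \<delta> a b) \<and>
     partial_isometries_extend A \<delta> E \<epsilon> \<iota>"
proof -
  define \<Lambda> where "\<Lambda> = distances A \<delta>"
  have fin\<Lambda>: "finite \<Lambda>" using fin by (simp add: \<Lambda>_def distances_def)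
  obtain \<mu> where \<mu>: "0 < \<mu>" "\<And>x y. x \<in> A \<Longrightarrow> y \<in> A \<Longrightarrow> 0 < \<delta> x y \<Longrightarrow> \<mu> \<le> \<delta> x y"
    using finite_positive_gap[OF fin] by blast
  have \<mu>: "0 < \<mu>" "\<And>d. d \<in> \<Lambda> \<Longrightarrow> 0 < d \<Longrightarrow> \<mu> \<le> d"
    using \<mu> by (auto simp: \<Lambda>_def distances_def)
  obtain M where M: "M \<in> S" "0 < M" "\<And>d. d \<in> \<Lambda> \<Longrightarrow> d < M"
    using multiple_above[OF fin\<Lambda> S(2,3) s0] by blast
  obtain k0 :: nat where k0: "M / \<mu> < real k0" using reals_Archimedean2 by blast
  define k where "k = Suc k0"
  have "M < real k0 * \<mu>" using k0 \<mu> by (simp add: field_simps)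
  hence k: "M \<le> real k * \<mu>" "1 \<le> k" using \<mu> by (auto simp: k_def algebra_simps)
  obtain E :: "nat set" and l \<iota> where ext: "extension_graph A \<delta> E l \<iota>" and short: "no_shortcuts E l (k0 + 2)"
    using extension_graph_no_shortcuts[OF fin met] by blast
  note a = extension_graphD(1-5)[OF ext, folded \<Lambda>_def] and autom = extension_graphD(6)[OF ext]
  have lsym: "l x y = l y x" and lnn: "0 \<le> l x y" and l0: "l x x = 0"
    if "x \<in> E" "y \<in> E" for x y using a(3) that by (auto simp: labelling_def)
  have lM: "l x y \<le> M" if "x \<in> E" "y \<in> E" for x y
    using a(4)[OF that] M by (auto simp: less_imp_le)
  have long: "M \<le> walk_length l w" if "walk l w" "set w \<subseteq> E" "Suc k \<le> length w" for w
  proof -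
    have "real (length w - 1) * \<mu> \<le> walk_length l w"
    proof (rule walk_length_ge[OF that(1)])
      fix x y assume "x \<in> set w" "y \<in> set w" "0 < l x y"
      thus "\<mu> \<le> l x y" using a(4)[of x y] \<mu>(2)[of "l x y"] that by auto
    qed
    moreover have "real k * \<mu> \<le> real (length w - 1) * \<mu>" using that \<mu> by (intro mult_right_mono) auto
    ultimately show ?thesis using k by linarith
  qed
  have short': "l (hd w) (last w) \<le> walk_length l w" if "walk l w" "set w \<subseteq> E" "w \<noteq> []" for w
  proof (cases "length w \<le> Suc k")
    case True thus ?thesis using short that by (auto simp: no_shortcuts_def k_def)
  next
    case False
    have "hd w \<in> E" "last w \<in> E" using that by auto
    thus ?thesis using long[of w] False that lM[of "hd w" "last w"] by linarith
  qed
  define P where "P x y = {w. set w \<subseteq> E \<and> w \<noteq> [] \<and> walk l w \<and> hd w = x \<and> last w = y}" for x y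
  \<comment> \<open>long walks are omitted to have a minimum over a finite set; they are no shorter than M\<close>
  define Q where "Q x y = insert M (walk_length l ` {w \<in> P x y. length w \<le> Suc k})" for x y
  define \<epsilon> where "\<epsilon> x y = Min (Q x y)" for x y
  have finQ: "finite (Q x y)" for x y
  proof -
    have "{w \<in> P x y. length w \<le> Suc k} \<subseteq> {w. set w \<subseteq> E \<and> length w \<le> Suc k}" by (auto simp: P_def)
    thus ?thesis unfolding Q_def using finite_lists_length_le[OF a(1)] finite_subset by blast
  qed
  have \<epsilon>Q: "\<epsilon> x y \<in> Q x y" for x y unfolding \<epsilon>_def by (rule Min_in) (auto simp: finQ, simp add: Q_def)
  have \<epsilon>M: "\<epsilon> x y \<le> M" for x y unfolding \<epsilon>_def by (rule Min_le[OF finQ]) (simp add: Q_def)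
  have \<epsilon>P: "\<epsilon> x y \<le> walk_length l w" if "w \<in> P x y" for x y w
  proof (cases "length w \<le> Suc k")
    case True
    thus ?thesis unfolding \<epsilon>_def by (intro Min_le[OF finQ]) (use that in \<open>auto simp: Q_def\<close>)
  next
    case False
    thus ?thesis using long[of w] that \<epsilon>M[of x y] by (auto simp: P_def)
  qed
  have attained: "\<epsilon> x y = M \<or> (\<exists>w\<in>P x y. \<epsilon> x y = walk_length l w)" for x y
    using \<epsilon>Q[of x y] by (auto simp: Q_def)
  have nn: "0 \<le> \<epsilon> x y" for x y
    using attained[of x y] M(2) walk_length_nonneg by (fastforce simp: P_def)
  have pos: "0 < \<epsilon> x y" if "x \<noteq> y" for x y
  proof -
    have "0 < walk_length l w" if w: "w \<in> P x y" for w
    proof -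
      from w \<open>x \<noteq> y\<close> obtain a b w' where "w = a # b # w'"
        by (cases "(l, w)" rule: walk.cases) (auto simp: P_def)
      thus ?thesis using w walk_length_nonneg[of l "b # w'"] by (auto simp: P_def)
    qed
    thus ?thesis using attained[of x y] M by auto
  qed
  have metE: "metric_on E \<epsilon>"
    unfolding metric_on_def
  proof (intro conjI ballI)
    fix x y assume xy: "x \<in> E" "y \<in> E"
    show "0 \<le> \<epsilon> x y" by (rule nn)
    have "rev w \<in> P y x \<and> walk_length l (rev w) = walk_length l w" if "w \<in> P x y" for w x y
    proof -
      have "walk l (rev w) = walk l w \<and> walk_length l (rev w) = walk_length l w"
        by (rule walk_rev) (use that lsym in \<open>auto simp: P_def\<close>)
      thus ?thesis using that by (auto simp: P_def hd_rev last_rev)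
    qed
    hence "\<epsilon> y x \<le> \<epsilon> x y" for x y
      using attained[of x y] \<epsilon>M[of y x] \<epsilon>P[of _ y x] by metis
    thus "\<epsilon> x y = \<epsilon> y x" by (simp add: antisym)
    have "[x] \<in> P x x" using xy by (simp add: P_def)
    hence "\<epsilon> x x = 0" using \<epsilon>P[of "[x]" x x] nn[of x x] by simp
    thus "\<epsilon> x y = 0 \<longleftrightarrow> x = y" using pos[of x y] by (cases "x = y") auto
  next
    fix x y z assume xyz: "x \<in> E" "y \<in> E" "z \<in> E"
    show "\<epsilon> x z \<le> \<epsilon> x y + \<epsilon> y z"
    proof (cases "\<epsilon> x y = M \<or> \<epsilon> y z = M")
      case True
      thus ?thesis using \<epsilon>M[of x z] nn[of x y] nn[of y z] by linarith
    next
      case False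
      then obtain u v where u: "u \<in> P x y" "\<epsilon> x y = walk_length l u"
        and v: "v \<in> P y z" "\<epsilon> y z = walk_length l v"
        using attained by metis
      obtain u' where u': "u = u' @ [y]" using u(1) by (cases u rule: rev_cases) (auto simp: P_def)
      obtain v' where v': "v = y # v'" using v(1) by (cases v) (auto simp: P_def)
      have "u' @ y # v' \<in> P x z"
        using u v u' v' walk_split[of l u' y v'] by (auto simp: P_def hd_append split: if_splits)
      from \<epsilon>P[OF this] show ?thesis using u v u' v' walk_length_split[of l u' y v'] by simp
    qed
  qed
  have iso: "\<epsilon> (\<iota> x) (\<iota> y) = \<delta> x y" if xy: "x \<in> A" "y \<in> A" for x y
  proof (cases "x = y")
    case True
    have "\<delta> x y = 0" using True xy met unfolding metric_on_def by blast
    moreover have "\<epsilon> (\<iota> x) (\<iota> x) = 0" using metE a(2) xy unfolding metric_on_def by blast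
    ultimately show ?thesis using True by simp
  next
    case False
    have "\<delta> x y \<noteq> 0" "0 \<le> \<delta> x y" using met xy False unfolding metric_on_def by blast+
    hence "[\<iota> x, \<iota> y] \<in> P (\<iota> x) (\<iota> y)" using a(2,5) xy by (auto simp: P_def)
    from \<epsilon>P[OF this] have "\<epsilon> (\<iota> x) (\<iota> y) \<le> \<delta> x y" using a(5) xy by simp
    moreover have "\<delta> x y \<le> M" using M(3)[of "\<delta> x y"] xy
      by (force simp: \<Lambda>_def distances_def)
    moreover have "\<delta> x y \<le> walk_length l w" if "w \<in> P (\<iota> x) (\<iota> y)" for w
      using short'[of w] that a(5) xy by (auto simp: P_def)
    ultimately show ?thesis using attained[of "\<iota> x" "\<iota> y"] by fastforce
  qed
  \<comment> \<open>graph automorphisms do not increase the path metric; applied to inverses too, they preserve it\<close>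
  have contract: "\<epsilon> (\<theta> x) (\<theta> y) \<le> \<epsilon> x y"
    if \<theta>: "\<theta> ` E \<subseteq> E" "\<forall>x\<in>E. \<forall>y\<in>E. l (\<theta> x) (\<theta> y) = l x y" for \<theta> x y
  proof -
    have "map \<theta> w \<in> P (\<theta> x) (\<theta> y) \<and> walk_length l (map \<theta> w) = walk_length l w" if w: "w \<in> P x y" for w
    proof -
      have "walk l (map \<theta> w) = walk l w" "walk_length l (map \<theta> w) = walk_length l w"
        by (rule walk_map; use w \<theta> in \<open>auto simp: P_def subset_iff\<close>)+
      thus ?thesis using w \<theta>(1) by (auto simp: P_def hd_map last_map)
    qed
    thus ?thesis using attained[of x y] \<epsilon>M[of "\<theta> x" "\<theta> y"] \<epsilon>P[of _ "\<theta> x" "\<theta> y"] by metis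
  qed
  have wlS: "walk_length l w \<in> S" if "walk l w" "set w \<subseteq> E" for w
    using that
  proof (induction w)
    case (Cons x w)
    show ?case
    proof (cases w)
      case Nil thus ?thesis using S by simp
    next
      case (Cons y w')
      have "l x y \<in> S" using a(4)[of x y] Cons.prems Cons S(1,2) by (auto simp: \<Lambda>_def)
      thus ?thesis using Cons Cons.IH Cons.prems S(3) by auto
    qed
  qed (use S in auto)
  have \<epsilon>S: "\<epsilon> x y \<in> S" for x y using attained[of x y] M wlS by (auto simp: P_def)
  show ?thesis
    unfolding partial_isometries_extend_def
  proof (intro exI[of _ E] exI[of _ \<epsilon>] exI[of _ \<iota>] conjI ballI allI impI)
    show "finite E" "metric_on E \<epsilon>" "\<iota> ` A \<subseteq> E" by fact+
    show "distances E \<epsilon> \<subseteq> S" using \<epsilon>S by (auto simp: distances_def)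
    show "\<epsilon> (\<iota> a) (\<iota> b) = \<delta> a b" if "a \<in> A" "b \<in> A" for a b using iso that by blast
    fix C p assume "partial_isometry A \<delta> C p"
    from autom[OF this] obtain \<theta> where \<theta>: "bij_betw \<theta> E E" "\<forall>x\<in>E. \<forall>y\<in>E. l (\<theta> x) (\<theta> y) = l x y"
      "\<forall>a\<in>C. \<theta> (\<iota> a) = \<iota> (p a)" by blast
    define \<rho> where "\<rho> = inv_into E \<theta>"
    have \<rho>: "bij_betw \<rho> E E" unfolding \<rho>_def using \<theta>(1) by (rule bij_betw_inv_into)
    have \<rho>E: "\<rho> x \<in> E" "\<theta> (\<rho> x) = x" if "x \<in> E" for x
      using \<theta>(1) that by (auto simp: \<rho>_def bij_betw_def inv_into_into f_inv_into_f)
    have \<rho>\<theta>: "\<rho> (\<theta> x) = x" "\<theta> x \<in> E" if "x \<in> E" for x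
      using \<theta>(1) that by (auto simp: \<rho>_def bij_betw_def)
    have l\<rho>: "\<forall>x\<in>E. \<forall>y\<in>E. l (\<rho> x) (\<rho> y) = l x y" using \<theta>(2) \<rho>E by metis
    have "\<epsilon> (\<theta> x) (\<theta> y) = \<epsilon> x y" if "x \<in> E" "y \<in> E" for x y
    proof (rule antisym)
      show "\<epsilon> (\<theta> x) (\<theta> y) \<le> \<epsilon> x y" by (rule contract) (use \<theta> \<rho>\<theta> in auto)
      have "\<epsilon> (\<rho> (\<theta> x)) (\<rho> (\<theta> y)) \<le> \<epsilon> (\<theta> x) (\<theta> y)"
        by (rule contract) (use l\<rho> \<rho>E in auto)
      thus "\<epsilon> x y \<le> \<epsilon> (\<theta> x) (\<theta> y)" using \<rho>\<theta> that by simp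
    qed
    thus "\<exists>\<theta>. bij_betw \<theta> E E \<and> (\<forall>x\<in>E. \<forall>y\<in>E. \<epsilon> (\<theta> x) (\<theta> y) = \<epsilon> x y) \<and> (\<forall>a\<in>C. \<theta> (\<iota> a) = \<iota> (p a))"
      using \<theta> by blast
  qed
qed

section \<open>Isometries and one-point extensions\<close>

abbreviation isoinv :: "('a \<Rightarrow> 'b) \<Rightarrow> 'b \<Rightarrow> 'a" where
  "isoinv g \<equiv> inv_into UNIV g"

lemma isometry_dist: "g \<in> isometries \<Longrightarrow> dist (g x) (g y) = dist x y"
  by (simp add: isometries_def)

lemma isometry_bij: "g \<in> isometries \<Longrightarrow> bij g"
  by (simp add: isometries_def)

lemma isoinv_cancel:
  assumes "g \<in> isometries" shows "isoinv g (g x) = x" "g (isoinv g x) = x"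
  using isometry_bij[OF assms] by (simp_all add: bij_is_inj bij_is_surj surj_f_inv_f)

lemma isoinv_comp:
  assumes "g \<in> isometries" shows "isoinv g \<circ> g = id" "g \<circ> isoinv g = id"
  using isoinv_cancel[OF assms] by (auto simp: fun_eq_iff)

lemma id_in_isometries: "id \<in> isometries"
  by (simp add: isometries_def)

lemma comp_in_isometries: "g \<in> isometries \<Longrightarrow> h \<in> isometries \<Longrightarrow> g \<circ> h \<in> isometries"
  by (auto simp: isometries_def bij_comp)

lemma isoinv_in_isometries:
  assumes "g \<in> isometries" shows "isoinv g \<in> isometries"
proof -
  have "dist (isoinv g x) (isoinv g y) = dist x y" for x y
    using isometry_dist[OF assms, of "isoinv g x" "isoinv g y"] isoinv_cancel[OF assms] by simp
  thus ?thesis using isometry_bij[OF assms] by (simp add: isometries_def bij_imp_bij_inv)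
qed

lemma isoinv_isoinv: "g \<in> isometries \<Longrightarrow> isoinv (isoinv g) = g"
  using isometry_bij inv_inv_eq by blast

lemma isoinv_compose: "g \<in> isometries \<Longrightarrow> h \<in> isometries \<Longrightarrow> isoinv (g \<circ> h) = isoinv h \<circ> isoinv g"
  using isometry_bij o_inv_distrib by blast

lemma dist_isoinv_comp:
  assumes "g \<in> isometries" shows "dist a ((isoinv g \<circ> k) b) = dist (g a) (k b)"
  using isometry_dist[OF assms, of a "(isoinv g \<circ> k) b"] isoinv_cancel(2)[OF assms] by simp

lemma isoinv_isoinv_comp:
  assumes "g \<in> isometries" "k \<in> isometries" shows "isoinv (isoinv g \<circ> k) = isoinv k \<circ> g"
  using isoinv_compose[OF isoinv_in_isometries[OF assms(1)] assms(2)] isoinv_isoinv[OF assms(1)] by simp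

lemma comp_isoinv_isoinv_comp:
  assumes "g \<in> isometries" "k \<in> isometries" shows "k \<circ> isoinv (isoinv g \<circ> k) = g"
  using isoinv_isoinv_comp[OF assms] isoinv_cancel(2)[OF assms(2)] by (simp add: fun_eq_iff)

lemma isometries_eq_if_dense:
  assumes "g \<in> isometries" "h \<in> isometries" "closure D = UNIV" "\<And>d. d \<in> D \<Longrightarrow> g d = h d"
  shows "g = h"
proof (rule ext, rule ccontr)
  fix x assume ne: "g x \<noteq> h x"
  define e where "e = dist (g x) (h x) / 2"
  have "0 < e" using ne by (simp add: e_def)
  moreover have "x \<in> closure D" using assms by simp
  ultimately obtain d where d: "d \<in> D" "dist d x < e" by (auto simp: closure_approachable)
  have "dist (g x) (h x) \<le> dist (g x) (g d) + dist (h d) (h x)"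
    using dist_triangle[of "g x" "h x" "g d"] assms(4)[OF d(1)] by simp
  also have "\<dots> = 2 * dist d x"
    using isometry_dist assms(1,2) by (metis dist_commute mult_2)
  also have "\<dots> < dist (g x) (h x)" using d by (simp add: e_def)
  finally show False by simp
qed

text \<open>
  Every finite one-point metric extension of a finite subset of \<open>D\<close> by distances in \<open>S\<close> is
  realized in \<open>D\<close>; the function \<open>f\<close> gives the distances of the new point, positive so that it
  is new.
\<close>

definition finitely_injective :: "'u::metric_space set \<Rightarrow> real set \<Rightarrow> bool" where
  "finitely_injective D S \<longleftrightarrow>
     (\<forall>A f. finite A \<and> A \<subseteq> D \<and> f ` A \<subseteq> S \<and> (\<forall>a\<in>A. 0 < f a) \<and>
        (\<forall>a\<in>A. \<forall>b\<in>A. \<bar>f a - f b\<bar> \<le> dist a b \<and> dist a b \<le> f a + f b) \<longrightarrow>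
        (\<exists>u\<in>D. \<forall>a\<in>A. dist u a = f a))"

lemma finitely_injectiveD:
  assumes "finitely_injective D S" "finite A" "A \<subseteq> D" "f ` A \<subseteq> S" "\<And>a. a \<in> A \<Longrightarrow> 0 < f a"
    "\<And>a b. a \<in> A \<Longrightarrow> b \<in> A \<Longrightarrow> \<bar>f a - f b\<bar> \<le> dist a b"
    "\<And>a b. a \<in> A \<Longrightarrow> b \<in> A \<Longrightarrow> dist a b \<le> f a + f b"
  obtains u where "u \<in> D" "\<And>a. a \<in> A \<Longrightarrow> dist u a = f a"
proof -
  have "\<exists>u\<in>D. \<forall>a\<in>A. dist u a = f a"
    using assms(1)[unfolded finitely_injective_def, rule_format, of A f] assms(2-) by blast
  thus thesis using that by blast
qed

lemma distances_mem: "x \<in> E \<Longrightarrow> y \<in> E \<Longrightarrow> \<delta> x y \<in> distances E \<delta>"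
  by (auto simp: distances_def)

text \<open>
  One point of \<open>E\<close> at a time: its distances to the points already embedded are those of a one-point
  extension of their images.
\<close>

lemma extend_isometric_embedding:
  fixes f :: "'e \<Rightarrow> 'u::metric_space"
  assumes inj: "finitely_injective D S" and fin: "finite E" and met: "metric_on E \<delta>"
    and S: "distances E \<delta> \<subseteq> S" and E0: "E0 \<subseteq> E" "f ` E0 \<subseteq> D"
    and iso: "\<And>x y. x \<in> E0 \<Longrightarrow> y \<in> E0 \<Longrightarrow> dist (f x) (f y) = \<delta> x y"
  obtains f' where "\<And>x. x \<in> E0 \<Longrightarrow> f' x = f x" "f' ` E \<subseteq> D"
    "\<And>x y. x \<in> E \<Longrightarrow> y \<in> E \<Longrightarrow> dist (f' x) (f' y) = \<delta> x y"
proof -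
  have "\<exists>f'. (\<forall>x\<in>E0. f' x = f x) \<and> f' ` (E0 \<union> F) \<subseteq> D \<and>
          (\<forall>x\<in>E0 \<union> F. \<forall>y\<in>E0 \<union> F. dist (f' x) (f' y) = \<delta> x y)" if "finite F" "F \<subseteq> E - E0" for F
    using that
  proof (induction F)
    case empty
    thus ?case using E0 iso by auto
  next
    case (insert e F)
    then obtain f' where f': "\<forall>x\<in>E0. f' x = f x" "f' ` (E0 \<union> F) \<subseteq> D"
        "\<forall>x\<in>E0 \<union> F. \<forall>y\<in>E0 \<union> F. dist (f' x) (f' y) = \<delta> x y" by blast
    let ?B = "E0 \<union> F"
    have BE: "?B \<subseteq> E" "e \<in> E" "e \<notin> ?B" "finite ?B"
      using insert.prems insert.hyps E0 finite_subset[OF E0(1) fin] by auto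
    have nn: "0 \<le> \<delta> x y" and sym: "\<delta> x y = \<delta> y x" and zero: "\<delta> x y = 0 \<longleftrightarrow> x = y"
      if "x \<in> E" "y \<in> E" for x y using met that unfolding metric_on_def by blast+
    have tri: "\<delta> x z \<le> \<delta> x y + \<delta> y z" if "x \<in> E" "y \<in> E" "z \<in> E" for x y z
      using met that unfolding metric_on_def by blast
    have inj': "inj_on f' ?B"
      using f'(3) zero BE by (intro inj_onI) (metis dist_self subsetD)
    define r where "r = inv_into ?B f'"
    have r: "r (f' x) = x" if "x \<in> ?B" for x using inj' that by (simp add: r_def)
    have rB: "r y \<in> ?B" "f' (r y) = y" if "y \<in> f' ` ?B" for y
      using inv_into_into[OF that] f_inv_into_f[OF that] unfolding r_def by blast+
    have dr: "dist a b = \<delta> (r a) (r b)" if "a \<in> f' ` ?B" "b \<in> f' ` ?B" for a b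
      using f'(3) rB that by metis
    obtain u where u: "u \<in> D" "\<And>a. a \<in> f' ` ?B \<Longrightarrow> dist u a = \<delta> e (r a)"
    proof (rule finitely_injectiveD[OF inj, of "f' ` ?B" "\<lambda>a. \<delta> e (r a)"])
      show "finite (f' ` ?B)" "f' ` ?B \<subseteq> D" using BE f' by auto
      show "(\<lambda>a. \<delta> e (r a)) ` f' ` ?B \<subseteq> S" using S BE(1,2) r distances_mem[of _ E _ \<delta>] by (auto simp: subset_iff)
      fix a assume a: "a \<in> f' ` ?B"
      hence ra: "r a \<in> E" "r a \<noteq> e" using rB BE by auto
      show "0 < \<delta> e (r a)" using nn[OF BE(2) ra(1)] zero[OF BE(2) ra(1)] ra by (metis less_le)
      fix b assume b: "b \<in> f' ` ?B"
      hence rb: "r b \<in> E" using rB BE by auto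
      show "\<bar>\<delta> e (r a) - \<delta> e (r b)\<bar> \<le> dist a b"
        using tri[OF BE(2) ra(1) rb] tri[OF BE(2) rb ra(1)] sym[OF ra(1) rb] dr[OF a b] by linarith
      show "dist a b \<le> \<delta> e (r a) + \<delta> e (r b)"
        using tri[OF ra(1) BE(2) rb] sym[OF ra(1) BE(2)] dr[OF a b] by linarith
    qed blast
    define f'' where "f'' = f'(e := u)"
    have e0: "e \<notin> E0" using BE by auto
    have ux: "dist u (f' x) = \<delta> e x" "dist (f' x) u = \<delta> x e" if "x \<in> ?B" for x
      using u(2)[of "f' x"] r that sym[of e x] BE by (auto simp: dist_commute)
    have "(\<forall>x\<in>E0. f'' x = f x) \<and> f'' ` (E0 \<union> insert e F) \<subseteq> D \<and>
        (\<forall>x\<in>E0 \<union> insert e F. \<forall>y\<in>E0 \<union> insert e F. dist (f'' x) (f'' y) = \<delta> x y)"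
    proof (intro conjI ballI)
      show "f'' x = f x" if "x \<in> E0" for x using that e0 f'(1) by (auto simp: f''_def)
      show "f'' ` (E0 \<union> insert e F) \<subseteq> D" using f'(2) u(1) by (auto simp: f''_def)
      fix x y assume xy: "x \<in> E0 \<union> insert e F" "y \<in> E0 \<union> insert e F"
      have z: "\<delta> e e = 0" using zero BE by blast
      show "dist (f'' x) (f'' y) = \<delta> x y"
      proof (cases "x = e"; cases "y = e")
        assume "x = e" "y = e" thus ?thesis using z by simp
      next
        assume "x = e" "y \<noteq> e" thus ?thesis using ux(1)[of y] xy by (simp add: f''_def)
      next
        assume "x \<noteq> e" "y = e" thus ?thesis using ux(2)[of x] xy by (simp add: f''_def)
      next
        assume "x \<noteq> e" "y \<noteq> e" thus ?thesis using f'(3) xy by (simp add: f''_def)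
      qed
    qed
    thus ?case by blast
  qed
  from this[of "E - E0"] fin obtain f' where f': "\<forall>x\<in>E0. f' x = f x" "f' ` (E0 \<union> (E - E0)) \<subseteq> D"
    "\<forall>x\<in>E0 \<union> (E - E0). \<forall>y\<in>E0 \<union> (E - E0). dist (f' x) (f' y) = \<delta> x y" by blast
  have "E0 \<union> (E - E0) = E" using E0 by auto
  note f'' = f'[unfolded this]
  show thesis
  proof (rule that[of f'])
    show "f' x = f x" if "x \<in> E0" for x using f''(1) that by blast
    show "f' ` E \<subseteq> D" by (rule f''(2))
    show "dist (f' x) (f' y) = \<delta> x y" if "x \<in> E" "y \<in> E" for x y using f''(3) that by blast
  qed
qed

text \<open>
  Completeness and separability are stated in terms of \<open>\<delta>\<close>, so that universality can be applied to
  metrics on subsets of any type.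
\<close>

lemma universal_metric_embeds:
  assumes uni: "universal_polish TYPE('u::polish_space)" and met: "metric_on M \<delta>"
    and complete: "\<And>\<sigma> :: nat \<Rightarrow> 'b. range \<sigma> \<subseteq> M \<Longrightarrow> \<forall>e>0. \<exists>N. \<forall>n\<ge>N. \<forall>m\<ge>N. \<delta> (\<sigma> n) (\<sigma> m) < e \<Longrightarrow>
        \<exists>x\<in>M. \<forall>e>0. \<exists>N. \<forall>n\<ge>N. \<delta> (\<sigma> n) x < e"
    and separable: "countable Q" "Q \<subseteq> M" "\<And>x e. x \<in> M \<Longrightarrow> 0 < e \<Longrightarrow> \<exists>q\<in>Q. \<delta> x q < e"
  shows "\<exists>f :: 'b \<Rightarrow> 'u. \<forall>x\<in>M. \<forall>y\<in>M. dist (f x) (f y) = \<delta> x y"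
proof -
  define d where "d x y = (if x \<in> M \<and> y \<in> M then \<delta> x y else 0)" for x y
  have "Metric_space M d"
    by (rule Metric_space.intro; use met in \<open>auto simp: d_def metric_on_def\<close>)
  then interpret A: Metric_space M d .
  have "A.mcomplete"
    unfolding A.mcomplete_def
  proof (intro allI impI)
    fix \<sigma> assume \<sigma>: "A.MCauchy \<sigma>"
    hence r: "range \<sigma> \<subseteq> M" by (simp add: A.MCauchy_def)
    hence dd: "d (\<sigma> n) (\<sigma> m) = \<delta> (\<sigma> n) (\<sigma> m)" for n m by (auto simp: d_def)
    have "\<forall>e>0. \<exists>N. \<forall>n\<ge>N. \<forall>m\<ge>N. \<delta> (\<sigma> n) (\<sigma> m) < e"
      using \<sigma> by (simp add: A.MCauchy_def dd)
    from complete[OF r this] obtain x where x: "x \<in> M" "\<forall>e>0. \<exists>N. \<forall>n\<ge>N. \<delta> (\<sigma> n) x < e" by blast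
    have r': "\<sigma> n \<in> M" and dx: "d (\<sigma> n) x = \<delta> (\<sigma> n) x" for n using r x(1) by (auto simp: d_def)
    have "limitin A.mtopology \<sigma> x sequentially"
      unfolding A.limitin_metric eventually_sequentially using x dx r' by auto
    thus "\<exists>x. limitin A.mtopology \<sigma> x sequentially" ..
  qed
  moreover have "separable_space A.mtopology"
  proof -
    have "A.mtopology closure_of Q = M"
    proof (rule antisym)
      show "A.mtopology closure_of Q \<subseteq> M" by (auto simp: A.metric_closure_of)
      show "M \<subseteq> A.mtopology closure_of Q"
      proof
        fix x assume x: "x \<in> M"
        have "\<exists>y\<in>Q. y \<in> A.mball x e" if "0 < e" for e
          using separable(3)[OF x that] separable(2) x by (auto simp: d_def)
        thus "x \<in> A.mtopology closure_of Q" using x by (auto simp: A.metric_closure_of)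
      qed
    qed
    thus ?thesis unfolding separable_space_def using separable(1,2) by auto
  qed
  ultimately have "mcomplete_of (metric (M, d))" "separable_space (mtopology_of (metric (M, d)))" by auto
  from universal_polish_embeds[OF uni this] show ?thesis by (auto simp: d_def)
qed

text \<open>
  Embed \<open>A\<close> together with the new point by universality, then move the copy of \<open>A\<close> back to
  \<open>A\<close> by homogeneity.
\<close>

lemma urysohn_finitely_injective:
  assumes "urysohn_space TYPE('u::polish_space)"
  shows "finitely_injective (UNIV :: 'u set) UNIV"
  unfolding finitely_injective_def
proof (intro allI impI, elim conjE)
  fix A :: "'u set" and f
  assume fin: "finite A" and pos: "\<forall>a\<in>A. 0 < f a"
    and kat: "\<forall>a\<in>A. \<forall>b\<in>A. \<bar>f a - f b\<bar> \<le> dist a b \<and> dist a b \<le> f a + f b"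
  define M where "M = insert None (Some ` A)"
  define \<delta> :: "'u option \<Rightarrow> 'u option \<Rightarrow> real" where
    "\<delta> x y = (case (x, y) of (None, None) \<Rightarrow> 0 | (None, Some a) \<Rightarrow> f a | (Some a, None) \<Rightarrow> f a
              | (Some a, Some b) \<Rightarrow> dist a b)" for x y
  have met: "metric_on M \<delta>"
    unfolding metric_on_def
  proof (intro conjI ballI)
    fix x y assume "x \<in> M" "y \<in> M"
    thus "0 \<le> \<delta> x y" "\<delta> x y = \<delta> y x" "\<delta> x y = 0 \<longleftrightarrow> x = y"
      using pos by (force simp: M_def \<delta>_def dist_commute split: option.splits)+
  next
    fix x y z assume "x \<in> M" "y \<in> M" "z \<in> M"
      moreover have "f a \<le> f b + dist b a" "f a \<le> dist a b + f b" if "a \<in> A" "b \<in> A" for a b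
      using kat that by (smt (verit) dist_commute)+
    moreover have "dist a b \<le> f a + f b" if "a \<in> A" "b \<in> A" for a b using kat that by blast
    ultimately show "\<delta> x z \<le> \<delta> x y + \<delta> y z"
      using pos by (auto simp: M_def \<delta>_def less_imp_le intro: dist_triangle)
  qed
  have "\<exists>e :: 'u option \<Rightarrow> 'u. \<forall>x\<in>M. \<forall>y\<in>M. dist (e x) (e y) = \<delta> x y"
  proof (rule universal_metric_embeds[OF _ met])
    show "universal_polish TYPE('u)" using assms by (simp add: urysohn_space_def)
    have finM: "finite M" using fin by (simp add: M_def)
    show "countable M" "M \<subseteq> M" using finM by (auto simp: countable_finite)
    have d0: "\<delta> x x = 0" if "x \<in> M" for x using met that unfolding metric_on_def by blast
    show "\<exists>q\<in>M. \<delta> x q < e" if "x \<in> M" "0 < e" for x e using d0[OF that(1)] that by (intro bexI[of _ x]) simp_all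
    fix \<sigma> :: "nat \<Rightarrow> 'u option"
    assume \<sigma>: "range \<sigma> \<subseteq> M" and C: "\<forall>e>0. \<exists>N. \<forall>n\<ge>N. \<forall>m\<ge>N. \<delta> (\<sigma> n) (\<sigma> m) < e"
    obtain e0 where e0: "0 < e0" "\<And>x y. x \<in> M \<Longrightarrow> y \<in> M \<Longrightarrow> 0 < \<delta> x y \<Longrightarrow> e0 \<le> \<delta> x y"
      using finite_positive_gap[OF finM] by blast
    obtain N where N: "\<forall>n\<ge>N. \<forall>m\<ge>N. \<delta> (\<sigma> n) (\<sigma> m) < e0" using C e0 by blast
    have "\<delta> (\<sigma> n) (\<sigma> N) = 0" if "n \<ge> N" for n
    proof -
      have m: "\<sigma> n \<in> M" "\<sigma> N \<in> M" using \<sigma> by auto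
      hence "0 \<le> \<delta> (\<sigma> n) (\<sigma> N)" using met unfolding metric_on_def by blast
      moreover have "\<delta> (\<sigma> n) (\<sigma> N) < e0" using N that by blast
      ultimately show ?thesis using e0(2)[OF m] by linarith
    qed
    thus "\<exists>x\<in>M. \<forall>e>0. \<exists>N. \<forall>n\<ge>N. \<delta> (\<sigma> n) x < e"
      using \<sigma> by (intro bexI[of _ "\<sigma> N"] allI impI exI[of _ N]) auto
  qed
  then obtain e :: "'u option \<Rightarrow> 'u" where e: "\<forall>x\<in>M. \<forall>y\<in>M. dist (e x) (e y) = \<delta> x y" by blast
  have ed: "dist (e (Some a)) (e (Some b)) = dist a b" "dist (e None) (e (Some a)) = f a"
    if "a \<in> A" "b \<in> A" for a b using e that by (auto simp: M_def \<delta>_def)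
  define B where "B = (e \<circ> Some) ` A"
  define r where "r = inv_into A (e \<circ> Some)"
  have injA: "inj_on (e \<circ> Some) A" by (rule inj_onI) (use ed in \<open>force simp: o_def\<close>)
  have r: "r (e (Some a)) = a" if "a \<in> A" for a
    using inv_into_f_f[OF injA that] by (simp add: r_def)
  have "\<forall>x\<in>B. \<forall>y\<in>B. dist (r x) (r y) = dist x y" using r ed by (auto simp: B_def)
  moreover have "finite B" using fin by (simp add: B_def)
  ultimately obtain g where g: "g \<in> isometries" "\<forall>x\<in>B. g x = r x"
    using assms unfolding urysohn_space_def homogeneous_metric_def by blast
  have "dist (g (e None)) a = f a" if "a \<in> A" for a
  proof -
    have "g (e (Some a)) = a" using g(2) r that by (auto simp: B_def)
    thus ?thesis using isometry_dist[OF g(1), of "e None" "e (Some a)"] ed(2) that by simp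
  qed
  thus "\<exists>u\<in>UNIV. \<forall>a\<in>A. dist u a = f a" by blast
qed

section \<open>Large chains and products\<close>

definition fixator :: "'u::metric_space set \<Rightarrow> ('u \<Rightarrow> 'u) set" where
  "fixator c = {g \<in> isometries. \<forall>a\<in>c. g a = a}"

text \<open>
  The sets \<open>moves_less c \<epsilon>\<close> with \<open>c\<close> finite and \<open>\<epsilon> > 0\<close>
  form a neighbourhood base at the identity in the topology of pointwise convergence.
\<close>

definition moves_less :: "'u::metric_space set \<Rightarrow> real \<Rightarrow> ('u \<Rightarrow> 'u) set" where
  "moves_less c \<epsilon> = {g \<in> isometries. \<forall>a\<in>c. dist (g a) a < \<epsilon>}"

text \<open>
  The only property of \<open>V\<close> that the main argument uses besides monotonicity and symmetry. The place
  \<open>n\<close> of the first difference matters for chains: the constructed \<open>h \<alpha>\<close> and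
  \<open>h \<beta>\<close> are related through the data of stage \<open>n\<close>, which only has to defeat
  \<open>V n\<close>.
\<close>

definition large_in :: "('u \<Rightarrow> 'u) set \<Rightarrow> (nat \<Rightarrow> ('u \<Rightarrow> 'u) set) \<Rightarrow> bool" where
  "large_in X V \<longleftrightarrow> (\<forall>h :: (nat \<Rightarrow> bool) \<Rightarrow> 'u \<Rightarrow> 'u. (\<forall>\<alpha>. h \<alpha> \<in> X) \<longrightarrow>
     (\<exists>\<alpha> \<beta> n. (\<forall>i<n. \<alpha> i = \<beta> i) \<and> \<alpha> n \<noteq> \<beta> n \<and> isoinv (h \<alpha>) \<circ> h \<beta> \<in> V n))"

lemma large_inD:
  fixes h :: "(nat \<Rightarrow> bool) \<Rightarrow> 'u \<Rightarrow> 'u"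
  assumes "large_in X V" "\<And>\<alpha>. h \<alpha> \<in> X"
  obtains n \<alpha> \<beta> where "\<forall>i<n. \<alpha> i = \<beta> i" "\<alpha> n \<noteq> \<beta> n" "isoinv (h \<alpha>) \<circ> h \<beta> \<in> V n"
proof -
  have "\<exists>\<alpha> \<beta> n. (\<forall>i<n. \<alpha> i = \<beta> i) \<and> \<alpha> n \<noteq> \<beta> n \<and> isoinv (h \<alpha>) \<circ> h \<beta> \<in> V n"
    by (rule mp[OF spec[OF assms(1)[unfolded large_in_def]]]) (use assms(2) in blast)
  thus thesis by (elim exE conjE) (rule that)
qed

lemma large_in_mono:
  assumes "large_in X V" "Y \<subseteq> X"
  shows "large_in Y V"
  unfolding large_in_def
proof (intro allI impI)
  fix h :: "(nat \<Rightarrow> bool) \<Rightarrow> 'a \<Rightarrow> 'a"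
  assume "\<forall>\<alpha>. h \<alpha> \<in> Y"
  hence "\<And>\<alpha>. h \<alpha> \<in> X" using assms(2) by blast
  from large_inD[OF assms(1), of h, OF this]
  show "\<exists>\<alpha> \<beta> n. (\<forall>i<n. \<alpha> i = \<beta> i) \<and> \<alpha> n \<noteq> \<beta> n \<and> isoinv (h \<alpha>) \<circ> h \<beta> \<in> V n" by metis
qed

lemma first_difference:
  fixes \<alpha> \<beta> :: "nat \<Rightarrow> bool"
  assumes "\<alpha> \<noteq> \<beta>"
  obtains n where "\<forall>i<n. \<alpha> i = \<beta> i" "\<alpha> n \<noteq> \<beta> n"
proof
  have ex: "\<exists>n. \<alpha> n \<noteq> \<beta> n" using assms by auto
  show "\<alpha> (LEAST n. \<alpha> n \<noteq> \<beta> n) \<noteq> \<beta> (LEAST n. \<alpha> n \<noteq> \<beta> n)" by (rule LeastI_ex[OF ex])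
  show "\<forall>i<(LEAST n. \<alpha> n \<noteq> \<beta> n). \<alpha> i = \<beta> i" using not_less_Least by blast
qed

text \<open>
  A colouring argument does not control where two sequences differ, so its conclusion must hold at every place of
  difference, in particular at the first.
\<close>

lemma large_inI:
  assumes "\<And>h :: (nat \<Rightarrow> bool) \<Rightarrow> 'u \<Rightarrow> 'u. \<forall>\<alpha>. h \<alpha> \<in> X \<Longrightarrow>
     \<exists>\<alpha> \<beta>. \<alpha> \<noteq> \<beta> \<and> (\<forall>n. \<alpha> n \<noteq> \<beta> n \<longrightarrow> isoinv (h \<alpha>) \<circ> h \<beta> \<in> V n)"
  shows "large_in X V"
  unfolding large_in_def
proof (intro allI impI)
  fix h :: "(nat \<Rightarrow> bool) \<Rightarrow> 'u \<Rightarrow> 'u" assume "\<forall>\<alpha>. h \<alpha> \<in> X"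
  then obtain \<alpha> \<beta> where ne: "\<alpha> \<noteq> \<beta>" and V: "\<forall>n. \<alpha> n \<noteq> \<beta> n \<longrightarrow> isoinv (h \<alpha>) \<circ> h \<beta> \<in> V n"
    using assms by blast
  obtain n where "\<forall>i<n. \<alpha> i = \<beta> i" "\<alpha> n \<noteq> \<beta> n" using first_difference[OF ne] .
  thus "\<exists>\<alpha> \<beta> n. (\<forall>i<n. \<alpha> i = \<beta> i) \<and> \<alpha> n \<noteq> \<beta> n \<and> isoinv (h \<alpha>) \<circ> h \<beta> \<in> V n"
    using V by blast
qed

primrec npow :: "('a \<Rightarrow> 'a) set \<Rightarrow> nat \<Rightarrow> ('a \<Rightarrow> 'a) set" where
  "npow V 0 = {id}"
| "npow V (Suc n) = {g \<circ> h |g h. g \<in> V \<and> h \<in> npow V n}"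

lemma npow_comp: "g \<in> npow V m \<Longrightarrow> h \<in> npow V n \<Longrightarrow> g \<circ> h \<in> npow V (m + n)"
proof (induction m arbitrary: g)
  case (Suc m)
  obtain g1 g2 where "g = g1 \<circ> g2" "g1 \<in> V" "g2 \<in> npow V m" using Suc.prems by auto
  moreover have "g2 \<circ> h \<in> npow V (m + n)" using Suc.IH[of g2] Suc.prems calculation by blast
  moreover have "g \<circ> h = g1 \<circ> (g2 \<circ> h)" using calculation by (simp add: o_assoc)
  ultimately show ?case unfolding add_Suc npow.simps by blast
qed simp

lemma npow_1: "npow V 1 = V" by auto

lemma npow_mono: "V \<subseteq> W \<Longrightarrow> npow V n \<subseteq> npow W n"
  by (induction n) auto

lemma npow_isometries: "V \<subseteq> isometries \<Longrightarrow> npow V n \<subseteq> isometries"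
  by (induction n) (auto simp: id_in_isometries intro: comp_in_isometries)

lemma npow_isoinv:
  assumes "V \<subseteq> isometries" "\<And>g. g \<in> V \<Longrightarrow> isoinv g \<in> V" "g \<in> npow V n"
  shows "isoinv g \<in> npow V n"
  using assms(3)
proof (induction n arbitrary: g)
  case (Suc n)
  then obtain g1 g2 where g: "g = g1 \<circ> g2" "g1 \<in> V" "g2 \<in> npow V n" by auto
  hence "isoinv g = isoinv g2 \<circ> isoinv g1"
    using assms(1) npow_isometries[OF assms(1)] by (auto intro: isoinv_compose)
  moreover have "isoinv g2 \<in> npow V n" "isoinv g1 \<in> npow V 1"
    using Suc g assms(2) npow_1 by blast+
  hence "isoinv g2 \<circ> isoinv g1 \<in> npow V (n + 1)" by (rule npow_comp)
  ultimately show ?case by (simp only: Suc_eq_plus1)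
qed simp

lemma extends_to_isometry:
  assumes "urysohn_space TYPE('u::polish_space)" "finite (A :: 'u set)"
    "\<forall>x\<in>A. \<forall>y\<in>A. dist (f x) (f y) = dist x y"
  shows "\<exists>g\<in>isometries. \<forall>x\<in>A. g x = f x"
  using assms(1)[unfolded urysohn_space_def homogeneous_metric_def] assms(2,3) by simp

section \<open>From stabilizers to neighbourhoods of the identity\<close>

text \<open>
  The map that fixes \<open>c\<close> and sends \<open>g b\<close> to \<open>k b\<close> is a partial isometry; extend
  it to \<open>u\<close> and compare \<open>k\<close> with \<open>u \<circ> g\<close>.
\<close>

lemma same_position_imp_double_coset:
  fixes c :: "'u::polish_space set"
  assumes U: "urysohn_space TYPE('u)" and fin: "finite c"
    and gk: "g \<in> isometries" "k \<in> isometries"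
    and eq: "\<And>a b. a \<in> c \<Longrightarrow> b \<in> c \<Longrightarrow> dist a (k b) = dist a (g b)"
  shows "\<exists>u\<in>fixator c. \<exists>v\<in>fixator c. k = u \<circ> (g \<circ> v)"
proof -
  define f where "f x = (if x \<in> c then x else k (isoinv g x))" for x
  have fc: "f a = a" if "a \<in> c" for a using that by (simp add: f_def)
  have fg: "f (g b) = k b" if "b \<in> c" for b
  proof (cases "g b \<in> c")
    case True
    have "dist (g b) (k b) = 0" using eq[OF True that] by simp
    thus ?thesis using True by (simp add: f_def)
  next
    case False
    thus ?thesis using isoinv_cancel[OF gk(1)] by (simp add: f_def)
  qed
  have eq': "dist (k b) a = dist (g b) a" if "a \<in> c" "b \<in> c" for a b
    using eq[OF that] by (simp add: dist_commute)
  have "\<forall>x\<in>c \<union> g ` c. \<forall>y\<in>c \<union> g ` c. dist (f x) (f y) = dist x y"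
    by (auto simp: fc fg eq eq' isometry_dist[OF gk(1)] isometry_dist[OF gk(2)])
  moreover have "finite (c \<union> g ` c)" using fin by simp
  ultimately obtain u where u: "u \<in> isometries" "\<And>x. x \<in> c \<union> g ` c \<Longrightarrow> u x = f x"
    using extends_to_isometry[OF U, of "c \<union> g ` c" f] by blast
  define v where "v = isoinv g \<circ> (isoinv u \<circ> k)"
  have v_iso: "v \<in> isometries"
    using gk u(1) by (simp add: v_def comp_in_isometries isoinv_in_isometries)
  have "v b = b" if "b \<in> c" for b
  proof -
    have "u (g b) = k b" using u(2) fg that by simp
    hence "isoinv u (k b) = g b" using isoinv_cancel(1)[OF u(1)] by metis
    thus ?thesis using isoinv_cancel[OF gk(1)] by (simp add: v_def)
  qed
  hence "v \<in> fixator c"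
    using gk u(1) v_iso by (simp add: fixator_def)
  moreover have "k = u \<circ> (g \<circ> v)"
    using isoinv_cancel[OF gk(1)] isoinv_cancel[OF u(1)] by (simp add: v_def fun_eq_iff)
  moreover have "u \<in> fixator c" using u fc by (simp add: fixator_def)
  ultimately show ?thesis by blast
qed

text \<open>
  The hypotheses say that \<open>F\<close> is the cross distance of a metric on the disjoint union of \<open>X\<close>
  and a copy of \<open>c\<close>; one-point extensions and homogeneity realize it over \<open>X\<close>.
\<close>

lemma isometry_with_distances:
  fixes c X :: "'u::polish_space set"
  assumes U: "urysohn_space TYPE('u)" and fin: "finite c" "finite X"
    and pos: "\<And>a x. a \<in> c \<Longrightarrow> x \<in> X \<Longrightarrow> 0 < F a x"
    and F1: "\<And>a x y. a \<in> c \<Longrightarrow> x \<in> X \<Longrightarrow> y \<in> X \<Longrightarrow> F a x \<le> F a y + dist x y"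
    and F2: "\<And>a x y. a \<in> c \<Longrightarrow> x \<in> X \<Longrightarrow> y \<in> X \<Longrightarrow> dist x y \<le> F a x + F a y"
    and F3: "\<And>a b x. a \<in> c \<Longrightarrow> b \<in> c \<Longrightarrow> x \<in> X \<Longrightarrow> dist a b \<le> F a x + F b x"
    and F4: "\<And>a b x. a \<in> c \<Longrightarrow> b \<in> c \<Longrightarrow> x \<in> X \<Longrightarrow> F a x \<le> F b x + dist a b"
  obtains k where "k \<in> isometries" "\<And>a x. a \<in> c \<Longrightarrow> x \<in> X \<Longrightarrow> dist (k a) x = F a x"
proof -
  define E :: "('u + 'u) set" where "E = Inl ` X \<union> Inr ` c"
  define \<delta> :: "'u + 'u \<Rightarrow> 'u + 'u \<Rightarrow> real" where
    "\<delta> p q = (case (p, q) of (Inl x, Inl y) \<Rightarrow> dist x y | (Inr a, Inr b) \<Rightarrow> dist a b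
       | (Inl x, Inr a) \<Rightarrow> F a x | (Inr a, Inl x) \<Rightarrow> F a x)" for p q
  have met: "metric_on E \<delta>"
    unfolding metric_on_def
  proof (intro conjI ballI)
    fix p q assume pq: "p \<in> E" "q \<in> E"
    show "0 \<le> \<delta> p q" "\<delta> p q = \<delta> q p"
      using pq pos by (auto simp: E_def \<delta>_def dist_commute less_imp_le)
    have "F a x \<noteq> 0" if "a \<in> c" "x \<in> X" for a x using pos[OF that] by simp
    thus "\<delta> p q = 0 \<longleftrightarrow> p = q" using pq by (auto simp: E_def \<delta>_def)
  next
    fix p q r assume pqr: "p \<in> E" "q \<in> E" "r \<in> E"
    show "\<delta> p r \<le> \<delta> p q + \<delta> q r"
    proof -
      have F1': "F a x \<le> dist x y + F a y" if "a \<in> c" "x \<in> X" "y \<in> X" for a x y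
        using F1[OF that] by simp
      have F1'': "F a x \<le> F a y + dist y x" if "a \<in> c" "x \<in> X" "y \<in> X" for a x y
        using F1[OF that] by (simp add: dist_commute)
      have F4': "F a x \<le> dist a b + F b x" if "a \<in> c" "b \<in> c" "x \<in> X" for a b x
        using F4[OF that] by simp
      have F4'': "F a x \<le> F b x + dist b a" if "a \<in> c" "b \<in> c" "x \<in> X" for a b x
        using F4[OF that] by (simp add: dist_commute)
      show ?thesis using pqr
        by (auto simp: E_def \<delta>_def intro: F1' F1'' F2 F3 F4' F4'' dist_triangle)
    qed
  qed
  obtain f' :: "'u + 'u \<Rightarrow> 'u" where f': "\<And>x. x \<in> Inl ` X \<Longrightarrow> f' x = projl x"
    "\<And>p q. p \<in> E \<Longrightarrow> q \<in> E \<Longrightarrow> dist (f' p) (f' q) = \<delta> p q"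
  proof (rule extend_isometric_embedding[OF urysohn_finitely_injective[OF U], of E \<delta> "Inl ` X" projl])
    show "finite E" using fin by (simp add: E_def)
    show "dist (projl x) (projl y) = \<delta> x y" if "x \<in> Inl ` X" "y \<in> Inl ` X" for x y
      using that by (auto simp: \<delta>_def)
  qed (use met in \<open>auto simp: E_def\<close>)
  have "\<forall>a\<in>c. \<forall>b\<in>c. dist (f' (Inr a)) (f' (Inr b)) = dist a b"
    using f'(2)[of "Inr a" "Inr b" for a b] by (simp add: E_def \<delta>_def)
  from extends_to_isometry[OF U fin(1) this]
  obtain k where k: "k \<in> isometries" "\<And>a. a \<in> c \<Longrightarrow> k a = f' (Inr a)" by blast
  have "dist (k a) x = F a x" if "a \<in> c" "x \<in> X" for a x
    using f'(2)[of "Inr a" "Inl x"] f'(1)[of "Inl x"] k(2) that by (simp add: E_def \<delta>_def)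
  thus thesis using that k(1) by blast
qed

text \<open>
  The triangle inequality for the metric of \<open>path_of_copies\<close>, with \<open>x\<close>, \<open>y\<close>,
  \<open>z\<close> for the three differences of parameters. As \<open>D \<le> C\<close>, the left side increases with
  \<open>z\<close>, so \<open>z\<close> may be taken as large as possible. If \<open>x + y \<le> 1\<close>, this is
  \<open>x + y\<close> and \<open>D \<le> A + B\<close> suffices; otherwise the left side is at most
  \<open>C\<close> and the right side is at least \<open>C * (x + y)\<close>.
\<close>

lemma interpolation_triangle:
  fixes A B D C x y z :: real
  assumes "0 \<le> A" "0 \<le> B" "D \<le> A + B" "A \<le> C" "B \<le> C" "D \<le> C" "0 \<le> x" "0 \<le> y" "x \<le> 1" "y \<le> 1"
    "0 \<le> z" "z \<le> x + y" "z \<le> 1" "0 \<le> C"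
  shows "(1 - z) * D + C * z \<le> ((1 - x) * A + C * x) + ((1 - y) * B + C * y)"
proof (cases "x + y \<le> 1")
  case True
  have "(1 - z) * D + C * z = D + (C - D) * z" by (simp add: algebra_simps)
  also have "\<dots> \<le> D + (C - D) * (x + y)" using assms by (intro add_left_mono mult_left_mono) auto
  also have "\<dots> = D * (1 - x - y) + C * (x + y)" by (simp add: algebra_simps)
  also have "\<dots> \<le> (A + B) * (1 - x - y) + C * (x + y)"
    using assms True by (intro add_right_mono mult_right_mono) auto
  also have "\<dots> \<le> ((1 - x) * A + C * x) + ((1 - y) * B + C * y)"
  proof -
    have "0 \<le> A * y" "0 \<le> B * x" using assms by auto
    thus ?thesis by (simp add: algebra_simps)
  qed
  finally show ?thesis .
next
  case False
  have "(1 - z) * D \<le> (1 - z) * C" using assms by (intro mult_left_mono) auto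
  hence "(1 - z) * D + C * z \<le> C" by (simp add: algebra_simps)
  also have "C \<le> C * (x + y)" using False assms mult_left_mono[of 1 "x + y" C] by simp
  also have "\<dots> \<le> ((1 - x) * A + C * x) + ((1 - y) * B + C * y)"
  proof -
    have "0 \<le> (1 - x) * A" "0 \<le> (1 - y) * B" using assms by auto
    thus ?thesis by (simp add: algebra_simps)
  qed
  finally show ?thesis .
qed

text \<open>
  The product of \<open>c\<close> with the unit interval, with the interpolated metric, is compact and hence embeds by
  universality; each slice is an isometric copy of \<open>c\<close>.
\<close>

lemma path_of_copies:
  fixes c :: "'u::polish_space set"
  assumes U: "urysohn_space TYPE('u)" and fin: "finite c" and C: "0 < C"
    and diam: "\<And>a b. a \<in> c \<Longrightarrow> b \<in> c \<Longrightarrow> dist a b \<le> C"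
  obtains \<gamma> :: "real \<Rightarrow> 'u \<Rightarrow> 'u" where "\<And>t. t \<in> {0..1} \<Longrightarrow> \<gamma> t \<in> isometries"
    "\<And>s t a b. s \<in> {0..1} \<Longrightarrow> t \<in> {0..1} \<Longrightarrow> a \<in> c \<Longrightarrow> b \<in> c \<Longrightarrow>
        dist (\<gamma> s a) (\<gamma> t b) = (1 - \<bar>s - t\<bar>) * dist a b + C * \<bar>s - t\<bar>"
proof -
  define M where "M = c \<times> {0..1::real}"
  define \<delta> where "\<delta> = (\<lambda>(a :: 'u, s) (b, t). (1 - \<bar>s - t\<bar>) * dist a b + C * \<bar>s - t\<bar>)"
  have ge: "C * \<bar>s - t\<bar> \<le> \<delta> (a, s) (b, t)" and ge': "dist a b \<le> \<delta> (a, s) (b, t)"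
    if "(a, s) \<in> M" "(b, t) \<in> M" for a b s t
  proof -
    have "\<bar>s - t\<bar> \<le> 1" using that by (auto simp: M_def)
    thus "C * \<bar>s - t\<bar> \<le> \<delta> (a, s) (b, t)" by (simp add: \<delta>_def)
    have "dist a b * \<bar>s - t\<bar> \<le> C * \<bar>s - t\<bar>" using diam that by (intro mult_right_mono) (auto simp: M_def)
    thus "dist a b \<le> \<delta> (a, s) (b, t)" by (simp add: \<delta>_def algebra_simps)
  qed
  have met: "metric_on M \<delta>"
    unfolding metric_on_def
  proof (intro conjI ballI)
    fix p q assume pq: "p \<in> M" "q \<in> M"
    obtain a s b t where e: "p = (a, s)" "q = (b, t)" by (metis surj_pair)
    note g = ge[OF pq[unfolded e]] ge'[OF pq[unfolded e]]
    show "0 \<le> \<delta> p q" using order_trans[OF zero_le_dist g(2)] e by simp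
    show "\<delta> p q = \<delta> q p" using e by (simp add: \<delta>_def dist_commute abs_minus_commute)
    show "\<delta> p q = 0 \<longleftrightarrow> p = q"
    proof
      assume z: "\<delta> p q = 0"
      hence "dist a b \<le> 0" using g(2) e by simp
      moreover have "C * \<bar>s - t\<bar> \<le> 0" using g(1) e z by simp
      hence "\<bar>s - t\<bar> \<le> 0" using C by (simp add: mult_le_0_iff)
      ultimately show "p = q" using e by simp
    qed (simp add: e \<delta>_def)
  next
    fix p q r assume pqr: "p \<in> M" "q \<in> M" "r \<in> M"
    obtain a1 s1 a2 s2 a3 s3 where e: "p = (a1, s1)" "q = (a2, s2)" "r = (a3, s3)"
      by (metis surj_pair)
    have m: "a1 \<in> c" "a2 \<in> c" "a3 \<in> c" "0 \<le> s1" "s1 \<le> 1" "0 \<le> s2" "s2 \<le> 1" "0 \<le> s3" "s3 \<le> 1"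
      using pqr e by (auto simp: M_def)
    have "(1 - \<bar>s1 - s3\<bar>) * dist a1 a3 + C * \<bar>s1 - s3\<bar> \<le>
       ((1 - \<bar>s1 - s2\<bar>) * dist a1 a2 + C * \<bar>s1 - s2\<bar>) + ((1 - \<bar>s2 - s3\<bar>) * dist a2 a3 + C * \<bar>s2 - s3\<bar>)"
      by (rule interpolation_triangle) (use m C diam in \<open>auto simp: dist_triangle\<close>)
    thus "\<delta> p r \<le> \<delta> p q + \<delta> q r" using e by (simp add: \<delta>_def)
  qed
  have "\<exists>e :: 'u \<times> real \<Rightarrow> 'u. \<forall>x\<in>M. \<forall>y\<in>M. dist (e x) (e y) = \<delta> x y"
  proof (rule universal_metric_embeds[OF _ met])
    show "universal_polish TYPE('u)" using U by (simp add: urysohn_space_def)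
    show "countable (c \<times> ({0..1} \<inter> \<rat>))" "c \<times> ({0..1} \<inter> \<rat>) \<subseteq> M"
      using fin countable_rat by (auto simp: M_def countable_finite)
    show "\<exists>q\<in>c \<times> ({0..1} \<inter> \<rat>). \<delta> x q < e" if x: "x \<in> M" and e: "0 < e" for x e
    proof -
      obtain a s where xs: "x = (a, s)" "a \<in> c" "0 \<le> s" "s \<le> 1" using x by (auto simp: M_def)
      have "\<exists>r\<in>\<rat>. 0 \<le> r \<and> r \<le> 1 \<and> \<bar>s - r\<bar> < e / C"
      proof (cases "s = 0")
        case True
        thus ?thesis using e C by (intro bexI[of _ 0]) auto
      next
        case False
        have "max 0 (s - e / C) < s" using e C False xs by auto
        then obtain r where "r \<in> \<rat>" "max 0 (s - e / C) < r" "r < s" using Rats_dense_in_real by blast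
        thus ?thesis using xs by (intro bexI[of _ r]) auto
      qed
      then obtain r where r: "r \<in> \<rat>" "0 \<le> r" "r \<le> 1" "\<bar>s - r\<bar> < e / C" by blast
      have "\<delta> x (a, r) = C * \<bar>s - r\<bar>" using xs by (simp add: \<delta>_def)
      also have "\<dots> < e" using r C by (simp add: field_simps)
      finally show ?thesis using xs r by (intro bexI[of _ "(a, r)"]) auto
    qed
    fix \<sigma> :: "nat \<Rightarrow> 'u \<times> real"
    assume \<sigma>: "range \<sigma> \<subseteq> M" and Cau: "\<forall>e>0. \<exists>N. \<forall>n\<ge>N. \<forall>m\<ge>N. \<delta> (\<sigma> n) (\<sigma> m) < e"
    define a s where "a n = fst (\<sigma> n)" and "s n = snd (\<sigma> n)" for n
    have \<sigma>M: "(a n, s n) \<in> M" "\<sigma> n = (a n, s n)" for n using \<sigma> by (auto simp: a_def s_def)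
    obtain e0 where e0: "0 < e0" "\<And>x y. x \<in> c \<Longrightarrow> y \<in> c \<Longrightarrow> x \<noteq> y \<Longrightarrow> e0 \<le> dist x y"
      using finite_positive_gap[OF fin, of dist] by (metis zero_less_dist_iff)
    obtain N where N: "\<forall>n\<ge>N. \<forall>m\<ge>N. \<delta> (\<sigma> n) (\<sigma> m) < e0" using Cau e0(1) by blast
    have aN: "a n = a N" if "n \<ge> N" for n
    proof (rule ccontr)
      assume "a n \<noteq> a N"
      moreover have "a n \<in> c" "a N \<in> c" using \<sigma>M(1)[of n] \<sigma>M(1)[of N] by (auto simp: M_def)
      ultimately have "e0 \<le> dist (a n) (a N)" using e0(2) by blast
      moreover have "dist (a n) (a N) \<le> \<delta> (\<sigma> n) (\<sigma> N)" using ge'[OF \<sigma>M(1) \<sigma>M(1)] \<sigma>M(2) by metis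
      moreover have "\<delta> (\<sigma> n) (\<sigma> N) < e0" using N that by blast
      ultimately show False by linarith
    qed
    have "Cauchy s"
    proof (rule metric_CauchyI)
      fix e :: real assume "0 < e"
      then obtain K where K: "\<forall>n\<ge>K. \<forall>m\<ge>K. \<delta> (\<sigma> n) (\<sigma> m) < C * e" using Cau C by (meson mult_pos_pos)
      have "dist (s m) (s n) < e" if "m \<ge> K" "n \<ge> K" for m n
      proof -
        have "C * \<bar>s m - s n\<bar> \<le> \<delta> (\<sigma> m) (\<sigma> n)" using ge[OF \<sigma>M(1) \<sigma>M(1)] \<sigma>M(2) by metis
        also have "\<dots> < C * e" using K that by blast
        finally show ?thesis using C by (simp add: dist_real_def)
      qed
      thus "\<exists>M. \<forall>m\<ge>M. \<forall>n\<ge>M. dist (s m) (s n) < e" by blast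
    qed
    then obtain l where l: "s \<longlonglongrightarrow> l" using Cauchy_convergent_iff convergent_def by blast
    have s01: "0 \<le> s n" "s n \<le> 1" for n using \<sigma>M(1)[of n] by (auto simp: M_def)
    have l01: "0 \<le> l" "l \<le> 1"
      using LIMSEQ_le_const[OF l] LIMSEQ_le_const2[OF l] s01 by blast+
    show "\<exists>x\<in>M. \<forall>e>0. \<exists>N. \<forall>n\<ge>N. \<delta> (\<sigma> n) x < e"
    proof (intro bexI[of _ "(a N, l)"] allI impI)
      show "(a N, l) \<in> M" using \<sigma>M(1)[of N] l01 by (auto simp: M_def)
      fix e :: real assume "0 < e"
      hence "0 < e / C" using C by simp
      then obtain K where K: "\<forall>n\<ge>K. \<bar>s n - l\<bar> < e / C" using l LIMSEQ_D by fastforce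
      have "\<delta> (\<sigma> n) (a N, l) < e" if "n \<ge> max K N" for n
      proof -
        have "\<delta> (\<sigma> n) (a N, l) = C * \<bar>s n - l\<bar>"
          using aN[of n] that \<sigma>M(2)[of n] by (simp add: \<delta>_def)
        also have "\<dots> < e" using K that C by (simp add: field_simps)
        finally show ?thesis .
      qed
      thus "\<exists>K. \<forall>n\<ge>K. \<delta> (\<sigma> n) (a N, l) < e" by blast
    qed
  qed
  then obtain e :: "'u \<times> real \<Rightarrow> 'u" where e: "\<forall>x\<in>M. \<forall>y\<in>M. dist (e x) (e y) = \<delta> x y" by blast
  have "\<exists>g. g \<in> isometries \<and> (\<forall>a\<in>c. g a = e (a, t))" if t: "t \<in> {0..1}" for t
  proof -
    have "\<forall>a\<in>c. \<forall>b\<in>c. dist (e (a, t)) (e (b, t)) = dist a b"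
      using e t by (simp add: M_def \<delta>_def)
    from extends_to_isometry[OF U fin this] show ?thesis by blast
  qed
  then obtain \<gamma> where \<gamma>: "\<And>t. t \<in> {0..1} \<Longrightarrow> \<gamma> t \<in> isometries \<and> (\<forall>a\<in>c. \<gamma> t a = e (a, t))" by metis
  show thesis
  proof (rule that)
    show "\<gamma> t \<in> isometries" if "t \<in> {0..1}" for t using \<gamma> that by blast
    show "dist (\<gamma> s a) (\<gamma> t b) = (1 - \<bar>s - t\<bar>) * dist a b + C * \<bar>s - t\<bar>"
      if "s \<in> {0..1}" "t \<in> {0..1}" "a \<in> c" "b \<in> c" for s t a b
      using e \<gamma>[OF that(1)] \<gamma>[OF that(2)] that by (simp add: M_def \<delta>_def)
  qed
qed

lemma finite_diameter_bound:
  fixes c :: "'a::metric_space set"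
  assumes "finite c"
  obtains C where "0 < C" "\<And>x y. x \<in> c \<Longrightarrow> y \<in> c \<Longrightarrow> dist x y \<le> C"
proof -
  obtain e x0 where e: "\<forall>y\<in>c. dist x0 y \<le> e"
    using finite_imp_bounded[OF assms] by (auto simp: bounded_def)
  have "dist x y \<le> max 1 (2 * e)" if "x \<in> c" "y \<in> c" for x y
    using bspec[OF e that(1)] bspec[OF e that(2)] dist_triangle3[of x y x0] by linarith
  thus thesis using that[of "max 1 (2 * e)"] by simp
qed

text \<open>
  By \<open>same_position_imp_double_coset\<close>, every isometry in the same position as \<open>g\<close> has the form
  \<open>u \<circ> g \<circ> v\<close> with \<open>u\<close>, \<open>v\<close> in the stabilizer of
  \<open>c\<close>, so it is a product of \<open>2 * n + 1\<close> elements of \<open>V\<close>. For a small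
  \<open>h\<close> there is \<open>k\<close> such that \<open>k\<close> and \<open>h\<inverse> k\<close> are both in
  this position, and \<open>h = k (h\<inverse> k)\<inverse>\<close>.
\<close>

lemma moves_less_subset_npow:
  fixes c :: "'u::polish_space set"
  assumes U: "urysohn_space TYPE('u)" and fin: "finite c" and C: "0 < C"
    and diam: "\<And>a b. a \<in> c \<Longrightarrow> b \<in> c \<Longrightarrow> dist a b \<le> C"
    and z: "0 < z" "z \<le> 1"
    and V: "V \<subseteq> isometries" "\<And>g. g \<in> V \<Longrightarrow> isoinv g \<in> V"
    and fx: "fixator c \<subseteq> npow V n" and g: "g \<in> V"
    and gd: "\<And>a b. a \<in> c \<Longrightarrow> b \<in> c \<Longrightarrow> dist a (g b) = (1 - z) * dist a b + C * z"
  shows "\<exists>\<epsilon>>0. moves_less c \<epsilon> \<subseteq> npow V (4 * n + 2)"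
proof -
  obtain e0 where e0: "0 < e0" "\<And>x y. x \<in> c \<Longrightarrow> y \<in> c \<Longrightarrow> x \<noteq> y \<Longrightarrow> e0 \<le> dist x y"
    using finite_positive_gap[OF fin, of dist] by (metis zero_less_dist_iff)
  \<comment> \<open>two displacements fit into the amount z * e0 by which the factor 1 - z shrinks distances in c,
      and into C * z, the least distance from the new copy of c\<close>
  define \<epsilon> where "\<epsilon> = min (z * e0 / 2) (C * z / 2)"
  have \<epsilon>: "0 < \<epsilon>" "2 * \<epsilon> \<le> z * e0" "2 * \<epsilon> \<le> C * z" using e0 z C by (auto simp: \<epsilon>_def)
  have gI: "g \<in> isometries" using g V by blast
  have pos: "k \<in> npow V (2 * n + 1)"
    if k: "k \<in> isometries" "\<And>a b. a \<in> c \<Longrightarrow> b \<in> c \<Longrightarrow> dist a (k b) = (1 - z) * dist a b + C * z" for k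
  proof -
    have "dist a (k b) = dist a (g b)" if "a \<in> c" "b \<in> c" for a b using that gd k(2) by simp
    from same_position_imp_double_coset[OF U fin gI k(1) this] obtain u v
      where uv: "u \<in> fixator c" "v \<in> fixator c" "k = u \<circ> (g \<circ> v)" by blast
    have "g \<in> npow V 1" using g npow_1 by blast
    hence "u \<circ> (g \<circ> v) \<in> npow V (n + (1 + n))" using uv fx by (blast intro: npow_comp)
    thus ?thesis using uv(3) by (simp add: mult_2)
  qed
  have "h \<in> npow V (4 * n + 2)" if h: "h \<in> moves_less c \<epsilon>" for h
  proof -
    have hI: "h \<in> isometries" and hm: "\<And>a. a \<in> c \<Longrightarrow> dist (h a) a < \<epsilon>"
      using h by (auto simp: moves_less_def)
    define X where "X = c \<union> h ` c"
    have "\<exists>a\<in>c. dist x a < \<epsilon>" if "x \<in> X" for x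
      using that hm \<epsilon>(1) by (auto simp: X_def intro: bexI[of _ x])
    then obtain \<rho> where \<rho>: "\<And>x. x \<in> X \<Longrightarrow> \<rho> x \<in> c" "\<And>x. x \<in> X \<Longrightarrow> dist x (\<rho> x) < \<epsilon>" by metis
    have near: "a = \<rho> x" if "a \<in> c" "x \<in> X" "dist x a < \<epsilon>" for a x
    proof (rule ccontr)
      assume "a \<noteq> \<rho> x"
      hence "e0 \<le> dist a (\<rho> x)" using e0(2) that \<rho> by blast
      also have "\<dots> \<le> dist x a + dist x (\<rho> x)" by (rule dist_triangle3)
      also have "\<dots> < 2 * \<epsilon>" using \<rho>(2)[OF that(2)] that by simp
      also have "\<dots> \<le> e0" using \<epsilon>(2) z e0(1) mult_right_mono[of z 1 e0] by linarith
      finally show False by simp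
    qed
    \<comment> \<open>points of c and their images under h get the same distances, those prescribed by the position\<close>
    define F where "F a x = (1 - z) * dist a (\<rho> x) + C * z" for a x
    have Cz: "0 < C * z" using C z by simp
    have close: "dist (\<rho> x) (\<rho> y) - 2 * \<epsilon> \<le> dist x y" "dist x y \<le> dist (\<rho> x) (\<rho> y) + 2 * \<epsilon>"
      if "x \<in> X" "y \<in> X" for x y
      using \<rho>(2)[OF that(1)] \<rho>(2)[OF that(2)] dist_triangle[of "\<rho> x" "\<rho> y" x] dist_triangle[of x "\<rho> y" y]
        dist_triangle[of x y "\<rho> x"] dist_triangle[of "\<rho> x" y "\<rho> y"] dist_commute[of x "\<rho> x"] dist_commute[of y "\<rho> y"]
      by linarith+
    have shrink: "(1 - z) * dist (\<rho> x) (\<rho> y) \<le> dist x y" if "x \<in> X" "y \<in> X" for x y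
    proof (cases "\<rho> x = \<rho> y")
      case False
      have "z * e0 \<le> z * dist (\<rho> x) (\<rho> y)" using e0(2) \<rho>(1) that False z by (intro mult_left_mono) auto
      thus ?thesis using close(1)[OF that] \<epsilon>(2) by (simp add: algebra_simps)
    qed simp
    have stretch: "dist a b \<le> (1 - z) * dist a b + C * z" if "a \<in> c" "b \<in> c" for a b
      using mult_right_mono[OF diam[OF that], of z] z by (simp add: algebra_simps)
    have tri: "(1 - z) * p \<le> (1 - z) * q + (1 - z) * r" if "p \<le> q + r" for p q r
      using mult_left_mono[OF that, of "1 - z"] z by (simp add: algebra_simps)
    obtain k where k: "k \<in> isometries" "\<And>a x. a \<in> c \<Longrightarrow> x \<in> X \<Longrightarrow> dist (k a) x = F a x"
    proof (rule isometry_with_distances[OF U fin, of X F])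
      show "finite X" using fin by (simp add: X_def)
      fix a x assume ax: "a \<in> c" "x \<in> X"
      have "0 \<le> (1 - z) * dist a (\<rho> x)" using z by simp
      thus "0 < F a x" using Cz by (simp add: F_def)
      {
        fix y assume y: "y \<in> X"
        have "(1 - z) * dist a (\<rho> x) \<le> (1 - z) * dist a (\<rho> y) + (1 - z) * dist (\<rho> x) (\<rho> y)"
          by (rule tri) (metis dist_commute dist_triangle)
        thus "F a x \<le> F a y + dist x y" using shrink[OF ax(2) y] by (simp add: F_def)
        have "(1 - z) * dist (\<rho> x) (\<rho> y) \<le> (1 - z) * dist a (\<rho> x) + (1 - z) * dist a (\<rho> y)"
          by (rule tri) (rule dist_triangle3)
        moreover have "dist (\<rho> x) (\<rho> y) \<le> (1 - z) * dist (\<rho> x) (\<rho> y) + C * z"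
          using stretch \<rho>(1) ax y by blast
        ultimately show "dist x y \<le> F a x + F a y"
          using close(2)[OF ax(2) y] \<epsilon>(3) by (simp add: F_def)
      }
      fix b assume b: "b \<in> c"
      have "(1 - z) * dist a b \<le> (1 - z) * dist a (\<rho> x) + (1 - z) * dist b (\<rho> x)"
        by (rule tri) (rule dist_triangle2)
      thus "dist a b \<le> F a x + F b x" using stretch[OF ax(1) b] Cz by (simp add: F_def)
      have "(1 - z) * dist a (\<rho> x) \<le> (1 - z) * dist b (\<rho> x) + (1 - z) * dist a b"
        by (rule tri) (metis add.commute dist_triangle)
      moreover have "(1 - z) * dist a b \<le> dist a b" using z by (simp add: algebra_simps)
      ultimately show "F a x \<le> F b x + dist a b" by (simp add: F_def)
    qed blast
    have "k \<in> npow V (2 * n + 1)"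
    proof (rule pos[OF k(1)])
      fix a b assume ab: "a \<in> c" "b \<in> c"
      have "a \<in> X" "\<rho> a = a" using near[of a a] ab \<epsilon>(1) by (auto simp: X_def)
      thus "dist a (k b) = (1 - z) * dist a b + C * z"
        using k(2)[OF ab(2), of a] by (simp add: F_def dist_commute)
    qed
    moreover have hk: "isoinv h \<circ> k \<in> npow V (2 * n + 1)"
    proof (rule pos)
      show "isoinv h \<circ> k \<in> isometries" using hI k by (simp add: comp_in_isometries isoinv_in_isometries)
      fix a b assume ab: "a \<in> c" "b \<in> c"
      have X: "h a \<in> X" "\<rho> (h a) = a" using near[of a "h a"] ab hm by (auto simp: X_def)
      have "dist a ((isoinv h \<circ> k) b) = dist (h a) (k b)"
        by (rule dist_isoinv_comp[OF hI])
      thus "dist a ((isoinv h \<circ> k) b) = (1 - z) * dist a b + C * z"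
        using k(2)[OF ab(2) X(1)] X(2) by (simp add: F_def dist_commute)
    qed
    from npow_isoinv[OF V(1) _ hk] V(2) have "isoinv (isoinv h \<circ> k) \<in> npow V (2 * n + 1)" by blast
    ultimately have "k \<circ> isoinv (isoinv h \<circ> k) \<in> npow V ((2 * n + 1) + (2 * n + 1))" by (rule npow_comp)
    moreover have "k \<circ> isoinv (isoinv h \<circ> k) = h" by (rule comp_isoinv_isoinv_comp[OF hI k(1)])
    ultimately show ?thesis by (simp add: algebra_simps)
  qed
  thus ?thesis using \<epsilon>(1) by blast
qed

text \<open>
  Following the path of copies in steps that move \<open>c\<close> by less than \<open>\<epsilon>\<close> shows that
  \<open>H\<close> contains an isometry \<open>w\<close> for which all distances between \<open>c\<close> and
  \<open>w ` c\<close> equal \<open>C\<close>, hence all isometries in this position. An arbitrary \<open>g\<close> is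
  \<open>k (g\<inverse> k)\<inverse>\<close> with \<open>k\<close> moving \<open>c\<close> to distance
  \<open>C\<close> from \<open>c\<close> and from \<open>g ` c\<close>.
\<close>

lemma subgroup_containing_moves_less:
  fixes c :: "'u::polish_space set"
  assumes U: "urysohn_space TYPE('u)" and fin: "finite c" and \<epsilon>: "0 < \<epsilon>"
    and sub: "moves_less c \<epsilon> \<subseteq> H" and comp: "\<And>g h. g \<in> H \<Longrightarrow> h \<in> H \<Longrightarrow> g \<circ> h \<in> H"
    and inv: "\<And>g. g \<in> H \<Longrightarrow> isoinv g \<in> H"
  shows "isometries \<subseteq> H"
proof
  fix g :: "'u \<Rightarrow> 'u" assume g: "g \<in> isometries"
  define X where "X = c \<union> g ` c"
  have finX: "finite X" using fin by (simp add: X_def)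
  obtain C where C: "0 < C" "\<And>x y. x \<in> X \<Longrightarrow> y \<in> X \<Longrightarrow> dist x y \<le> C"
    using finite_diameter_bound[OF finX] by blast
  obtain \<gamma> :: "real \<Rightarrow> 'u \<Rightarrow> 'u" where \<gamma>: "\<And>t. t \<in> {0..1} \<Longrightarrow> \<gamma> t \<in> isometries"
    "\<And>s t a b. s \<in> {0..1} \<Longrightarrow> t \<in> {0..1} \<Longrightarrow> a \<in> c \<Longrightarrow> b \<in> c \<Longrightarrow>
        dist (\<gamma> s a) (\<gamma> t b) = (1 - \<bar>s - t\<bar>) * dist a b + C * \<bar>s - t\<bar>"
    using path_of_copies[OF U fin C(1)] C(2) unfolding X_def by blast
  have rel: "isoinv (\<gamma> s) \<circ> \<gamma> t \<in> isometries"
    "a \<in> c \<Longrightarrow> b \<in> c \<Longrightarrow> dist a ((isoinv (\<gamma> s) \<circ> \<gamma> t) b) = (1 - \<bar>s - t\<bar>) * dist a b + C * \<bar>s - t\<bar>"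
    if "s \<in> {0..1}" "t \<in> {0..1}" for s t a b
  proof -
    show "isoinv (\<gamma> s) \<circ> \<gamma> t \<in> isometries"
      using \<gamma>(1) that by (simp add: comp_in_isometries isoinv_in_isometries)
    assume "a \<in> c" "b \<in> c"
    thus "dist a ((isoinv (\<gamma> s) \<circ> \<gamma> t) b) = (1 - \<bar>s - t\<bar>) * dist a b + C * \<bar>s - t\<bar>"
      unfolding dist_isoinv_comp[OF \<gamma>(1)[OF that(1)]] by (rule \<gamma>(2)[OF that])
  qed
  obtain m :: nat where "C / \<epsilon> < real m" using reals_Archimedean2 by blast
  hence m: "C < real m * \<epsilon>" using \<epsilon> by (simp add: field_simps)
  have m0: "0 < m" using m C by (cases m) auto
  have t01: "real k / real m \<in> {0..1}" if "k \<le> m" for k using that m0 by simp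
  have steps: "isoinv (\<gamma> 0) \<circ> \<gamma> (real k / real m) \<in> H" if "k \<le> m" for k
    using that
  proof (induction k)
    case 0
    have "\<gamma> 0 \<in> isometries" by (rule \<gamma>(1)) simp
    from isoinv_comp(1)[OF this] have e: "isoinv (\<gamma> 0) \<circ> \<gamma> (real 0 / real m) = id" by simp
    have "id \<in> moves_less c \<epsilon>" using \<epsilon> by (simp add: moves_less_def id_in_isometries)
    thus ?case unfolding e using sub by blast
  next
    case (Suc k)
    let ?s = "real k / real m" and ?t = "real (Suc k) / real m"
    have st: "?s \<in> {0..1}" "?t \<in> {0..1}" using Suc.prems by (auto intro!: t01 simp del: of_nat_Suc)
    have d: "\<bar>?s - ?t\<bar> = 1 / real m" using m0 by (simp add: field_simps abs_if)
    have "dist ((isoinv (\<gamma> ?s) \<circ> \<gamma> ?t) a) a < \<epsilon>" if "a \<in> c" for a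
    proof -
      have "dist ((isoinv (\<gamma> ?s) \<circ> \<gamma> ?t) a) a = C * (1 / real m)"
        using rel(2)[OF st that that] d by (simp add: dist_commute)
      also have "\<dots> < \<epsilon>" using m m0 by (simp add: field_simps)
      finally show ?thesis .
    qed
    hence "isoinv (\<gamma> ?s) \<circ> \<gamma> ?t \<in> H" using sub rel(1)[OF st] by (auto simp: moves_less_def)
    moreover have "isoinv (\<gamma> 0) \<circ> \<gamma> ?s \<in> H" by (rule Suc.IH) (use Suc.prems in simp)
    ultimately have "(isoinv (\<gamma> 0) \<circ> \<gamma> ?s) \<circ> (isoinv (\<gamma> ?s) \<circ> \<gamma> ?t) \<in> H" using comp by blast
    moreover have "(isoinv (\<gamma> 0) \<circ> \<gamma> ?s) \<circ> (isoinv (\<gamma> ?s) \<circ> \<gamma> ?t) = isoinv (\<gamma> 0) \<circ> \<gamma> ?t"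
      using isoinv_cancel(2)[OF \<gamma>(1)[OF st(1)]] by (simp add: fun_eq_iff)
    ultimately show ?case by argo
  qed
  define w where "w = isoinv (\<gamma> 0) \<circ> \<gamma> 1"
  have wH: "w \<in> H" using steps[of m] m0 by (simp add: w_def)
  have w: "w \<in> isometries" "\<And>a b. a \<in> c \<Longrightarrow> b \<in> c \<Longrightarrow> dist a (w b) = C"
    using rel[of 0 1] by (auto simp: w_def)
  have fixH: "fixator c \<subseteq> H" using sub \<epsilon> by (auto simp: fixator_def moves_less_def)
  have pos: "k \<in> H" if k: "k \<in> isometries" "\<And>a b. a \<in> c \<Longrightarrow> b \<in> c \<Longrightarrow> dist a (k b) = C" for k
  proof -
    have "dist a (k b) = dist a (w b)" if "a \<in> c" "b \<in> c" for a b using that w k(2) by simp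
    from same_position_imp_double_coset[OF U fin w(1) k(1) this] obtain u v
      where uv: "u \<in> fixator c" "v \<in> fixator c" "k = u \<circ> (w \<circ> v)" by blast
    thus ?thesis using fixH wH comp by blast
  qed
  obtain k where k: "k \<in> isometries" "\<And>a x. a \<in> c \<Longrightarrow> x \<in> X \<Longrightarrow> dist (k a) x = C"
  proof (rule isometry_with_distances[OF U fin finX, of "\<lambda>_ _. C"])
    show "dist a b \<le> C + C" if "a \<in> c" "b \<in> c" for a b using C(2)[of a b] C(1) that by (simp add: X_def)
    show "dist x y \<le> C + C" if "x \<in> X" "y \<in> X" for x y using C(2)[OF that] C(1) by simp
  qed (use C in auto)
  have "k \<in> H" by (rule pos[OF k(1)]) (use k(2) in \<open>auto simp: X_def dist_commute\<close>)
  moreover have "isoinv g \<circ> k \<in> H"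
  proof (rule pos)
    show "isoinv g \<circ> k \<in> isometries" using g k by (simp add: comp_in_isometries isoinv_in_isometries)
    fix a b assume ab: "a \<in> c" "b \<in> c"
    have "dist a ((isoinv g \<circ> k) b) = dist (g a) (k b)"
      by (rule dist_isoinv_comp[OF g])
    thus "dist a ((isoinv g \<circ> k) b) = C" using k(2)[OF ab(2), of "g a"] ab by (simp add: X_def dist_commute)
  qed
  ultimately have "k \<circ> isoinv (isoinv g \<circ> k) \<in> H" using comp inv by blast
  moreover have "k \<circ> isoinv (isoinv g \<circ> k) = g" by (rule comp_isoinv_isoinv_comp[OF g k(1)])
  ultimately show "g \<in> H" by simp
qed

section \<open>Isometries preserving a countable dense set\<close>

text \<open>
  A countable dense subset on which finite extension problems can still be solved exactly, as long as the distances lie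
  in \<open>S\<close>. Closure of \<open>S\<close> under addition makes path metrics and amalgams available.
\<close>

locale dense_injective =
  fixes D :: "'u::polish_space set" and S :: "real set"
  assumes countable_D: "countable D" and dense: "closure D = UNIV"
    and dist_S: "\<And>x y. x \<in> D \<Longrightarrow> y \<in> D \<Longrightarrow> dist x y \<in> S"
    and S_0: "0 \<in> S" and S_add: "\<And>s t. s \<in> S \<Longrightarrow> t \<in> S \<Longrightarrow> s + t \<in> S"
    and S_pos: "\<exists>s\<in>S. 0 < s"
    and injective: "finitely_injective D S"
begin

definition P :: "('u \<Rightarrow> 'u) set" where
  "P = {g \<in> isometries. g ` D = D}"

lemma P_isometry: "g \<in> P \<Longrightarrow> g \<in> isometries"
  and P_mem: "g \<in> P \<Longrightarrow> d \<in> D \<Longrightarrow> g d \<in> D"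
  by (auto simp: P_def)

lemma P_dist: "g \<in> P \<Longrightarrow> dist (g x) (g y) = dist x y"
  by (simp add: P_isometry isometry_dist)

lemma P_id: "id \<in> P"
  by (simp add: P_def id_in_isometries)

lemma P_comp: "g \<in> P \<Longrightarrow> h \<in> P \<Longrightarrow> g \<circ> h \<in> P"
  unfolding P_def by (simp only: mem_Collect_eq comp_in_isometries image_comp[symmetric] simp_thms)

lemma P_isoinv:
  assumes "g \<in> P" shows "isoinv g \<in> P"
proof -
  have g: "g \<in> isometries" "g ` D = D" using assms by (auto simp: P_def)
  have "isoinv g ` g ` D = D" using isoinv_cancel(1)[OF g(1)] by (simp add: image_image)
  thus ?thesis using g isoinv_in_isometries[OF g(1)] by (simp add: P_def)
qed

lemma P_isoinv_cancel: "g \<in> P \<Longrightarrow> isoinv g (g x) = x" "g \<in> P \<Longrightarrow> g (isoinv g x) = x"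
  using isoinv_cancel P_isometry by blast+

lemma D_nonempty: "D \<noteq> {}" using dense by auto

text \<open>
  Uniform continuity extends \<open>f\<close> to the closure of \<open>D\<close>; completeness makes the extension
  surjective.
\<close>

lemma extends_to_P:
  assumes iso: "\<And>x y. x \<in> D \<Longrightarrow> y \<in> D \<Longrightarrow> dist (f x) (f y) = dist x y" and surj: "f ` D = D"
  shows "\<exists>h\<in>P. \<forall>d\<in>D. h d = f d"
proof -
  have "uniformly_continuous_on D f"
    unfolding uniformly_continuous_on_def
  proof (intro allI impI)
    fix e :: real assume "0 < e"
    thus "\<exists>d>0. \<forall>x\<in>D. \<forall>x'\<in>D. dist x' x < d \<longrightarrow> dist (f x') (f x) < e"
      using iso by (intro exI[of _ e]) auto
  qed
  then obtain g where g: "uniformly_continuous_on (closure D) g" "\<And>x. x \<in> D \<Longrightarrow> f x = g x"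
    by (rule uniformly_continuous_on_extension_on_closure) blast
  have cont: "g \<midarrow>x\<rightarrow> g x" for x
    using uniformly_continuous_imp_continuous[OF g(1)] dense
    by (auto simp: continuous_on_def)
  have seq: "\<exists>s. (\<forall>n. s n \<in> D) \<and> s \<longlonglongrightarrow> x" for x
    using dense closure_sequential[of x D] by auto
  have lim: "(\<lambda>n. g (s n)) \<longlonglongrightarrow> g x" if "s \<longlonglongrightarrow> x" for s x
    using continuous_on_tendsto_compose[OF uniformly_continuous_imp_continuous[OF g(1)] that] dense by auto
  have dist: "dist (g x) (g y) = dist x y" for x y
  proof -
    obtain s t where s: "\<forall>n. s n \<in> D" "s \<longlonglongrightarrow> x" and t: "\<forall>n. t n \<in> D" "t \<longlonglongrightarrow> y" using seq by metis
    have "(\<lambda>n. dist (g (s n)) (g (t n))) \<longlonglongrightarrow> dist (g x) (g y)"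
      using lim s t by (intro tendsto_dist) auto
    moreover have "dist (g (s n)) (g (t n)) = dist (s n) (t n)" for n
      using iso g(2) s t by metis
    moreover have "(\<lambda>n. dist (s n) (t n)) \<longlonglongrightarrow> dist x y" using s t by (intro tendsto_dist)
    ultimately show ?thesis using LIMSEQ_unique by auto
  qed
  have "\<exists>x. g x = y" for y
  proof -
    obtain t where t: "\<forall>n. t n \<in> D" "t \<longlonglongrightarrow> y" using seq by metis
    have "\<forall>n. \<exists>s. s \<in> D \<and> g s = t n" using t surj g(2) by (metis imageE)
    then obtain s where s: "\<And>n. s n \<in> D" "\<And>n. g (s n) = t n" by metis
    have "Cauchy t" using t LIMSEQ_imp_Cauchy by blast
    hence "Cauchy s" unfolding Cauchy_def using dist s(2) by metis
    then obtain x where "s \<longlonglongrightarrow> x" using Cauchy_convergent_iff convergent_def by blast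
    from lim[OF this] have "t \<longlonglongrightarrow> g x" using s(2) by simp
    thus ?thesis using t LIMSEQ_unique by blast
  qed
  moreover have "inj g"
  proof (rule injI)
    fix x y assume "g x = g y"
    thus "x = y" using dist[of x y] by simp
  qed
  ultimately have "bij g" by (auto simp: bij_def surj_def) metis
  hence "g \<in> isometries" using dist by (simp add: isometries_def)
  moreover have "g ` D = D" using surj g(2) by (metis image_cong)
  ultimately show ?thesis using g(2) by (auto simp: P_def)
qed

text \<open>
  Stabilization at every point of \<open>D\<close> alone gives an isometric map of \<open>D\<close> into itself; the
  condition on the inverses makes the limit surjective.
\<close>

lemma limit_in_P:
  assumes g: "\<And>n. g n \<in> P" and C: "\<And>n. C n \<subseteq> C (Suc n)"
    and agree: "\<And>n c. c \<in> C n \<Longrightarrow> g (Suc n) c = g n c"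
    and dom: "\<And>d. d \<in> D \<Longrightarrow> \<exists>n. d \<in> C n" and ran: "\<And>d. d \<in> D \<Longrightarrow> \<exists>n. isoinv (g n) d \<in> C n"
  shows "\<exists>h\<in>P. \<forall>n. \<forall>c\<in>C n \<inter> D. h c = g n c"
proof -
  have Cmono: "C m \<subseteq> C n" if "m \<le> n" for m n using lift_Suc_mono_le[of C] C that by blast
  have stable: "g (m + k) c = g m c" if "c \<in> C m" for m k c
  proof (induction k)
    case (Suc k)
    have "c \<in> C (m + k)" using Cmono[of m "m + k"] that by auto
    thus ?case using agree Suc by simp
  qed simp
  define f where "f c = g (LEAST n. c \<in> C n) c" for c
  have f: "f c = g n c" if "c \<in> C n" for c n
  proof -
    have "(LEAST n. c \<in> C n) \<le> n" "c \<in> C (LEAST n. c \<in> C n)" using that by (auto intro: Least_le LeastI)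
    thus ?thesis using stable[of c "LEAST n. c \<in> C n" "n - (LEAST n. c \<in> C n)"] by (simp add: f_def)
  qed
  have "dist (f x) (f y) = dist x y" if "x \<in> D" "y \<in> D" for x y
  proof -
    obtain m n where "x \<in> C m" "y \<in> C n" using dom \<open>x \<in> D\<close> \<open>y \<in> D\<close> by blast
    hence "x \<in> C (max m n)" "y \<in> C (max m n)" using Cmono[of m "max m n"] Cmono[of n "max m n"] by auto
    thus ?thesis using f P_dist[OF g] by metis
  qed
  moreover have "f ` D = D"
  proof
    show "f ` D \<subseteq> D" using g P_mem by (auto simp: f_def)
    show "D \<subseteq> f ` D"
    proof
      fix d assume d: "d \<in> D"
      then obtain n where n: "isoinv (g n) d \<in> C n" using ran by blast
      hence "f (isoinv (g n) d) = d" using f P_isoinv_cancel[OF g] by metis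
      moreover have "isoinv (g n) d \<in> D" using P_mem[OF P_isoinv[OF g] d] .
      ultimately show "d \<in> f ` D" by (metis imageI)
    qed
  qed
  ultimately obtain h where h: "h \<in> P" "\<forall>d\<in>D. h d = f d" using extends_to_P[of f] by blast
  thus ?thesis using f by (intro bexI[of _ h]) auto
qed

section \<open>Tame systems\<close>

text \<open>
  Finite systems of isometries are represented by their length \<open>n\<close> and a sequence \<open>z\<close>, of
  which the first \<open>n\<close> entries matter, so that \<open>z(n := y)\<close> is the extension by one isometry.
\<close>

definition invariant :: "nat \<Rightarrow> (nat \<Rightarrow> 'u \<Rightarrow> 'u) \<Rightarrow> 'u set \<Rightarrow> bool" where
  "invariant n z A \<longleftrightarrow> (\<forall>i<n. z i ` A = A)"

definition isometric_on :: "'u set \<Rightarrow> ('u \<Rightarrow> 'u) \<Rightarrow> bool" where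
  "isometric_on A f \<longleftrightarrow> (\<forall>x\<in>A. \<forall>y\<in>A. dist (f x) (f y) = dist x y)"

text \<open>
  The second condition says that finite invariant sets are cofinal. The third is a relative injectivity: if the action
  on a finite invariant set \<open>A\<close> extends to an action \<open>e\<close> by isometries on a finite
  \<open>E \<supseteq> A\<close>, then \<open>E\<close> embeds over \<open>A\<close> equivariantly.
\<close>

definition tame :: "nat \<Rightarrow> (nat \<Rightarrow> 'u \<Rightarrow> 'u) \<Rightarrow> bool" where
  "tame n z \<longleftrightarrow> (\<forall>i<n. z i \<in> P) \<and>
     (\<forall>A. finite A \<and> A \<subseteq> D \<longrightarrow> (\<exists>B. finite B \<and> A \<subseteq> B \<and> B \<subseteq> D \<and> invariant n z B)) \<and>
     (\<forall>A E e. finite E \<and> A \<subseteq> E \<and> E \<subseteq> D \<and> invariant n z A \<and>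
        (\<forall>i<n. e i ` E = E \<and> isometric_on E (e i) \<and> (\<forall>a\<in>A. e i a = z i a)) \<longrightarrow>
        (\<exists>j. j ` E \<subseteq> D \<and> isometric_on E j \<and> (\<forall>a\<in>A. j a = a) \<and>
             (\<forall>i<n. \<forall>x\<in>E. j (e i x) = z i (j x))))"

lemma tame_P: "tame n z \<Longrightarrow> i < n \<Longrightarrow> z i \<in> P"
  by (simp add: tame_def)

lemma tame_invariant:
  assumes "tame n z" "finite A" "A \<subseteq> D"
  obtains B where "finite B" "A \<subseteq> B" "B \<subseteq> D" "invariant n z B"
proof -
  from conjunct1[OF conjunct2[OF assms(1)[unfolded tame_def]], rule_format, OF conjI[OF assms(2,3)]]
  obtain B where B: "finite B \<and> A \<subseteq> B \<and> B \<subseteq> D \<and> invariant n z B" ..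
  show thesis by (rule that[of B]) (use B in simp_all)
qed

lemma tame_embedding:
  assumes "tame n z" "finite E" "A \<subseteq> E" "E \<subseteq> D" "invariant n z A"
    "\<forall>i<n. e i ` E = E \<and> isometric_on E (e i) \<and> (\<forall>a\<in>A. e i a = z i a)"
  obtains j where "j ` E \<subseteq> D" "isometric_on E j" "\<And>a. a \<in> A \<Longrightarrow> j a = a"
    "\<And>i x. i < n \<Longrightarrow> x \<in> E \<Longrightarrow> j (e i x) = z i (j x)"
proof -
  have "\<exists>j. j ` E \<subseteq> D \<and> isometric_on E j \<and> (\<forall>a\<in>A. j a = a) \<and> (\<forall>i<n. \<forall>x\<in>E. j (e i x) = z i (j x))"
    using conjunct2[OF conjunct2[OF assms(1)[unfolded tame_def]]] assms(2-) by blast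
  thus thesis using that by blast
qed

lemma tame_0: "tame 0 z"
  unfolding tame_def
proof (intro conjI allI impI)
  show "\<exists>B. finite B \<and> A \<subseteq> B \<and> B \<subseteq> D \<and> invariant 0 z B" if "finite A \<and> A \<subseteq> D" for A
    using that by (auto simp: invariant_def)
  show "\<exists>j. j ` E \<subseteq> D \<and> isometric_on E j \<and> (\<forall>a\<in>A. j a = a) \<and> (\<forall>i<0. \<forall>x\<in>E. j (e i x) = z i (j x))"
    if "finite E \<and> A \<subseteq> E \<and> E \<subseteq> D \<and> invariant 0 z A \<and>
      (\<forall>i<0. e i ` E = E \<and> isometric_on E (e i) \<and> (\<forall>a\<in>A. e i a = z i a))" for A E e
    using that by (intro exI[of _ id]) (auto simp: isometric_on_def)
qed auto

lemma isometric_on_inj: "isometric_on A f \<Longrightarrow> inj_on f A"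
  unfolding isometric_on_def inj_on_def by (metis dist_self zero_less_dist_iff less_irrefl)

lemma isometric_on_P: "g \<in> P \<Longrightarrow> isometric_on A g"
  by (simp add: isometric_on_def P_dist)

lemma extend_in_D:
  assumes "finite E" "A \<subseteq> E" "E \<subseteq> D" "f ` A \<subseteq> D" "isometric_on A f"
  obtains k where "\<And>a. a \<in> A \<Longrightarrow> k a = f a" "k ` E \<subseteq> D" "isometric_on E k"
proof (rule extend_isometric_embedding[OF injective assms(1), of dist A f])
  show "metric_on E dist" by (auto simp: metric_on_def dist_commute dist_triangle)
  show "distances E dist \<subseteq> S" using assms(3) dist_S by (auto simp: distances_def)
  show "dist (f x) (f y) = dist x y" if "x \<in> A" "y \<in> A" for x y
    using assms(5) that by (simp add: isometric_on_def)
  fix f' assume "\<And>x. x \<in> A \<Longrightarrow> f' x = f x" "f' ` E \<subseteq> D"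
    "\<And>x y. x \<in> E \<Longrightarrow> y \<in> E \<Longrightarrow> dist (f' x) (f' y) = dist x y"
  thus thesis using that[of f'] by (simp add: isometric_on_def)
qed (use assms in auto)

text \<open>
  Finite equivariant partial isometries, as relations, so that back and forth are exchanged by taking the converse.
\<close>

definition partial_conjugacy ::
    "nat \<Rightarrow> (nat \<Rightarrow> 'u \<Rightarrow> 'u) \<Rightarrow> (nat \<Rightarrow> 'u \<Rightarrow> 'u) \<Rightarrow> ('u \<times> 'u) set \<Rightarrow> bool" where
  "partial_conjugacy n z z' r \<longleftrightarrow> finite r \<and> r \<subseteq> D \<times> D \<and>
     (\<forall>a b a' b'. (a, b) \<in> r \<longrightarrow> (a', b') \<in> r \<longrightarrow> dist a a' = dist b b') \<and>
     (\<forall>i<n. \<forall>a b. (a, b) \<in> r \<longrightarrow> (z i a, z' i b) \<in> r)"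

lemma partial_conjugacyD:
  assumes "partial_conjugacy n z z' r"
  shows "finite r" "r \<subseteq> D \<times> D" "\<And>a b a' b'. (a, b) \<in> r \<Longrightarrow> (a', b') \<in> r \<Longrightarrow> dist a a' = dist b b'"
    "\<And>i a b. i < n \<Longrightarrow> (a, b) \<in> r \<Longrightarrow> (z i a, z' i b) \<in> r"
  using assms unfolding partial_conjugacy_def by blast+

lemma partial_conjugacy_converse:
  assumes "partial_conjugacy n z z' r" shows "partial_conjugacy n z' z (r\<inverse>)"
  unfolding partial_conjugacy_def
proof (intro conjI allI impI)
  note r = partial_conjugacyD[OF assms]
  show "finite (r\<inverse>)" "r\<inverse> \<subseteq> D \<times> D" using r(1,2) by auto
  show "dist a a' = dist b b'" if "(a, b) \<in> r\<inverse>" "(a', b') \<in> r\<inverse>" for a b a' b'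
    using r(3)[of b a b' a'] that by simp
  show "(z' i a, z i b) \<in> r\<inverse>" if "i < n" "(a, b) \<in> r\<inverse>" for i a b
    using r(4)[of i b a] that by simp
qed

text \<open>
  Enclose \<open>d\<close> and the domain in a finite invariant set \<open>E\<close> of \<open>z\<close>, copy
  \<open>E\<close> over the range in an arbitrary way, transport the action to the copy, and use the tameness of
  \<open>z'\<close> to make the copy equivariant.
\<close>

lemma partial_conjugacy_extend:
  assumes z: "tame n z" and z': "tame n z'" and r: "partial_conjugacy n z z' r" and d: "d \<in> D"
  shows "\<exists>r'. r \<subseteq> r' \<and> partial_conjugacy n z z' r' \<and> d \<in> Domain r'"
proof -
  note r = partial_conjugacyD[OF r]
  define A where "A = Domain r"
  have fA: "finite A" "A \<subseteq> D" using r(1,2) finite_Domain by (auto simp: A_def)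
  have "\<forall>a\<in>A. \<exists>b. (a, b) \<in> r" by (auto simp: A_def)
  then obtain f where f: "\<And>a. a \<in> A \<Longrightarrow> (a, f a) \<in> r" by metis
  have rf: "a \<in> A" "b = f a" if "(a, b) \<in> r" for a b
  proof -
    show "a \<in> A" using that by (auto simp: A_def)
    from r(3)[OF that f[OF this]] show "b = f a" by simp
  qed
  have fiso: "isometric_on A f" unfolding isometric_on_def using r(3) f by metis
  have fD: "f ` A \<subseteq> D" using f r(2) by auto
  obtain E where E: "finite E" "insert d A \<subseteq> E" "E \<subseteq> D" "invariant n z E"
    using tame_invariant[OF z, of "insert d A"] fA d by auto
  obtain k where k: "\<And>a. a \<in> A \<Longrightarrow> k a = f a" "k ` E \<subseteq> D" "isometric_on E k"
    using extend_in_D[OF E(1) _ E(3) fD fiso] E(2) by auto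
  have kinj: "inj_on k E" by (rule isometric_on_inj[OF k(3)])
  define ki where "ki = inv_into E k"
  have kik: "ki (k x) = x" if "x \<in> E" for x using kinj that by (simp add: ki_def)
  define e where "e i = k \<circ> z i \<circ> ki" for i
  have zE: "z i ` E = E" if "i < n" for i using E(4) that by (simp add: invariant_def)
  have ek: "e i (k x) = k (z i x)" if "x \<in> E" for i x using kik that by (simp add: e_def)
  have inv: "invariant n z' (f ` A)"
    unfolding invariant_def
  proof (intro allI impI)
    fix i assume i: "i < n"
    have "z' i ` (f ` A) \<subseteq> f ` A"
    proof (intro image_subsetI, elim imageE)
      fix b a assume "b = f a" "a \<in> A"
      hence "(z i a, z' i b) \<in> r" using r(4)[OF i f] by simp
      thus "z' i b \<in> f ` A" using rf by blast
    qed
    moreover have "inj_on (z' i) (f ` A)"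
      by (rule isometric_on_inj[OF isometric_on_P[OF tame_P[OF z' i]]])
    ultimately show "z' i ` (f ` A) = f ` A" using fA(1) by (intro endo_inj_surj) auto
  qed
  have fk: "f ` A = k ` A" using k(1) by (auto simp: image_iff)
  have cond: "\<forall>i<n. e i ` (k ` E) = k ` E \<and> isometric_on (k ` E) (e i) \<and> (\<forall>a\<in>f ` A. e i a = z' i a)"
  proof (intro allI impI conjI ballI)
    fix i assume i: "i < n"
    have "e i ` (k ` E) = k ` (z i ` E)" using ek by (auto simp: image_image)
    thus "e i ` (k ` E) = k ` E" using zE[OF i] by simp
    have "z i x \<in> E" if "x \<in> E" for x using zE[OF i] that by blast
    thus "isometric_on (k ` E) (e i)"
      using k(3) P_dist[OF tame_P[OF z i]] ek by (auto simp: isometric_on_def)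
    fix b assume "b \<in> f ` A"
    then obtain a where a: "a \<in> A" "b = f a" by blast
    have "(z i a, z' i b) \<in> r" using r(4)[OF i f] a by simp
    hence "z i a \<in> A" "z' i b = f (z i a)" using rf by blast+
    thus "e i b = z' i b" using ek[of a i] k(1) a E(2) by auto
  qed
  obtain j where j: "j ` (k ` E) \<subseteq> D" "isometric_on (k ` E) j" "\<And>a. a \<in> f ` A \<Longrightarrow> j a = a"
      "\<And>i x. i < n \<Longrightarrow> x \<in> k ` E \<Longrightarrow> j (e i x) = z' i (j x)"
    by (rule tame_embedding[OF z' _ _ k(2) inv cond]) (use E fk in auto)
  define r' where "r' = (\<lambda>x. (x, j (k x))) ` E"
  have "r \<subseteq> r'"
  proof
    fix p assume "p \<in> r"
    then obtain a where a: "a \<in> A" "p = (a, f a)" using rf by (cases p) blast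
    have "j (k a) = f a" using k(1)[OF a(1)] j(3)[of "f a"] a(1) by simp
    thus "p \<in> r'" using a E(2) by (auto simp: r'_def)
  qed
  moreover have "partial_conjugacy n z z' r'"
    unfolding partial_conjugacy_def
  proof (intro conjI)
    show "finite r'" using E by (simp add: r'_def)
    show "r' \<subseteq> D \<times> D" using E(3) j(1) by (auto simp: r'_def)
    show "\<forall>a b a' b'. (a, b) \<in> r' \<longrightarrow> (a', b') \<in> r' \<longrightarrow> dist a a' = dist b b'"
      using k(3) j(2) by (auto simp: r'_def isometric_on_def)
    have "(z i x, z' i (j (k x))) \<in> r'" if "i < n" "x \<in> E" for i x
    proof -
      have "z i x \<in> E" using zE that by blast
      moreover have "z' i (j (k x)) = j (k (z i x))" using j(4)[of i "k x"] ek[of x i] that by simp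
      ultimately show ?thesis by (simp add: r'_def)
    qed
    thus "\<forall>i<n. \<forall>a b. (a, b) \<in> r' \<longrightarrow> (z i a, z' i b) \<in> r'" by (auto simp: r'_def)
  qed
  moreover have "d \<in> Domain r'" using E(2) by (auto simp: r'_def)
  ultimately show ?thesis by blast
qed

text \<open>
  Back-and-forth along an enumeration of \<open>D\<close>.
\<close>

lemma tame_conjugate:
  assumes z: "tame n z" and z': "tame n z'" and r: "partial_conjugacy n z z' r"
  shows "\<exists>h\<in>P. (\<forall>(a, b)\<in>r. h a = b) \<and> (\<forall>i<n. h \<circ> z i = z' i \<circ> h)"
proof -
  define d where "d = from_nat_into D"
  have dD: "d n \<in> D" for n using D_nonempty by (simp add: d_def from_nat_into)
  have dsurj: "\<exists>n. x = d n" if "x \<in> D" for x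
    using from_nat_into_surj[OF countable_D that] by (auto simp: d_def)
  have step: "\<exists>r''. r' \<subseteq> r'' \<and> partial_conjugacy n z z' r'' \<and> x \<in> Domain r'' \<and> x \<in> Range r''"
    if r': "partial_conjugacy n z z' r'" and x: "x \<in> D" for r' x
  proof -
    obtain r1 where r1: "r' \<subseteq> r1" "partial_conjugacy n z z' r1" "x \<in> Domain r1"
      using partial_conjugacy_extend[OF z z' r' x] by blast
    obtain r2 where r2: "r1\<inverse> \<subseteq> r2" "partial_conjugacy n z' z r2" "x \<in> Domain r2"
      using partial_conjugacy_extend[OF z' z partial_conjugacy_converse[OF r1(2)] x] by blast
    have "r' \<subseteq> r2\<inverse>" "x \<in> Domain (r2\<inverse>)" "x \<in> Range (r2\<inverse>)" using r1 r2 by auto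
    thus ?thesis using partial_conjugacy_converse[OF r2(2)] by blast
  qed
  have "\<exists>R. \<forall>k. (partial_conjugacy n z z' (R k) \<and> (k = 0 \<longrightarrow> R k = r)) \<and>
      (R k \<subseteq> R (Suc k) \<and> d k \<in> Domain (R (Suc k)) \<and> d k \<in> Range (R (Suc k)))"
  proof (rule dependent_nat_choice)
    show "\<exists>x. partial_conjugacy n z z' x \<and> (0 = 0 \<longrightarrow> x = r)" using r by auto
    show "\<exists>y. (partial_conjugacy n z z' y \<and> (Suc k = 0 \<longrightarrow> y = r)) \<and>
        x \<subseteq> y \<and> d k \<in> Domain y \<and> d k \<in> Range y"
      if "partial_conjugacy n z z' x \<and> (k = 0 \<longrightarrow> x = r)" for x k
      using step[of x "d k"] that dD by auto
  qed
  then obtain R where R: "\<And>k. partial_conjugacy n z z' (R k)" "R 0 = r" "\<And>k. R k \<subseteq> R (Suc k)"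
    "\<And>k. d k \<in> Domain (R (Suc k))" "\<And>k. d k \<in> Range (R (Suc k))" by auto
  have Rmono: "R i \<subseteq> R j" if "i \<le> j" for i j using lift_Suc_mono_le[of R] R(3) that by blast
  define U where "U = (\<Union>k. R k)"
  have Uiso: "dist a a' = dist b b'" if ab: "(a, b) \<in> U" "(a', b') \<in> U" for a b a' b'
  proof -
    obtain i j where "(a, b) \<in> R i" "(a', b') \<in> R j" using ab by (auto simp: U_def)
    hence "(a, b) \<in> R (max i j)" "(a', b') \<in> R (max i j)" using Rmono[of i "max i j"] Rmono[of j "max i j"] by auto
    thus ?thesis using partial_conjugacyD(3)[OF R(1)] by blast
  qed
  have UD: "U \<subseteq> D \<times> D" using partial_conjugacyD(2)[OF R(1)] unfolding U_def by blast
  have Uz: "(z i a, z' i b) \<in> U" if i: "i < n" and ab: "(a, b) \<in> U" for i a b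
  proof -
    obtain k where "(a, b) \<in> R k" using ab by (auto simp: U_def)
    from partial_conjugacyD(4)[OF R(1) i this] show ?thesis by (auto simp: U_def)
  qed
  have "\<forall>x\<in>D. \<exists>y. (x, y) \<in> U"
  proof
    fix x assume "x \<in> D"
    then obtain k where "x = d k" using dsurj by blast
    with R(4)[of k] obtain y where "(x, y) \<in> R (Suc k)" by auto
    thus "\<exists>y. (x, y) \<in> U" by (auto simp: U_def)
  qed
  then obtain f where f: "\<And>x. x \<in> D \<Longrightarrow> (x, f x) \<in> U" by metis
  have fU: "b = f a" if "(a, b) \<in> U" for a b
  proof -
    have "a \<in> D" using UD that by auto
    from Uiso[OF that f[OF this]] show ?thesis by simp
  qed
  have "dist (f x) (f y) = dist x y" if "x \<in> D" "y \<in> D" for x y using Uiso[OF f f] that by simp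
  moreover have "f ` D = D"
  proof
    show "f ` D \<subseteq> D" using f UD by auto
    show "D \<subseteq> f ` D"
    proof
      fix y assume "y \<in> D"
      then obtain k where "y \<in> Range (R (Suc k))" using dsurj R(5) by metis
      then obtain x where "(x, y) \<in> U" by (auto simp: U_def)
      thus "y \<in> f ` D" using fU UD by auto
    qed
  qed
  ultimately obtain h where h: "h \<in> P" "\<forall>d\<in>D. h d = f d" using extends_to_P[of f] by blast
  have "h a = b" if "(a, b) \<in> U" for a b using fU that h(2) UD by auto
  moreover have "r \<subseteq> U" using R(2) by (auto simp: U_def)
  moreover have "h \<circ> z i = z' i \<circ> h" if i: "i < n" for i
  proof (rule isometries_eq_if_dense[OF _ _ dense])
    show "h \<circ> z i \<in> isometries" "z' i \<circ> h \<in> isometries"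
      using h z z' i tame_P P_comp P_isometry by blast+
    fix x assume x: "x \<in> D"
    have "z' i (f x) = f (z i x)" using Uz[OF i f[OF x]] fU by blast
    moreover have "z i x \<in> D" using P_mem[OF tame_P[OF z i] x] .
    ultimately show "(h \<circ> z i) x = (z' i \<circ> h) x" using h(2) x by simp
  qed
  ultimately show ?thesis using h(1) by (intro bexI[of _ h]) auto
qed

text \<open>
  The homogeneity of \<open>D\<close>, as the case of conjugacy between empty systems.
\<close>

lemma extends_finite_to_P:
  assumes "finite C" "C \<subseteq> D" "f ` C \<subseteq> D" "isometric_on C f"
  shows "\<exists>h\<in>P. \<forall>c\<in>C. h c = f c"
proof -
  have "partial_conjugacy 0 undefined undefined ((\<lambda>c. (c, f c)) ` C)"
    using assms by (auto simp: partial_conjugacy_def isometric_on_def)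
  from tame_conjugate[OF tame_0 tame_0 this] show ?thesis by auto
qed

section \<open>Genericity of tame systems\<close>

text \<open>
  Openness and density in \<open>P\<close> with respect to pointwise convergence on the discrete set \<open>D\<close>: a
  basic neighbourhood prescribes the values on a finite subset of \<open>D\<close>.
\<close>

definition dense_open :: "('u \<Rightarrow> 'u) set \<Rightarrow> bool" where
  "dense_open X \<longleftrightarrow>
     (\<forall>g\<in>X. \<exists>C. finite C \<and> C \<subseteq> D \<and> (\<forall>h\<in>P. (\<forall>c\<in>C. h c = g c) \<longrightarrow> h \<in> X)) \<and>
     (\<forall>g\<in>P. \<forall>C. finite C \<and> C \<subseteq> D \<longrightarrow> (\<exists>h\<in>X \<inter> P. \<forall>c\<in>C. h c = g c))"

definition comeager :: "('u \<Rightarrow> 'u) set \<Rightarrow> bool" where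
  "comeager R \<longleftrightarrow> (\<exists>\<X>. countable \<X> \<and> (\<forall>X\<in>\<X>. dense_open X) \<and> P \<inter> \<Inter>\<X> \<subseteq> R)"

lemma comeager_Int:
  assumes "comeager R" "comeager R'" shows "comeager (R \<inter> R')"
proof -
  obtain \<X> \<Y> where "countable \<X>" "\<forall>X\<in>\<X>. dense_open X" "P \<inter> \<Inter>\<X> \<subseteq> R"
    "countable \<Y>" "\<forall>X\<in>\<Y>. dense_open X" "P \<inter> \<Inter>\<Y> \<subseteq> R'"
    using assms unfolding comeager_def by metis
  thus ?thesis unfolding comeager_def by (intro exI[of _ "\<X> \<union> \<Y>"]) auto
qed

lemma dense_open_translate:
  assumes b: "b \<in> P" and X: "dense_open X"
  shows "dense_open {y. isoinv b \<circ> y \<in> X}"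
  unfolding dense_open_def
proof (intro conjI ballI allI impI)
  fix g assume "g \<in> {y. isoinv b \<circ> y \<in> X}"
  then obtain C where C: "finite C" "C \<subseteq> D" "\<forall>h\<in>P. (\<forall>c\<in>C. h c = (isoinv b \<circ> g) c) \<longrightarrow> h \<in> X"
    using X unfolding dense_open_def by blast
  have "isoinv b \<circ> h \<in> X" if "h \<in> P" "\<forall>c\<in>C. h c = g c" for h
    using C(3) P_comp[OF P_isoinv[OF b] that(1)] that(2) by simp
  thus "\<exists>C. finite C \<and> C \<subseteq> D \<and> (\<forall>h\<in>P. (\<forall>c\<in>C. h c = g c) \<longrightarrow> h \<in> {y. isoinv b \<circ> y \<in> X})"
    using C(1,2) by blast
next
  fix g C assume g: "g \<in> P" and C: "finite C \<and> C \<subseteq> D"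
  have "isoinv b \<circ> g \<in> P" using P_comp[OF P_isoinv[OF b] g] .
  then obtain w where w: "w \<in> X \<inter> P" "\<forall>c\<in>C. w c = (isoinv b \<circ> g) c"
    using X C unfolding dense_open_def by metis
  have "isoinv b \<circ> (b \<circ> w) = w" using P_isoinv_cancel(1)[OF b] by (simp add: fun_eq_iff)
  moreover have "\<forall>c\<in>C. (b \<circ> w) c = g c" using w(2) P_isoinv_cancel(2)[OF b] by simp
  ultimately show "\<exists>h\<in>{y. isoinv b \<circ> y \<in> X} \<inter> P. \<forall>c\<in>C. h c = g c"
    using w(1) P_comp[OF b, of w] by (intro bexI[of _ "b \<circ> w"]) simp_all
qed

lemma comeager_translate:
  assumes b: "b \<in> P" and R: "comeager R" shows "comeager {y. isoinv b \<circ> y \<in> R}"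
proof -
  obtain \<X> where X: "countable \<X>" "\<forall>X\<in>\<X>. dense_open X" "P \<inter> \<Inter>\<X> \<subseteq> R"
    using R unfolding comeager_def by metis
  show ?thesis
    unfolding comeager_def
  proof (intro exI conjI)
    show "countable ((\<lambda>X. {y. isoinv b \<circ> y \<in> X}) ` \<X>)" using X(1) by simp
    show "\<forall>X\<in>(\<lambda>X. {y. isoinv b \<circ> y \<in> X}) ` \<X>. dense_open X"
      using X(2) dense_open_translate[OF b] by blast
    show "P \<inter> \<Inter>((\<lambda>X. {y. isoinv b \<circ> y \<in> X}) ` \<X>) \<subseteq> {y. isoinv b \<circ> y \<in> R}"
      using X(3) P_comp[OF P_isoinv[OF b]] by auto
  qed
qed

lemma transport_isometry:
  fixes \<phi> :: "'e \<Rightarrow> 'u"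
  assumes \<phi>: "\<And>x y. x \<in> E \<Longrightarrow> y \<in> E \<Longrightarrow> dist (\<phi> x) (\<phi> y) = \<epsilon> x y" "inj_on \<phi> E"
    and \<theta>: "\<theta> ` E = E" "\<And>x y. x \<in> E \<Longrightarrow> y \<in> E \<Longrightarrow> \<epsilon> (\<theta> x) (\<theta> y) = \<epsilon> x y"
  obtains e where "e ` (\<phi> ` E) = \<phi> ` E" "isometric_on (\<phi> ` E) e" "\<And>x. x \<in> E \<Longrightarrow> e (\<phi> x) = \<phi> (\<theta> x)"
proof
  define e where "e = \<phi> \<circ> \<theta> \<circ> inv_into E \<phi>"
  show e: "e (\<phi> x) = \<phi> (\<theta> x)" if "x \<in> E" for x using that \<phi>(2) by (simp add: e_def)
  have "e ` (\<phi> ` E) = \<phi> ` (\<theta> ` E)" using e by (auto simp: image_image)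
  thus "e ` (\<phi> ` E) = \<phi> ` E" using \<theta>(1) by simp
  have "\<theta> x \<in> E" if "x \<in> E" for x using \<theta>(1) that by blast
  thus "isometric_on (\<phi> ` E) e" using e \<phi>(1) \<theta>(2) by (auto simp: isometric_on_def)
qed

lemma metric_on_dist: "metric_on (E :: 'u set) dist"
  by (auto simp: metric_on_def dist_commute dist_triangle)

lemma distances_dist: "E \<subseteq> D \<Longrightarrow> distances E dist \<subseteq> S"
  using dist_S by (auto simp: distances_def)

lemma metric_on_eq_0: "metric_on E \<epsilon> \<Longrightarrow> x \<in> E \<Longrightarrow> y \<in> E \<Longrightarrow> \<epsilon> x y = 0 \<Longrightarrow> x = y"
  unfolding metric_on_def by blast

lemma extension_property_D:
  assumes "finite A" "A \<subseteq> D"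
  obtains E :: "nat set" and \<epsilon> \<iota> where "finite E" "metric_on E \<epsilon>" "distances E \<epsilon> \<subseteq> S" "\<iota> ` A \<subseteq> E"
     "\<forall>a\<in>A. \<forall>b\<in>A. \<epsilon> (\<iota> a) (\<iota> b) = dist a b" "partial_isometries_extend A dist E \<epsilon> \<iota>"
proof -
  obtain s0 where s0: "s0 \<in> S" "0 < s0" using S_pos by blast
  have "\<exists>(E :: nat set) \<epsilon> \<iota>. finite E \<and> metric_on E \<epsilon> \<and> distances E \<epsilon> \<subseteq> S \<and> \<iota> ` A \<subseteq> E \<and>
     (\<forall>a\<in>A. \<forall>b\<in>A. \<epsilon> (\<iota> a) (\<iota> b) = dist a b) \<and> partial_isometries_extend A dist E \<epsilon> \<iota>"
    by (rule metric_extension_property[OF assms(1) metric_on_dist distances_dist[OF assms(2)] S_0 _ s0])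
      (rule S_add)
  thus thesis by (elim exE conjE) (rule that)
qed

text \<open>
  Enclose \<open>C\<close> and its image in a finite invariant set \<open>B0\<close> of \<open>z\<close>. By the
  extension property, a finite \<open>E \<supseteq> B0\<close> has isometries extending the action of \<open>z\<close>
  on \<open>B0\<close> and the restriction of \<open>g\<close> to \<open>C\<close>. Tameness embeds \<open>E\<close>
  over \<open>B0\<close> into \<open>D\<close> so that \<open>z\<close> acts on the image as prescribed; the extension
  of \<open>g\<close> is transported there and extended to all of \<open>D\<close>.
\<close>

lemma finite_invariant_dense:
  assumes z: "tame n z" and g: "g \<in> P" and C: "finite C" "C \<subseteq> D"
  obtains h B where "h \<in> P" "\<And>c. c \<in> C \<Longrightarrow> h c = g c" "finite B" "C \<subseteq> B" "B \<subseteq> D"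
    "invariant (Suc n) (z(n := h)) B"
proof -
  have "finite (C \<union> g ` C)" "C \<union> g ` C \<subseteq> D" using C P_mem[OF g] by auto
  then obtain B0 where B0: "finite B0" "C \<union> g ` C \<subseteq> B0" "B0 \<subseteq> D" "invariant n z B0"
    using tame_invariant[OF z] by metis
  obtain E :: "nat set" and \<epsilon> \<iota> where E: "finite E" "metric_on E \<epsilon>" "distances E \<epsilon> \<subseteq> S" "\<iota> ` B0 \<subseteq> E"
      "\<forall>a\<in>B0. \<forall>b\<in>B0. \<epsilon> (\<iota> a) (\<iota> b) = dist a b"
    and ext: "partial_isometries_extend B0 dist E \<epsilon> \<iota>"
    using extension_property_D[OF B0(1,3)] by metis
  have \<iota>inj: "inj_on \<iota> B0"
  proof (rule inj_onI)
    fix a b assume ab: "a \<in> B0" "b \<in> B0" "\<iota> a = \<iota> b"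
    have "\<epsilon> (\<iota> a) (\<iota> b) = 0" using E(2,4) ab unfolding metric_on_def by blast
    thus "a = b" using E(5)[rule_format, OF ab(1,2)] by simp
  qed
  obtain \<phi> :: "nat \<Rightarrow> 'u" where \<phi>: "\<And>x. x \<in> \<iota> ` B0 \<Longrightarrow> \<phi> x = inv_into B0 \<iota> x" "\<phi> ` E \<subseteq> D"
    "\<And>x y. x \<in> E \<Longrightarrow> y \<in> E \<Longrightarrow> dist (\<phi> x) (\<phi> y) = \<epsilon> x y"
  proof (rule extend_isometric_embedding[OF injective E(1,2,3,4), of "inv_into B0 \<iota>"])
    show "inv_into B0 \<iota> ` \<iota> ` B0 \<subseteq> D" using \<iota>inj B0(3) by auto
    show "dist (inv_into B0 \<iota> x) (inv_into B0 \<iota> y) = \<epsilon> x y" if "x \<in> \<iota> ` B0" "y \<in> \<iota> ` B0" for x y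
      using that \<iota>inj E(5) by auto
  qed blast
  have \<phi>\<iota>: "\<phi> (\<iota> b) = b" if "b \<in> B0" for b using \<phi>(1)[of "\<iota> b"] that \<iota>inj by simp
  have \<phi>inj: "inj_on \<phi> E"
  proof (rule inj_onI)
    fix x y assume xy: "x \<in> E" "y \<in> E" "\<phi> x = \<phi> y"
    hence "\<epsilon> x y = 0" using \<phi>(3)[of x y] by simp
    thus "x = y" using metric_on_eq_0[OF E(2)] xy by blast
  qed
  have lift: "\<exists>e. e ` (\<phi> ` E) = \<phi> ` E \<and> isometric_on (\<phi> ` E) e \<and> (\<forall>a\<in>C'. e a = p a)"
    if p: "partial_isometry B0 dist C' p" for C' p
  proof -
    obtain \<theta> where \<theta>: "bij_betw \<theta> E E" "\<forall>x\<in>E. \<forall>y\<in>E. \<epsilon> (\<theta> x) (\<theta> y) = \<epsilon> x y" "\<forall>a\<in>C'. \<theta> (\<iota> a) = \<iota> (p a)"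
      using ext p unfolding partial_isometries_extend_def by metis
    have C': "C' \<subseteq> B0" "p ` C' \<subseteq> B0" using p by (auto simp: partial_isometry_def)
    obtain e where e: "e ` (\<phi> ` E) = \<phi> ` E" "isometric_on (\<phi> ` E) e" "\<And>x. x \<in> E \<Longrightarrow> e (\<phi> x) = \<phi> (\<theta> x)"
      by (rule transport_isometry[OF \<phi>(3) \<phi>inj, of \<theta>]) (use \<theta> in \<open>auto simp: bij_betw_def\<close>)
    have "e a = p a" if "a \<in> C'" for a
    proof -
      have "a \<in> B0" "p a \<in> B0" using that C' by auto
      hence "e (\<phi> (\<iota> a)) = \<phi> (\<iota> (p a))" using e(3) E(4) \<theta>(3) that by auto
      thus ?thesis using \<phi>\<iota> \<open>a \<in> B0\<close> \<open>p a \<in> B0\<close> by simp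
    qed
    thus ?thesis using e by blast
  qed
  have "\<forall>i. i < n \<longrightarrow> (\<exists>e. e ` (\<phi> ` E) = \<phi> ` E \<and> isometric_on (\<phi> ` E) e \<and> (\<forall>a\<in>B0. e a = z i a))"
  proof (intro allI impI)
    fix i assume i: "i < n"
    have "partial_isometry B0 dist B0 (z i)"
      using B0(4) P_dist[OF tame_P[OF z i]] i by (auto simp: partial_isometry_def invariant_def)
    thus "\<exists>e. e ` (\<phi> ` E) = \<phi> ` E \<and> isometric_on (\<phi> ` E) e \<and> (\<forall>a\<in>B0. e a = z i a)" by (rule lift)
  qed
  then obtain e where e: "\<forall>i<n. e i ` (\<phi> ` E) = \<phi> ` E \<and> isometric_on (\<phi> ` E) (e i) \<and> (\<forall>a\<in>B0. e i a = z i a)"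
    by metis
  have "partial_isometry B0 dist C g" using B0(2) P_dist[OF g] by (auto simp: partial_isometry_def)
  from lift[OF this] obtain p where p: "p ` (\<phi> ` E) = \<phi> ` E" "isometric_on (\<phi> ` E) p" "\<forall>a\<in>C. p a = g a"
    by blast
  have B0E: "B0 \<subseteq> \<phi> ` E"
  proof
    fix b assume "b \<in> B0"
    thus "b \<in> \<phi> ` E" using \<phi>\<iota>[of b] E(4) by (metis image_eqI image_subset_iff)
  qed
  obtain j where j: "j ` (\<phi> ` E) \<subseteq> D" "isometric_on (\<phi> ` E) j" "\<And>a. a \<in> B0 \<Longrightarrow> j a = a"
    "\<And>i x. i < n \<Longrightarrow> x \<in> \<phi> ` E \<Longrightarrow> j (e i x) = z i (j x)"
    by (rule tame_embedding[OF z _ B0E \<phi>(2) B0(4) e]) (use E(1) in auto)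
  define B where "B = j ` (\<phi> ` E)"
  obtain q where q: "q ` B = B" "isometric_on B q" "\<And>x. x \<in> \<phi> ` E \<Longrightarrow> q (j x) = j (p x)"
    unfolding B_def
  proof (rule transport_isometry[of "\<phi> ` E" j dist p])
    show "dist (j x) (j y) = dist x y" "dist (p x) (p y) = dist x y" if "x \<in> \<phi> ` E" "y \<in> \<phi> ` E" for x y
      using j(2) p(2) that by (auto simp: isometric_on_def)
    show "inj_on j (\<phi> ` E)" by (rule isometric_on_inj[OF j(2)])
    show "p ` \<phi> ` E = \<phi> ` E" by (rule p(1))
  qed blast
  have finB: "finite B" "B \<subseteq> D" using E(1) j(1) by (auto simp: B_def)
  obtain h where h: "h \<in> P" "\<forall>b\<in>B. h b = q b"
    using extends_finite_to_P[OF finB(1,2) _ q(2)] q(1) finB(2) by auto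
  have B0B: "B0 \<subseteq> B" using B0E j(3) by (force simp: B_def)
  show thesis
  proof (rule that[OF h(1)])
    show "h c = g c" if c: "c \<in> C" for c
    proof -
      have cB: "c \<in> B0" "g c \<in> B0" using c B0(2) by auto
      hence "h c = q (j c)" using h(2) B0B j(3) by auto
      also have "\<dots> = j (p c)" using q(3) cB B0E by blast
      also have "\<dots> = g c" using p(3) c j(3) cB by simp
      finally show ?thesis .
    qed
    show "finite B" "B \<subseteq> D" by fact+
    show "C \<subseteq> B" using B0(2) B0B by blast
    show "invariant (Suc n) (z(n := h)) B"
      unfolding invariant_def
    proof (intro allI impI)
      fix i assume i: "i < Suc n"
      show "(z(n := h)) i ` B = B"
      proof (cases "i = n")
        case True
        have "h ` B = q ` B" using h(2) by (auto simp: image_iff)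
        thus ?thesis using True q(1) by simp
      next
        case False
        hence i: "i < n" using i by simp
        have "z i ` B = j ` (e i ` (\<phi> ` E))"
          unfolding B_def image_image using j(4)[OF i] by (intro image_cong) auto
        thus ?thesis using e i False by (simp add: B_def)
      qed
    qed
  qed
qed

definition extension_data :: "nat \<Rightarrow> (nat \<Rightarrow> 'u \<Rightarrow> 'u) \<Rightarrow> 'u set \<Rightarrow> 'u set \<Rightarrow> (nat \<Rightarrow> 'u \<Rightarrow> 'u) \<Rightarrow> bool" where
  "extension_data n z A E e \<longleftrightarrow> invariant n z A \<and>
     (\<forall>i<n. e i ` E = E \<and> isometric_on E (e i) \<and> (\<forall>a\<in>A. e i a = z i a))"

definition realizes :: "nat \<Rightarrow> (nat \<Rightarrow> 'u \<Rightarrow> 'u) \<Rightarrow> 'u set \<Rightarrow> 'u set \<Rightarrow> (nat \<Rightarrow> 'u \<Rightarrow> 'u) \<Rightarrow> ('u \<Rightarrow> 'u) \<Rightarrow> bool" where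
  "realizes n z A E e j \<longleftrightarrow> j ` E \<subseteq> D \<and> isometric_on E j \<and> (\<forall>a\<in>A. j a = a) \<and>
     (\<forall>i<n. \<forall>x\<in>E. j (e i x) = z i (j x))"

lemma tame_iff:
  "tame n z \<longleftrightarrow> (\<forall>i<n. z i \<in> P) \<and>
     (\<forall>A. finite A \<and> A \<subseteq> D \<longrightarrow> (\<exists>B. finite B \<and> A \<subseteq> B \<and> B \<subseteq> D \<and> invariant n z B)) \<and>
     (\<forall>A E e. finite E \<and> A \<subseteq> E \<and> E \<subseteq> D \<and> extension_data n z A E e \<longrightarrow> (\<exists>j. realizes n z A E e j))"
  unfolding tame_def extension_data_def realizes_def by blast

text \<open>
  The free amalgam of \<open>B\<close> and \<open>E\<close> over \<open>A\<close>, with distances capped at some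
  \<open>M\<close> above all those in \<open>B\<close> and \<open>E\<close>. The cap is needed if \<open>A\<close> is
  empty. The formula for the mixed distances, rather than mere existence, is what makes the actions on \<open>B\<close>
  and \<open>E\<close> combine to an action by isometries.
\<close>

lemma amalgam_in_D:
  assumes B: "finite B" "B \<subseteq> D" and E: "finite E" "E \<subseteq> D" and A: "A \<subseteq> B" "A \<subseteq> E"
  obtains k M where "k ` E \<subseteq> D" "isometric_on E k" "\<And>a. a \<in> A \<Longrightarrow> k a = a"
    "\<And>b x. b \<in> B \<Longrightarrow> x \<in> E - A \<Longrightarrow> k x \<notin> B \<and> dist b (k x) = Min (insert M ((\<lambda>a. dist b a + dist a x) ` A))"
proof -
  obtain s0 where s0: "s0 \<in> S" "0 < s0" using S_pos by blast
  have "finite ((\<lambda>(x, y). dist x y) ` ((B \<union> E) \<times> (B \<union> E)))" using B E by simp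
  from multiple_above[OF this S_0 S_add s0] obtain M where MS: "M \<in> S" and M0: "0 < M"
    and M': "\<And>w. w \<in> (\<lambda>(x, y). dist x y) ` ((B \<union> E) \<times> (B \<union> E)) \<Longrightarrow> w < M" by blast
  have M: "dist x y < M" if "x \<in> B \<union> E" "y \<in> B \<union> E" for x y
    by (rule M', rule image_eqI[of _ _ "(x, y)"]) (use that in auto)
  have finA: "finite A" using A B finite_subset by blast
  define m where "m b x = Min (insert M ((\<lambda>a. dist b a + dist a x) ` A))" for b x
  have m_le: "m b x \<le> M" "a \<in> A \<Longrightarrow> m b x \<le> dist b a + dist a x" for a b x
    unfolding m_def using finA by (auto intro!: Min_le)
  have m_cases: "m b x = M \<or> (\<exists>a\<in>A. m b x = dist b a + dist a x)" for b x
  proof -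
    have "m b x \<in> insert M ((\<lambda>a. dist b a + dist a x) ` A)"
      unfolding m_def by (rule Min_in) (use finA in auto)
    thus ?thesis by auto
  qed
  define G :: "('u + 'u) set" where "G = Inl ` B \<union> Inr ` (E - A)"
  define \<delta> :: "'u + 'u \<Rightarrow> 'u + 'u \<Rightarrow> real" where
    "\<delta> p q = (case (p, q) of (Inl x, Inl y) \<Rightarrow> dist x y | (Inr x, Inr y) \<Rightarrow> dist x y
       | (Inl b, Inr x) \<Rightarrow> m b x | (Inr x, Inl b) \<Rightarrow> m b x)" for p q
  have m_pos: "0 < m b x" if "x \<in> E - A" for b x
  proof -
    have "0 < dist b a + dist a x" if "a \<in> A" for a
    proof -
      have "a \<noteq> x" using that \<open>x \<in> E - A\<close> by blast
      hence "0 < dist a x" by simp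
      thus ?thesis using zero_le_dist[of b a] by linarith
    qed
    thus ?thesis using m_cases[of b x] M0 by auto
  qed
  have mS: "m b x \<in> S" if "b \<in> B" "x \<in> E" for b x
  proof -
    have "dist b a + dist a x \<in> S" if "a \<in> A" for a
      using that \<open>b \<in> B\<close> \<open>x \<in> E\<close> A B E by (intro S_add dist_S) auto
    thus ?thesis using m_cases[of b x] MS by auto
  qed
  have t1: "m b x \<le> dist b b' + m b' x" for b b' x
    using m_cases[of b' x]
  proof
    assume "m b' x = M" thus ?thesis using m_le(1)[of b x] zero_le_dist[of b b'] by linarith
  next
    assume "\<exists>a\<in>A. m b' x = dist b' a + dist a x"
    then obtain a where "a \<in> A" "m b' x = dist b' a + dist a x" by blast
    thus ?thesis using m_le(2)[of a b x] dist_triangle[of b a b'] by linarith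
  qed
  have t2: "m b x \<le> m b x' + dist x' x" for b x x'
    using m_cases[of b x']
  proof
    assume "m b x' = M" thus ?thesis using m_le(1)[of b x] zero_le_dist[of x' x] by linarith
  next
    assume "\<exists>a\<in>A. m b x' = dist b a + dist a x'"
    then obtain a where "a \<in> A" "m b x' = dist b a + dist a x'" by blast
    thus ?thesis using m_le(2)[of a b x] dist_triangle[of a x x'] by linarith
  qed
  have m_nn: "0 \<le> m b x" for b x using m_cases[of b x] M0 by auto
  have t3: "dist b b' \<le> m b x + m b' x" if "b \<in> B" "b' \<in> B" for b b' x
  proof (cases "m b x = M \<or> m b' x = M")
    case True
    thus ?thesis using M[of b b'] that m_nn[of b x] m_nn[of b' x] by auto
  next
    case False
    then obtain a a' where a: "a \<in> A" "m b x = dist b a + dist a x" "a' \<in> A" "m b' x = dist b' a' + dist a' x"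
      using m_cases[of b x] m_cases[of b' x] by blast
    have "dist b b' \<le> dist b a + dist a x + dist x a' + dist a' b'"
      using dist_triangle[of b b' a] dist_triangle[of a b' x] dist_triangle[of x b' a'] by linarith
    thus ?thesis using a by (simp add: dist_commute)
  qed
  have t4: "dist x x' \<le> m b x + m b x'" if "x \<in> E" "x' \<in> E" for b x x'
  proof (cases "m b x = M \<or> m b x' = M")
    case True
    thus ?thesis using M[of x x'] that m_nn[of b x] m_nn[of b x'] by auto
  next
    case False
    then obtain a a' where a: "a \<in> A" "m b x = dist b a + dist a x" "a' \<in> A" "m b x' = dist b a' + dist a' x'"
      using m_cases[of b x] m_cases[of b x'] by blast
    have "dist x x' \<le> dist x a + dist a b + dist b a' + dist a' x'"
      using dist_triangle[of x x' a] dist_triangle[of a x' b] dist_triangle[of b x' a'] by linarith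
    thus ?thesis using a by (simp add: dist_commute)
  qed
  have met: "metric_on G \<delta>"
    unfolding metric_on_def
  proof (intro conjI ballI)
    fix p q assume pq: "p \<in> G" "q \<in> G"
    show "0 \<le> \<delta> p q" "\<delta> p q = \<delta> q p"
      using pq m_nn by (auto simp: G_def \<delta>_def dist_commute)
    have "m b x \<noteq> 0" if "x \<in> E - A" for b x using m_pos[OF that, of b] by simp
    thus "\<delta> p q = 0 \<longleftrightarrow> p = q" using pq by (auto simp: G_def \<delta>_def)
  next
    fix p q r assume pqr: "p \<in> G" "q \<in> G" "r \<in> G"
    have t1': "m b x \<le> m b' x + dist b' b" for b b' x using t1[of b x b'] by (simp add: dist_commute)
    have t2': "m b x \<le> dist x x' + m b x'" for b x x' using t2[of b x x'] by (simp add: dist_commute)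
    show "\<delta> p r \<le> \<delta> p q + \<delta> q r"
      using pqr by (auto simp: G_def \<delta>_def intro: t1 t1' t2 t2' t3 t4 dist_triangle)
  qed
  have finG: "finite G" using B E by (simp add: G_def)
  have GS: "distances G \<delta> \<subseteq> S"
  proof
    fix s assume "s \<in> distances G \<delta>"
    then obtain p q where "p \<in> G" "q \<in> G" "s = \<delta> p q" by (auto simp: distances_def)
    thus "s \<in> S" using mS B E dist_S by (auto simp: G_def \<delta>_def subset_iff)
  qed
  have GB: "Inl ` B \<subseteq> G" "projl ` Inl ` B \<subseteq> D" using B by (auto simp: G_def)
  obtain \<phi> :: "'u + 'u \<Rightarrow> 'u" where \<phi>: "\<And>p. p \<in> Inl ` B \<Longrightarrow> \<phi> p = projl p" "\<phi> ` G \<subseteq> D"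
    "\<And>p q. p \<in> G \<Longrightarrow> q \<in> G \<Longrightarrow> dist (\<phi> p) (\<phi> q) = \<delta> p q"
  proof (rule extend_isometric_embedding[OF injective finG met GS GB])
    show "dist (projl x) (projl y) = \<delta> x y" if "x \<in> Inl ` B" "y \<in> Inl ` B" for x y
      using that by (auto simp: \<delta>_def)
  qed blast
  have \<phi>B: "\<phi> (Inl b) = b" if "b \<in> B" for b using \<phi>(1)[of "Inl b"] that by simp
  have \<phi>m: "dist b (\<phi> (Inr x)) = m b x" if "b \<in> B" "x \<in> E - A" for b x
    using \<phi>(3)[of "Inl b" "Inr x"] \<phi>B that by (simp add: G_def \<delta>_def)
  have \<phi>E: "dist (\<phi> (Inr x)) (\<phi> (Inr y)) = dist x y" if "x \<in> E - A" "y \<in> E - A" for x y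
    using \<phi>(3)[of "Inr x" "Inr y"] that by (simp add: G_def \<delta>_def)
  have mA: "m a x = dist a x" if "a \<in> A" "x \<in> E" for a x
  proof (rule antisym)
    show "m a x \<le> dist a x" using m_le(2)[OF that(1), of a x] by simp
    show "dist a x \<le> m a x"
      using m_cases[of a x] M[of a x] that A dist_triangle[of a x] by (auto simp: less_imp_le)
  qed
  define k where "k x = (if x \<in> A then x else \<phi> (Inr x))" for x
  show thesis
  proof (rule that)
    show "k ` E \<subseteq> D" using \<phi>(2) A E by (auto simp: k_def G_def)
    show "k a = a" if "a \<in> A" for a using that by (simp add: k_def)
    show "isometric_on E k"
      unfolding isometric_on_def
    proof (intro ballI)
      fix x y assume xy: "x \<in> E" "y \<in> E"
      have c1: "dist a (\<phi> (Inr v)) = dist a v" if "a \<in> A" "v \<in> E - A" for a v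
        using \<phi>m[of a v] mA[of a v] that A by auto
      show "dist (k x) (k y) = dist x y"
        using xy c1[of x y] c1[of y x] \<phi>E[of x y] by (auto simp: k_def dist_commute)
    qed
    show "k x \<notin> B \<and> dist b (k x) = Min (insert M ((\<lambda>a. dist b a + dist a x) ` A))"
      if "b \<in> B" "x \<in> E - A" for b x
    proof
      have kx: "k x = \<phi> (Inr x)" using that by (simp add: k_def)
      show "dist b (k x) = Min (insert M ((\<lambda>a. dist b a + dist a x) ` A))"
        using \<phi>m[OF that] kx by (simp add: m_def)
      show "k x \<notin> B"
      proof
        assume "k x \<in> B"
        hence "dist (k x) (k x) = m (k x) x" using \<phi>m that(2) kx by metis
        thus False using m_pos[OF that(2), of "k x"] by simp
      qed
    qed
  qed
qed

text \<open>
  First make \<open>g\<close>, without changing it on \<open>C \<union> A\<close>, an isometry \<open>h0\<close> with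
  a finite set \<open>B\<close> invariant under the enlarged system. Amalgamating \<open>B\<close> and \<open>E\<close>
  over \<open>A\<close> yields a finite set \<open>F\<close> with an action extending both. Tameness of \<open>z\<close>
  embeds \<open>F\<close> over \<open>B\<close> into \<open>D\<close>, equivariantly for the first \<open>n\<close>
  isometries; the last one is transported and extended to all of \<open>D\<close>.
\<close>

lemma realization_dense:
  assumes z: "tame n z" and g: "g \<in> P" and C: "finite C" "C \<subseteq> D"
    and E: "finite E" "E \<subseteq> D" "A \<subseteq> E" and data: "extension_data (Suc n) (z(n := g)) A E e"
  shows "\<exists>h\<in>P. (\<forall>c\<in>C. h c = g c) \<and> (\<exists>j. realizes (Suc n) (z(n := h)) A E e j)"
proof -
  have finA: "finite A" "A \<subseteq> D" using E finite_subset by auto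
  have "finite (C \<union> A)" "C \<union> A \<subseteq> D" using C finA by auto
  then obtain h0 B where h0: "h0 \<in> P" "\<And>c. c \<in> C \<union> A \<Longrightarrow> h0 c = g c"
    and B: "finite B" "C \<union> A \<subseteq> B" "B \<subseteq> D" "invariant (Suc n) (z(n := h0)) B"
    using finite_invariant_dense[OF z g] by metis
  define y where "y = z(n := h0)"
  have yP: "y i \<in> P" if "i < Suc n" for i using that h0(1) tame_P[OF z] by (auto simp: y_def less_Suc_eq)
  have yz: "y i = z i" if "i < n" for i using that by (simp add: y_def)
  have yB: "y i ` B = B" if "i < Suc n" for i using B(4) that by (simp add: y_def invariant_def)
  have ye: "y i a = e i a" if "i < Suc n" "a \<in> A" for i a
    using data h0(2)[of a] that by (cases "i = n") (auto simp: y_def extension_data_def)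
  have yA: "y i ` A = A" if i: "i < Suc n" for i
  proof -
    have "(z(n := g)) i ` A = A" using data i by (simp add: extension_data_def invariant_def)
    moreover have "(z(n := g)) i a = y i a" if "a \<in> A" for a
      using h0(2)[of a] that by (simp add: y_def)
    ultimately show ?thesis by (metis image_cong)
  qed
  have eE: "e i ` E = E" "isometric_on E (e i)" if "i < Suc n" for i
    using data that by (simp_all add: extension_data_def)
  obtain k M where k: "k ` E \<subseteq> D" "isometric_on E k" "\<And>a. a \<in> A \<Longrightarrow> k a = a"
    and kB: "\<And>b x. b \<in> B \<Longrightarrow> x \<in> E - A \<Longrightarrow>
        k x \<notin> B \<and> dist b (k x) = Min (insert M ((\<lambda>a. dist b a + dist a x) ` A))"
    using amalgam_in_D[OF B(1,3) E(1,2), of A] B(2) E(3) by blast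
  have kinj: "inj_on k E" by (rule isometric_on_inj[OF k(2)])
  have eA: "e i x \<in> E - A" if i: "i < Suc n" and x: "x \<in> E - A" for i x
  proof -
    have "e i ` A = A" using ye[OF i] yA[OF i] by (metis image_cong)
    moreover have "inj_on (e i) E" by (rule isometric_on_inj[OF eE(2)[OF i]])
    ultimately have "e i x \<notin> A" using x E(3) by (metis DiffD1 DiffD2 inj_on_image_mem_iff)
    thus ?thesis using eE(1)[OF i] x by blast
  qed
  define f where "f i x = (if x \<in> B then y i x else k (e i (inv_into E k x)))" for i x
  have fB: "f i b = y i b" if "b \<in> B" for i b using that by (simp add: f_def)
  have fk: "f i (k x) = k (e i x)" if "i < Suc n" "x \<in> E" for i x
  proof (cases "x \<in> A")
    case True
    hence "k x = x" "x \<in> B" using k(3) B(2) by auto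
    moreover have "e i x \<in> A" using ye[OF that(1) True] yA[OF that(1)] True by force
    ultimately show ?thesis using ye[OF that(1) True] k(3) fB by simp
  next
    case False
    hence "k x \<notin> B" using kB[of "k x" x] that False by blast
    thus ?thesis using that(2) kinj by (simp add: f_def)
  qed
  define F where "F = B \<union> k ` E"
  have finF: "finite F" "F \<subseteq> D" using B E k by (auto simp: F_def)
  have fF: "f i ` F = F" if i: "i < Suc n" for i
  proof -
    have "f i ` B = B" using fB yB[OF i] by (metis image_cong)
    moreover have "f i ` (k ` E) = k ` (e i ` E)" using fk[OF i] by (auto simp: image_image)
    ultimately show ?thesis using eE(1)[OF i] by (simp add: F_def image_Un)
  qed
  \<comment> \<open>the minimum defining a mixed distance is only permuted, since the actions agree on A and preserve it\<close>
  have cross: "dist (y i b) (k (e i x)) = dist b (k x)" if i: "i < Suc n" and b: "b \<in> B" and x: "x \<in> E - A" for i b x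
  proof -
    have "y i b \<in> B" using yB[OF i] b by blast
    hence "dist (y i b) (k (e i x)) = Min (insert M ((\<lambda>a. dist (y i b) a + dist a (e i x)) ` A))"
      using kB eA[OF i x] by blast
    also have "(\<lambda>a. dist (y i b) a + dist a (e i x)) ` A = (\<lambda>a. dist (y i b) (y i a) + dist (y i a) (e i x)) ` A"
      using yA[OF i] by (metis (no_types, lifting) image_cong image_image)
    also have "\<dots> = (\<lambda>a. dist b a + dist a x) ` A"
    proof (rule image_cong[OF refl])
      fix a assume a: "a \<in> A"
      have "dist (y i a) (e i x) = dist (e i a) (e i x)" using ye[OF i a] by simp
      also have "\<dots> = dist a x" using eE(2)[OF i] a x E(3) by (auto simp: isometric_on_def)
      finally show "dist (y i b) (y i a) + dist (y i a) (e i x) = dist b a + dist a x"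
        using P_dist[OF yP[OF i]] by simp
    qed
    finally show ?thesis using kB[OF b x] by simp
  qed
  have fiso: "isometric_on F (f i)" if i: "i < Suc n" for i
    unfolding isometric_on_def
  proof (intro ballI)
    fix p q assume p: "p \<in> F" and q: "q \<in> F"
    have kEA: "\<exists>x\<in>E - A. p = k x" if "p \<in> F" "p \<notin> B" for p
    proof -
      obtain x where x: "x \<in> E" "p = k x" using \<open>p \<in> F\<close> \<open>p \<notin> B\<close> by (auto simp: F_def)
      have "x \<notin> A" using x(2) k(3)[of x] B(2) \<open>p \<notin> B\<close> by auto
      thus ?thesis using x by blast
    qed
    show "dist (f i p) (f i q) = dist p q"
    proof (cases "p \<in> B"; cases "q \<in> B")
      assume "p \<in> B" "q \<in> B"
      thus ?thesis using fB P_dist[OF yP[OF i]] by simp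
    next
      assume pB: "p \<in> B" and "q \<notin> B"
      then obtain x where "x \<in> E - A" "q = k x" using kEA q by blast
      thus ?thesis using fB pB fk[OF i, of x] cross[OF i, of p x] by simp
    next
      assume "p \<notin> B" and qB: "q \<in> B"
      then obtain x where "x \<in> E - A" "p = k x" using kEA p by blast
      thus ?thesis using fB qB fk[OF i, of x] cross[OF i, of q x] by (simp add: dist_commute)
    next
      assume "p \<notin> B" "q \<notin> B"
      then obtain x x' where x: "x \<in> E - A" "p = k x" "x' \<in> E - A" "q = k x'" using kEA p q by metis
      have "e i x \<in> E" "e i x' \<in> E" using eE(1)[OF i] x by blast+
      thus ?thesis using x fk[OF i] k(2) eE(2)[OF i] by (simp add: isometric_on_def)
    qed
  qed
  have "z i ` B = B" if "i < n" for i using yB[of i] yz[OF that] that by simp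
  hence "invariant n z B" by (simp add: invariant_def)
  moreover have "\<forall>i<n. f i ` F = F \<and> isometric_on F (f i) \<and> (\<forall>a\<in>B. f i a = z i a)"
    using fF fiso fB yz by auto
  ultimately obtain j where j: "j ` F \<subseteq> D" "isometric_on F j" "\<And>a. a \<in> B \<Longrightarrow> j a = a"
    "\<And>i x. i < n \<Longrightarrow> x \<in> F \<Longrightarrow> j (f i x) = z i (j x)"
    using tame_embedding[OF z finF(1) _ finF(2), of B f] F_def by (metis sup_ge1)
  obtain q where q: "q ` (j ` F) = j ` F" "isometric_on (j ` F) q" "\<And>x. x \<in> F \<Longrightarrow> q (j x) = j (f n x)"
  proof (rule transport_isometry[of F j dist "f n"])
    show "dist (j x) (j y) = dist x y" "dist (f n x) (f n y) = dist x y" if "x \<in> F" "y \<in> F" for x y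
      using j(2) fiso[of n] that by (auto simp: isometric_on_def)
    show "inj_on j F" by (rule isometric_on_inj[OF j(2)])
    show "f n ` F = F" by (rule fF) simp
  qed blast
  obtain h where h: "h \<in> P" "\<forall>b\<in>j ` F. h b = q b"
    using extends_finite_to_P[OF finite_imageI[OF finF(1)] j(1) _ q(2)] q(1) j(1) by auto
  have hj: "h (j x) = j (f n x)" if "x \<in> F" for x using h(2) q(3) that by simp
  have hB: "h b = h0 b" if "b \<in> B" for b
  proof -
    have "h0 b \<in> B" using yB[of n] that by (auto simp: y_def)
    thus ?thesis using hj[of b] j(3) fB that by (simp add: F_def y_def)
  qed
  show ?thesis
  proof (intro bexI[OF _ h(1)] conjI exI)
    show "\<forall>c\<in>C. h c = g c" using hB h0(2) B(2) by auto
    show "realizes (Suc n) (z(n := h)) A E e (j \<circ> k)"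
      unfolding realizes_def
    proof (intro conjI allI impI ballI)
      show "(j \<circ> k) ` E \<subseteq> D" using j(1) by (auto simp: F_def)
      show "isometric_on E (j \<circ> k)" using j(2) k(2) by (auto simp: F_def isometric_on_def)
      show "(j \<circ> k) a = a" if "a \<in> A" for a using that k(3) j(3) B(2) by auto
      fix i x assume ix: "i < Suc n" "x \<in> E"
      have "(j \<circ> k) (e i x) = j (f i (k x))" using fk[OF ix] by simp
      also have "\<dots> = (z(n := h)) i (j (k x))"
        using j(4)[of i "k x"] hj[of "k x"] ix by (auto simp: F_def less_Suc_eq)
      finally show "(j \<circ> k) (e i x) = (z(n := h)) i ((j \<circ> k) x)" by simp
    qed
  qed
qed

text \<open>
  The requirements, countably many up to equality of the data, whose conjunction is tameness of the enlarged system.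
\<close>

definition invariant_req :: "nat \<Rightarrow> (nat \<Rightarrow> 'u \<Rightarrow> 'u) \<Rightarrow> 'u set \<Rightarrow> ('u \<Rightarrow> 'u) set" where
  "invariant_req n z A = {y. \<exists>B. finite B \<and> A \<subseteq> B \<and> B \<subseteq> D \<and> invariant (Suc n) (z(n := y)) B}"

definition realization_req ::
    "nat \<Rightarrow> (nat \<Rightarrow> 'u \<Rightarrow> 'u) \<Rightarrow> 'u set \<times> 'u set \<times> (nat \<Rightarrow> 'u \<Rightarrow> 'u) \<Rightarrow> ('u \<Rightarrow> 'u) set" where
  "realization_req n z = (\<lambda>(A, E, e). {y. extension_data (Suc n) (z(n := y)) A E e \<longrightarrow>
      (\<exists>j. realizes (Suc n) (z(n := y)) A E e j)})"

lemma dense_open_invariant_req: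
  assumes z: "tame n z" and A: "finite A" "A \<subseteq> D"
  shows "dense_open (invariant_req n z A)"
  unfolding dense_open_def
proof (intro conjI ballI allI impI)
  fix g assume "g \<in> invariant_req n z A"
  then obtain B where B: "finite B" "A \<subseteq> B" "B \<subseteq> D" "invariant (Suc n) (z(n := g)) B"
    by (auto simp: invariant_req_def)
  have "h \<in> invariant_req n z A" if "\<forall>c\<in>B. h c = g c" for h
  proof -
    have "(z(n := h)) i ` B = (z(n := g)) i ` B" for i
      using that by (intro image_cong) auto
    hence "invariant (Suc n) (z(n := h)) B" using B(4) by (simp add: invariant_def)
    thus ?thesis using B by (auto simp: invariant_req_def)
  qed
  thus "\<exists>C. finite C \<and> C \<subseteq> D \<and> (\<forall>h\<in>P. (\<forall>c\<in>C. h c = g c) \<longrightarrow> h \<in> invariant_req n z A)"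
    using B by blast
next
  fix g C assume g: "g \<in> P" and C: "finite C \<and> C \<subseteq> D"
  have "finite (C \<union> A)" "C \<union> A \<subseteq> D" using A C by auto
  then obtain h B where "h \<in> P" "\<And>c. c \<in> C \<union> A \<Longrightarrow> h c = g c"
    "finite B" "C \<union> A \<subseteq> B" "B \<subseteq> D" "invariant (Suc n) (z(n := h)) B"
    using finite_invariant_dense[OF z g] by metis
  thus "\<exists>h\<in>invariant_req n z A \<inter> P. \<forall>c\<in>C. h c = g c"
    by (intro bexI[of _ h]) (auto simp: invariant_req_def)
qed

lemma extension_data_cong:
  assumes "\<forall>a\<in>A. h a = g a"
  shows "extension_data (Suc n) (z(n := h)) A E e \<longleftrightarrow> extension_data (Suc n) (z(n := g)) A E e"
proof -
  have "(z(n := h)) i a = (z(n := g)) i a" if "a \<in> A" for i a using assms that by simp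
  moreover from this have "(z(n := h)) i ` A = (z(n := g)) i ` A" for i by (intro image_cong) auto
  ultimately show ?thesis unfolding extension_data_def invariant_def by simp
qed

text \<open>
  A realization depends on finitely many values of the last isometry, and whether the data are an extension of the
  action depends on its values on \<open>A\<close>.
\<close>

lemma dense_open_realization_req:
  assumes z: "tame n z" and E: "finite E" "E \<subseteq> D" "A \<subseteq> E"
  shows "dense_open (realization_req n z (A, E, e))"
  unfolding dense_open_def
proof (intro conjI ballI allI impI)
  have A: "finite A" "A \<subseteq> D" using E finite_subset by auto
  fix g assume g: "g \<in> realization_req n z (A, E, e)"
  show "\<exists>C. finite C \<and> C \<subseteq> D \<and> (\<forall>h\<in>P. (\<forall>c\<in>C. h c = g c) \<longrightarrow> h \<in> realization_req n z (A, E, e))"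
  proof (cases "extension_data (Suc n) (z(n := g)) A E e")
    case False
    hence "h \<in> realization_req n z (A, E, e)" if "\<forall>c\<in>A. h c = g c" for h
      using extension_data_cong[OF that] by (simp add: realization_req_def)
    thus ?thesis using A by blast
  next
    case True
    then obtain j where j: "realizes (Suc n) (z(n := g)) A E e j" using g by (auto simp: realization_req_def)
    have "h \<in> realization_req n z (A, E, e)" if h: "\<forall>c\<in>j ` E. h c = g c" for h
    proof -
      have "realizes (Suc n) (z(n := h)) A E e j" using j h by (auto simp: realizes_def)
      thus ?thesis by (auto simp: realization_req_def)
    qed
    thus ?thesis using E j by (intro exI[of _ "j ` E"]) (auto simp: realizes_def)
  qed
next
  have A: "finite A" "A \<subseteq> D" using E finite_subset by auto
  fix g C assume g: "g \<in> P" and C: "finite C \<and> C \<subseteq> D"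
  show "\<exists>h\<in>realization_req n z (A, E, e) \<inter> P. \<forall>c\<in>C. h c = g c"
  proof (cases "extension_data (Suc n) (z(n := g)) A E e")
    case False
    thus ?thesis using g by (intro bexI[of _ g]) (auto simp: realization_req_def)
  next
    case True
    obtain h where "h \<in> P" "\<forall>c\<in>C. h c = g c" "\<exists>j. realizes (Suc n) (z(n := h)) A E e j"
      using realization_dense[OF z g _ _ E True] C by blast
    thus ?thesis by (intro bexI[of _ h]) (auto simp: realization_req_def)
  qed
qed

text \<open>
  Both kinds of requirements are open because they concern finitely many values; their density is
  \<open>finite_invariant_dense\<close> and \<open>realization_dense\<close>.
\<close>

lemma comeager_tame:
  assumes z: "tame n z"
  shows "comeager {y. tame (Suc n) (z(n := y))}"
proof -
  define \<A> where "\<A> = {A. finite A \<and> A \<subseteq> D}"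
  define \<E> where "\<E> = (SIGMA A:\<A>. SIGMA E:\<A>. PiE {..n} (\<lambda>_. E \<rightarrow>\<^sub>E E))"
  define \<X> where "\<X> = invariant_req n z ` \<A> \<union> realization_req n z ` {(A, E, e) \<in> \<E>. A \<subseteq> E}"
  have c\<A>: "countable \<A>" unfolding \<A>_def by (rule countable_Collect_finite_subset[OF countable_D])
  have "finite (PiE {..n} (\<lambda>_. E \<rightarrow>\<^sub>E E))" if "E \<in> \<A>" for E
    using that by (intro finite_PiE) (auto simp: \<A>_def intro!: finite_PiE)
  hence "countable \<E>" unfolding \<E>_def using c\<A> by (intro countable_SIGMA) (auto intro: countable_finite)
  hence "countable \<X>" unfolding \<X>_def using c\<A>
    by (intro countable_Un countable_image) (auto intro: countable_subset[rotated])
  moreover have "\<forall>X\<in>\<X>. dense_open X"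
    using dense_open_invariant_req[OF z] dense_open_realization_req[OF z]
    by (auto simp: \<X>_def \<A>_def \<E>_def)
  moreover have "P \<inter> \<Inter>\<X> \<subseteq> {y. tame (Suc n) (z(n := y))}"
  proof
    fix y assume y: "y \<in> P \<inter> \<Inter>\<X>"
    have inv: "\<exists>B. finite B \<and> A \<subseteq> B \<and> B \<subseteq> D \<and> invariant (Suc n) (z(n := y)) B"
      if "finite A \<and> A \<subseteq> D" for A
    proof -
      have "invariant_req n z A \<in> \<X>" using that by (simp add: \<X>_def \<A>_def)
      hence "y \<in> invariant_req n z A" using y by blast
      thus ?thesis by (simp add: invariant_req_def)
    qed
    have real: "\<exists>j. realizes (Suc n) (z(n := y)) A E e j"
      if E: "finite E \<and> A \<subseteq> E \<and> E \<subseteq> D \<and> extension_data (Suc n) (z(n := y)) A E e" for A E e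
    proof -
      \<comment> \<open>restricting the data to the relevant arguments leaves countably many requirements\<close>
      define e' where "e' = (\<lambda>i\<in>{..n}. \<lambda>x\<in>E. e i x)"
      have e': "e' i x = e i x" if "i < Suc n" "x \<in> E" for i x using that by (simp add: e'_def)
      have eE: "e i x \<in> E" if "i < Suc n" "x \<in> E" for i x
      proof -
        have "e i ` E = E" using E that(1) by (simp add: extension_data_def)
        thus ?thesis using that(2) by blast
      qed
      have data: "extension_data (Suc n) (z(n := y)) A E e'"
        unfolding extension_data_def
      proof (intro conjI allI impI)
        show "invariant (Suc n) (z(n := y)) A" using E by (simp add: extension_data_def)
        fix i assume i: "i < Suc n"
        have "e' i ` E = e i ` E" using e'[OF i] by (intro image_cong) auto
        thus "e' i ` E = E" using E i by (simp add: extension_data_def)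
        show "isometric_on E (e' i)" using E i e'[OF i] by (simp add: extension_data_def isometric_on_def)
        show "\<forall>a\<in>A. e' i a = (z(n := y)) i a" using E i e'[OF i] by (auto simp: extension_data_def)
      qed
      have "A \<in> \<A>" "E \<in> \<A>" using E finite_subset by (auto simp: \<A>_def)
      moreover have "e' \<in> PiE {..n} (\<lambda>_. E \<rightarrow>\<^sub>E E)" using eE by (auto simp: e'_def)
      ultimately have "realization_req n z (A, E, e') \<in> \<X>" using E by (auto simp: \<X>_def \<E>_def)
      hence "y \<in> realization_req n z (A, E, e')" using y by blast
      then obtain j where "realizes (Suc n) (z(n := y)) A E e' j" using data by (auto simp: realization_req_def)
      hence "realizes (Suc n) (z(n := y)) A E e j" using e' by (simp add: realizes_def)
      thus ?thesis by blast
    qed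
    have yP: "(z(n := y)) i \<in> P" if "i < Suc n" for i
      using that y tame_P[OF z] by (auto simp: less_Suc_eq)
    show "y \<in> {y. tame (Suc n) (z(n := y))}"
      unfolding mem_Collect_eq tame_iff by (intro conjI allI impI yP inv real) simp_all
  qed
  ultimately show ?thesis unfolding comeager_def by blast
qed

section \<open>Perfect families of generic quotients\<close>

text \<open>
  An enumeration of \<open>D\<close>; it may have repetitions, as only its being exhaustive counts.
\<close>

definition D_seq :: "nat \<Rightarrow> 'u" where
  "D_seq = from_nat_into D"

lemma D_seq_in: "D_seq n \<in> D"
  using D_nonempty by (simp add: D_seq_def from_nat_into)

lemma D_seq_surj: "d \<in> D \<Longrightarrow> \<exists>n. d = D_seq n"
  using from_nat_into_surj[OF countable_D] by (metis D_seq_def)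

definition agree :: "'u set \<Rightarrow> ('u \<Rightarrow> 'u) \<Rightarrow> ('u \<Rightarrow> 'u) \<Rightarrow> bool" where
  "agree C g h \<longleftrightarrow> (\<forall>c\<in>C. g c = h c)"

text \<open>
  The finite information that \<open>g0\<close> and \<open>h0\<close> give on \<open>C\<close> forces the quotient into
  \<open>X\<close>.
\<close>

definition separates :: "'u set \<Rightarrow> ('u \<Rightarrow> 'u) set \<Rightarrow> ('u \<Rightarrow> 'u) \<Rightarrow> ('u \<Rightarrow> 'u) \<Rightarrow> bool" where
  "separates C X g0 h0 \<longleftrightarrow>
     (\<forall>g\<in>P. \<forall>h\<in>P. agree C g g0 \<longrightarrow> agree C h h0 \<longrightarrow> isoinv g \<circ> h \<in> X)"

lemma separates_mono:
  assumes "separates C X g0 h0" "C \<subseteq> C'" "agree C g1 g0" "agree C h1 h0"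
  shows "separates C' X g1 h1"
proof -
  have "agree C g g0" "agree C h h0" if "agree C' g g1" "agree C' h h1" for g h
    using assms(2-4) that by (auto simp: agree_def subset_iff)
  thus ?thesis using assms(1) unfolding separates_def by blast
qed

lemma separate_pair:
  assumes X: "dense_open X" and gh: "g0 \<in> P" "h0 \<in> P" and C: "finite C" "C \<subseteq> D"
  obtains h1 C' where "h1 \<in> P" "agree C h1 h0" "finite C'" "C \<subseteq> C'" "C' \<subseteq> D" "separates C' X g0 h1"
proof -
  have "isoinv g0 \<circ> h0 \<in> P" using gh P_comp P_isoinv by blast
  then obtain w where w: "w \<in> X" "w \<in> P" "\<forall>c\<in>C. w c = (isoinv g0 \<circ> h0) c"
    using X C unfolding dense_open_def by (metis IntE)
  obtain K where K: "finite K" "K \<subseteq> D" "\<forall>h\<in>P. (\<forall>c\<in>K. h c = w c) \<longrightarrow> h \<in> X"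
    using X w(1) unfolding dense_open_def by blast
  define C' where "C' = C \<union> K \<union> w ` K"
  have "isoinv g \<circ> h \<in> X" if gh': "g \<in> P" "h \<in> P" "agree C' g g0" "agree C' h (g0 \<circ> w)" for g h
  proof -
    have "(isoinv g \<circ> h) c = w c" if c: "c \<in> K" for c
    proof -
      have "h c = g0 (w c)" using gh'(4) c by (simp add: agree_def C'_def)
      moreover have "g (w c) = g0 (w c)" using gh'(3) c by (simp add: agree_def C'_def)
      ultimately show ?thesis using P_isoinv_cancel(1)[OF gh'(1), of "w c"] by simp
    qed
    thus ?thesis using K(3) P_comp[OF P_isoinv[OF gh'(1)] gh'(2)] by blast
  qed
  hence "separates C' X g0 (g0 \<circ> w)" by (simp add: separates_def)
  moreover have "agree C (g0 \<circ> w) h0"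
    using w(3) P_isoinv_cancel(2)[OF gh(1)] by (simp add: agree_def)
  moreover have "finite C'" "C \<subseteq> C'" "C' \<subseteq> D" using C K P_mem[OF w(2)] by (auto simp: C'_def)
  ultimately show thesis using that[of "g0 \<circ> w" C'] P_comp[OF gh(1) w(2)] by blast
qed

lemma separate_pairs:
  fixes \<gamma> :: "'i \<Rightarrow> 'u \<Rightarrow> 'u"
  assumes "finite Q" and ne: "\<And>u v X. (u, v, X) \<in> Q \<Longrightarrow> u \<noteq> v \<and> dense_open X"
    and \<gamma>: "\<And>u. \<gamma> u \<in> P" and C: "finite C" "C \<subseteq> D"
  shows "\<exists>\<gamma>' C'. (\<forall>u. \<gamma>' u \<in> P \<and> agree C (\<gamma>' u) (\<gamma> u)) \<and> finite C' \<and> C \<subseteq> C' \<and> C' \<subseteq> D \<and>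
     (\<forall>u v X. (u, v, X) \<in> Q \<longrightarrow> separates C' X (\<gamma>' u) (\<gamma>' v))"
  using assms(1) ne
proof (induction Q)
  case empty
  show ?case using \<gamma> C by (intro exI[of _ \<gamma>] exI[of _ C]) (auto simp: agree_def)
next
  case (insert q Q)
  obtain u v X where q: "q = (u, v, X)" by (metis surj_pair)
  have uv: "u \<noteq> v" and X: "dense_open X" using insert.prems q by auto
  have "\<exists>\<gamma>' C'. (\<forall>u. \<gamma>' u \<in> P \<and> agree C (\<gamma>' u) (\<gamma> u)) \<and> finite C' \<and> C \<subseteq> C' \<and> C' \<subseteq> D \<and>
     (\<forall>u v X. (u, v, X) \<in> Q \<longrightarrow> separates C' X (\<gamma>' u) (\<gamma>' v))"
    by (rule insert.IH) (use insert.prems in blast)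
  then obtain \<gamma>1 C1 where 1: "\<forall>u. \<gamma>1 u \<in> P \<and> agree C (\<gamma>1 u) (\<gamma> u)" "finite C1" "C \<subseteq> C1" "C1 \<subseteq> D"
    "\<forall>u v X. (u, v, X) \<in> Q \<longrightarrow> separates C1 X (\<gamma>1 u) (\<gamma>1 v)" by (elim exE conjE) (rule that)
  obtain h1 C2 where 2: "h1 \<in> P" "agree C1 h1 (\<gamma>1 v)" "finite C2" "C1 \<subseteq> C2" "C2 \<subseteq> D" "separates C2 X (\<gamma>1 u) h1"
    using separate_pair[OF X, of "\<gamma>1 u" "\<gamma>1 v" C1] 1 by metis
  define \<gamma>2 where "\<gamma>2 = \<gamma>1(v := h1)"
  have a2: "agree C1 (\<gamma>2 x) (\<gamma>1 x)" for x using 2(2) by (simp add: \<gamma>2_def agree_def)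
  show ?case
  proof (intro exI[of _ \<gamma>2] exI[of _ C2] conjI allI impI)
    show "\<gamma>2 x \<in> P" for x using 1(1) 2(1) by (simp add: \<gamma>2_def)
    show "agree C (\<gamma>2 x) (\<gamma> x)" for x
      using 1(1,3) a2[of x] by (auto simp: agree_def subset_iff)
    show "finite C2" "C \<subseteq> C2" "C2 \<subseteq> D" using 1 2 by auto
    fix a b Y assume "(a, b, Y) \<in> insert q Q"
    thus "separates C2 Y (\<gamma>2 a) (\<gamma>2 b)"
    proof
      assume "(a, b, Y) = q"
      thus ?thesis using q 2(6) uv by (simp add: \<gamma>2_def)
    next
      assume "(a, b, Y) \<in> Q"
      thus ?thesis using separates_mono[OF _ 2(4) a2 a2] 1(5) by blast
    qed
  qed
qed

definition branch :: "(nat \<Rightarrow> bool) \<Rightarrow> nat \<Rightarrow> bool list" where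
  "branch \<alpha> n = map \<alpha> [0..<n]"

lemma branch_Suc: "branch \<alpha> (Suc n) = branch \<alpha> n @ [\<alpha> n]"
  and length_branch: "length (branch \<alpha> n) = n"
  by (simp_all add: branch_def)

lemma branch_eq_imp: "branch \<alpha> n = branch \<beta> n \<Longrightarrow> i < n \<Longrightarrow> \<alpha> i = \<beta> i"
  by (simp add: branch_def)

text \<open>
  Mycielski's construction: approximations \<open>\<gamma> n u\<close> for the nodes \<open>u\<close> of level
  \<open>n\<close> of the binary tree are refined so that at level \<open>Suc n\<close> the quotients of distinct nodes
  are forced into the first \<open>n + 1\<close> dense open sets. Two distinct branches differ on all sufficiently
  high levels.
\<close>

lemma perfect_family:
  assumes R: "comeager R" and A: "finite A" "A \<subseteq> D"
  shows "\<exists>f :: (nat \<Rightarrow> bool) \<Rightarrow> 'u \<Rightarrow> 'u. (\<forall>\<alpha>. f \<alpha> \<in> P \<and> (\<forall>a\<in>A. f \<alpha> a = a)) \<and>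
     (\<forall>\<alpha> \<beta>. \<alpha> \<noteq> \<beta> \<longrightarrow> isoinv (f \<alpha>) \<circ> f \<beta> \<in> R)"
proof -
  obtain \<X> where \<X>: "countable \<X>" "\<forall>X\<in>\<X>. dense_open X" "P \<inter> \<Inter>\<X> \<subseteq> R"
    using R unfolding comeager_def by metis
  have "dense_open P" using P_id by (auto simp: dense_open_def)
  then obtain O' :: "nat \<Rightarrow> ('u \<Rightarrow> 'u) set" where O': "\<And>k. dense_open (O' k)" "\<X> \<subseteq> range O'"
  proof (cases "\<X> = {}")
    case False
    thus thesis using \<X> that[of "from_nat_into \<X>"] range_from_nat_into[of \<X>] from_nat_into[of \<X>] by auto
  qed (use that[of "\<lambda>_. P"] in auto)
  \<comment> \<open>a state consists of approximations for all nodes and the finite set C on which they are fixed;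
      the last two conditions of Next make all limits along branches total and surjective on D\<close>
  define Good where "Good n = (\<lambda>(\<gamma> :: bool list \<Rightarrow> 'u \<Rightarrow> 'u, C). (\<forall>u. \<gamma> u \<in> P) \<and> finite C \<and> A \<subseteq> C \<and> C \<subseteq> D \<and>
      (n = 0 \<longrightarrow> \<gamma> = (\<lambda>_. id)))" for n :: nat
  define Next where "Next n = (\<lambda>(\<gamma> :: bool list \<Rightarrow> 'u \<Rightarrow> 'u, C) (\<gamma>', C'). C \<subseteq> C' \<and>
      (\<forall>u. length u = Suc n \<longrightarrow> agree C (\<gamma>' u) (\<gamma> (butlast u))) \<and>
      (\<forall>u v k. length u = Suc n \<longrightarrow> length v = Suc n \<longrightarrow> u \<noteq> v \<longrightarrow> k \<le> n \<longrightarrow> separates C' (O' k) (\<gamma>' u) (\<gamma>' v)) \<and>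
      D_seq n \<in> C' \<and> (\<forall>u. length u = Suc n \<longrightarrow> isoinv (\<gamma>' u) (D_seq n) \<in> C'))" for n :: nat
  have step: "\<exists>y. Good (Suc n) y \<and> Next n x y" if x: "Good n x" for n x
  proof -
    obtain \<gamma> C where xe: "x = (\<gamma>, C)" by (metis surj_pair)
    have g: "\<And>u. \<gamma> u \<in> P" "finite C" "A \<subseteq> C" "C \<subseteq> D" using x xe by (auto simp: Good_def)
    define L where "L = {u :: bool list. length u = Suc n}"
    have finL: "finite L"
      using finite_lists_length_eq[of "UNIV :: bool set" "Suc n"] by (simp add: L_def)
    define Q where "Q = {q \<in> L \<times> L \<times> O' ` {..n}. fst q \<noteq> fst (snd q)}"
    have finQ: "finite Q" unfolding Q_def using finL by simp
    have "\<exists>\<gamma>' C'. (\<forall>u. \<gamma>' u \<in> P \<and> agree C (\<gamma>' u) (\<gamma> (butlast u))) \<and> finite C' \<and> C \<subseteq> C' \<and> C' \<subseteq> D \<and>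
       (\<forall>u v X. (u, v, X) \<in> Q \<longrightarrow> separates C' X (\<gamma>' u) (\<gamma>' v))"
      by (rule separate_pairs[OF finQ]) (use g O'(1) in \<open>auto simp: Q_def\<close>)
    then obtain \<gamma>' C1 where 1: "\<forall>u. \<gamma>' u \<in> P \<and> agree C (\<gamma>' u) (\<gamma> (butlast u))" "finite C1" "C \<subseteq> C1" "C1 \<subseteq> D"
      "\<forall>u v X. (u, v, X) \<in> Q \<longrightarrow> separates C1 X (\<gamma>' u) (\<gamma>' v)"
      by (elim exE conjE) (rule that)
    have P': "\<gamma>' u \<in> P" for u using 1(1) by blast
    define C2 where "C2 = C1 \<union> {D_seq n} \<union> (\<lambda>u. isoinv (\<gamma>' u) (D_seq n)) ` L"
    have C2: "finite C2" "C2 \<subseteq> D" "C1 \<subseteq> C2"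
      using 1(2,4) finL P_mem[OF P_isoinv[OF P'] D_seq_in] D_seq_in by (auto simp: C2_def)
    have "Next n x (\<gamma>', C2)"
      unfolding Next_def xe prod.case
    proof (intro conjI allI impI)
      show "C \<subseteq> C2" using 1(3) C2(3) by blast
      show "agree C (\<gamma>' u) (\<gamma> (butlast u))" for u using 1(1) by blast
      show "separates C2 (O' k) (\<gamma>' u) (\<gamma>' v)"
        if "length u = Suc n" "length v = Suc n" "u \<noteq> v" "k \<le> n" for u v k
      proof -
        have "(u, v, O' k) \<in> Q" using that by (auto simp: Q_def L_def)
        hence "separates C1 (O' k) (\<gamma>' u) (\<gamma>' v)" using 1(5) by blast
        thus ?thesis by (rule separates_mono[OF _ C2(3)]) (simp_all add: agree_def)
      qed
      show "D_seq n \<in> C2" "length u = Suc n \<Longrightarrow> isoinv (\<gamma>' u) (D_seq n) \<in> C2" for u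
        by (auto simp: C2_def L_def)
    qed
    moreover have "Good (Suc n) (\<gamma>', C2)" using 1(3) P' C2 g(3) by (auto simp: Good_def)
    ultimately show ?thesis by blast
  qed
  have "Good 0 (\<lambda>_. id, A)" using A P_id by (simp add: Good_def)
  then obtain \<sigma> where \<sigma>: "\<And>n. Good n (\<sigma> n)" "\<And>n. Next n (\<sigma> n) (\<sigma> (Suc n))"
    using dependent_nat_choice[of Good Next] step by blast
  define \<gamma> C where "\<gamma> n = fst (\<sigma> n)" and "C n = snd (\<sigma> n)" for n
  have G: "\<And>n u. \<gamma> n u \<in> P" "\<And>n. A \<subseteq> C n" "\<And>n. C n \<subseteq> D" "\<And>u. \<gamma> 0 u = id"
    using \<sigma>(1) unfolding Good_def \<gamma>_def C_def by (auto simp: case_prod_beta)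
  have N: "\<And>n. C n \<subseteq> C (Suc n)"
    "\<And>n u. length u = Suc n \<Longrightarrow> agree (C n) (\<gamma> (Suc n) u) (\<gamma> n (butlast u))"
    "\<And>n u v k. length u = Suc n \<Longrightarrow> length v = Suc n \<Longrightarrow> u \<noteq> v \<Longrightarrow> k \<le> n \<Longrightarrow>
        separates (C (Suc n)) (O' k) (\<gamma> (Suc n) u) (\<gamma> (Suc n) v)"
    "\<And>n. D_seq n \<in> C (Suc n)" "\<And>n u. length u = Suc n \<Longrightarrow> isoinv (\<gamma> (Suc n) u) (D_seq n) \<in> C (Suc n)"
    using \<sigma>(2) unfolding Next_def \<gamma>_def C_def case_prod_beta by simp_all
  have "\<exists>h\<in>P. \<forall>n. agree (C n) h (\<gamma> n (branch \<alpha> n))" for \<alpha>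
  proof -
    have "\<exists>h\<in>P. \<forall>n. \<forall>c\<in>C n \<inter> D. h c = \<gamma> n (branch \<alpha> n) c"
    proof (rule limit_in_P)
      show "\<gamma> n (branch \<alpha> n) \<in> P" "C n \<subseteq> C (Suc n)" for n by (fact G(1) N(1))+
      show "\<gamma> (Suc n) (branch \<alpha> (Suc n)) c = \<gamma> n (branch \<alpha> n) c" if "c \<in> C n" for n c
        using N(2)[of "branch \<alpha> (Suc n)" n] that by (simp add: length_branch agree_def) (simp add: branch_Suc)
      show "\<exists>n. d \<in> C n" if "d \<in> D" for d using D_seq_surj[OF that] N(4) by blast
      show "\<exists>n. isoinv (\<gamma> n (branch \<alpha> n)) d \<in> C n" if "d \<in> D" for d
        using D_seq_surj[OF that] N(5)[OF length_branch] by blast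
    qed
    then obtain h where h: "h \<in> P" "\<forall>n. \<forall>c\<in>C n \<inter> D. h c = \<gamma> n (branch \<alpha> n) c" by blast
    have "agree (C n) h (\<gamma> n (branch \<alpha> n))" for n unfolding agree_def using h(2) G(3)[of n] by blast
    thus ?thesis using h(1) by blast
  qed
  then obtain f where f: "\<And>\<alpha>. f \<alpha> \<in> P" "\<And>\<alpha> n. agree (C n) (f \<alpha>) (\<gamma> n (branch \<alpha> n))" by metis
  have "isoinv (f \<alpha>) \<circ> f \<beta> \<in> R" if ne: "\<alpha> \<noteq> \<beta>" for \<alpha> \<beta>
  proof -
    obtain i where i: "\<alpha> i \<noteq> \<beta> i" using ne by blast
    have "isoinv (f \<alpha>) \<circ> f \<beta> \<in> O' k" for k
    proof -
      define m where "m = max i k"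
      have "branch \<alpha> (Suc m) \<noteq> branch \<beta> (Suc m)"
        using branch_eq_imp[of \<alpha> "Suc m" \<beta> i] i by (auto simp: m_def less_Suc_eq_le)
      hence "separates (C (Suc m)) (O' k) (\<gamma> (Suc m) (branch \<alpha> (Suc m))) (\<gamma> (Suc m) (branch \<beta> (Suc m)))"
        by (intro N(3)) (simp_all add: length_branch m_def)
      thus ?thesis using f unfolding separates_def by blast
    qed
    hence "isoinv (f \<alpha>) \<circ> f \<beta> \<in> P \<inter> \<Inter>\<X>" using f(1) P_comp P_isoinv O'(2) by blast
    thus ?thesis using \<X>(3) by blast
  qed
  moreover have "f \<alpha> a = a" if "a \<in> A" for \<alpha> a
    using f(2)[where \<alpha> = \<alpha> and n = 0] G(2)[of 0] G(4) that by (auto simp: agree_def)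
  ultimately show ?thesis using f(1) by (intro exI[of _ f] conjI allI impI ballI) simp_all
qed

text \<open>
  Two members of a perfect family agree on \<open>A\<close>, so their quotient fixes \<open>A\<close>.
\<close>

lemma comeager_meets_fixator:
  assumes R: "comeager R" and A: "finite A" "A \<subseteq> D"
  shows "\<exists>y\<in>R. y \<in> P \<and> (\<forall>a\<in>A. y a = a)"
proof -
  obtain f :: "(nat \<Rightarrow> bool) \<Rightarrow> 'u \<Rightarrow> 'u" where f: "\<And>\<alpha>. f \<alpha> \<in> P" "\<And>\<alpha> a. a \<in> A \<Longrightarrow> f \<alpha> a = a"
    "\<And>\<alpha> \<beta>. \<alpha> \<noteq> \<beta> \<Longrightarrow> isoinv (f \<alpha>) \<circ> f \<beta> \<in> R"
    using perfect_family[OF assms] by metis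
  define y where "y = isoinv (f (\<lambda>_. False)) \<circ> f (\<lambda>_. True)"
  have "y \<in> R" unfolding y_def by (rule f(3)) (metis)
  moreover have "y \<in> P" using f(1) P_comp P_isoinv by (simp add: y_def)
  moreover have "y a = a" if "a \<in> A" for a
    using f(2)[OF that] P_isoinv_cancel(1)[OF f(1), of "\<lambda>_. False" a] by (simp add: y_def)
  ultimately show ?thesis by blast
qed

section \<open>Stabilizers in powers of a large chain\<close>

primrec partial_product :: "(nat \<Rightarrow> 'u \<Rightarrow> 'u) \<Rightarrow> (nat \<Rightarrow> bool) \<Rightarrow> nat \<Rightarrow> 'u \<Rightarrow> 'u" where
  "partial_product f \<alpha> 0 = id"
| "partial_product f \<alpha> (Suc n) = (if \<alpha> n then partial_product f \<alpha> n \<circ> f n else partial_product f \<alpha> n)"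

lemma partial_product_cong:
  "(\<And>i. i < n \<Longrightarrow> \<alpha> i = \<beta> i) \<Longrightarrow> partial_product f \<alpha> n = partial_product f \<beta> n"
  by (induction n) auto

text \<open>
  Let \<open>h \<alpha>\<close> be the limit of the partial products. Suppose \<open>\<alpha>\<close> and
  \<open>\<beta>\<close> first differ at \<open>n\<close>, and let \<open>p\<close> be the common product of the factors
  before. The factors after \<open>n\<close> commute with \<open>x n\<close> and \<open>y n\<close>, so
  \<open>h \<alpha>\<close> conjugates \<open>x n\<close> to \<open>p (x n) p\<inverse>\<close>. The additional
  factor \<open>f n\<close> of \<open>h \<beta>\<close> turns \<open>y n\<close> into \<open>x n\<close>, so
  \<open>h \<beta>\<close> conjugates \<open>y n\<close> to the same isometry.
\<close>

lemma conjugating_tree: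
  assumes f: "\<And>n. f n \<in> P" and C: "\<And>n. C n \<subseteq> C (Suc n)" "\<And>n c. c \<in> C n \<Longrightarrow> f n c = c"
    and enum: "\<And>n. D_seq n \<in> C n" "\<And>n \<alpha>. isoinv (partial_product f \<alpha> n) (D_seq n) \<in> C n"
    and xy: "\<And>n. x n \<in> P" "\<And>n. y n \<in> P" "\<And>n. f n \<circ> y n = x n \<circ> f n"
    and comm: "\<And>n m. n < m \<Longrightarrow> f m \<circ> x n = x n \<circ> f m" "\<And>n m. n < m \<Longrightarrow> f m \<circ> y n = y n \<circ> f m"
  obtains h where "\<And>\<alpha>. h \<alpha> \<in> P"
    "\<And>\<alpha> \<beta> n. (\<And>i. i < n \<Longrightarrow> \<alpha> i = \<beta> i) \<Longrightarrow> \<not> \<alpha> n \<Longrightarrow> \<beta> n \<Longrightarrow>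
       (isoinv (h \<beta>) \<circ> h \<alpha>) \<circ> x n = y n \<circ> (isoinv (h \<beta>) \<circ> h \<alpha>)"
proof -
  let ?p = "partial_product f"
  have pP: "?p \<alpha> n \<in> P" for \<alpha> n
  proof (induction n)
    case 0 show ?case by (simp only: partial_product.simps P_id)
  next
    case (Suc n) thus ?case using P_comp[OF Suc f[of n]] by simp
  qed
  have "\<exists>h\<in>P. \<forall>n. \<forall>c\<in>C n \<inter> D. h c = ?p \<alpha> n c" for \<alpha>
  proof (rule limit_in_P)
    show "?p \<alpha> n \<in> P" "C n \<subseteq> C (Suc n)" for n by (fact pP C(1))+
    show "?p \<alpha> (Suc n) c = ?p \<alpha> n c" if "c \<in> C n" for n c using C(2)[OF that] by simp
    show "\<exists>n. d \<in> C n" "\<exists>n. isoinv (?p \<alpha> n) d \<in> C n" if "d \<in> D" for d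
      using D_seq_surj[OF that] enum by blast+
  qed
  then obtain h where h: "\<And>\<alpha>. h \<alpha> \<in> P" "\<And>\<alpha> n c. c \<in> C n \<Longrightarrow> c \<in> D \<Longrightarrow> h \<alpha> c = ?p \<alpha> n c"
    by (metis IntI)
  have Cmono: "C m \<subseteq> C n" if "m \<le> n" for m n using lift_Suc_mono_le[of C] C(1) that by blast
  have eventually: "\<exists>N. \<forall>n\<ge>N. h \<alpha> d = ?p \<alpha> n d" if d: "d \<in> D" for \<alpha> d
  proof -
    obtain N where "d \<in> C N" using D_seq_surj[OF d] enum(1) by metis
    hence "\<forall>n\<ge>N. h \<alpha> d = ?p \<alpha> n d" using Cmono h(2) d by blast
    thus ?thesis ..
  qed
  have intertwine: "h \<alpha> \<circ> t = w \<circ> h \<alpha>"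
    if t: "t \<in> P" and w: "w \<in> P" and start: "?p \<alpha> (Suc n) \<circ> t = w \<circ> ?p \<alpha> (Suc n)"
      and c: "\<And>m. n < m \<Longrightarrow> f m \<circ> t = t \<circ> f m" for \<alpha> t w n
  proof -
    have step: "?p \<alpha> (Suc n + k) \<circ> t = w \<circ> ?p \<alpha> (Suc n + k)" for k
    proof (induction k)
      case (Suc k)
      define N where "N = Suc n + k"
      have 1: "f N (t v) = t (f N v)" for v
        using fun_cong[OF c[of N], of v] by (simp add: N_def)
      have 2: "?p \<alpha> N (t v) = w (?p \<alpha> N v)" for v
        using fun_cong[OF Suc, of v] by (simp only: N_def o_apply)
      have "?p \<alpha> (Suc N) \<circ> t = w \<circ> ?p \<alpha> (Suc N)" by (simp add: fun_eq_iff 1 2)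
      thus ?case by (simp only: N_def add_Suc_right)
    qed (use start in simp)
    show ?thesis
    proof (rule isometries_eq_if_dense[OF _ _ dense])
      show "h \<alpha> \<circ> t \<in> isometries" "w \<circ> h \<alpha> \<in> isometries" using h(1) t w P_comp P_isometry by blast+
      fix d assume d: "d \<in> D"
      obtain N1 where N1: "\<forall>n\<ge>N1. h \<alpha> d = ?p \<alpha> n d" using eventually[OF d] by blast
      obtain N2 where N2: "\<forall>n\<ge>N2. h \<alpha> (t d) = ?p \<alpha> n (t d)" using eventually[OF P_mem[OF t d]] by blast
      define N where "N = Suc n + max N1 N2"
      have "N1 \<le> N" "N2 \<le> N" by (auto simp: N_def)
      hence "h \<alpha> d = ?p \<alpha> N d" "h \<alpha> (t d) = ?p \<alpha> N (t d)" using N1 N2 by blast+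
      moreover have "?p \<alpha> N (t d) = w (?p \<alpha> N d)"
        using fun_cong[OF step, of "max N1 N2" d] by (simp only: N_def o_apply)
      ultimately show "(h \<alpha> \<circ> t) d = (w \<circ> h \<alpha>) d" by simp
    qed
  qed
  show thesis
  proof (rule that[of h])
    show "h \<alpha> \<in> P" for \<alpha> by (rule h(1))
    fix \<alpha> \<beta> :: "nat \<Rightarrow> bool" and n assume ag: "\<And>i. i < n \<Longrightarrow> \<alpha> i = \<beta> i" and n: "\<not> \<alpha> n" "\<beta> n"
    define p where "p = ?p \<alpha> n"
    have p: "p \<in> P" "?p \<beta> n = p" using pP partial_product_cong[OF ag] by (simp_all add: p_def)
    define w where "w = p \<circ> (x n \<circ> isoinv p)"
    have w: "w \<in> P" using p(1) xy(1) P_comp P_isoinv by (simp add: w_def)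
    have wp: "w \<circ> p = p \<circ> x n" using P_isoinv_cancel(1)[OF p(1)] by (simp add: w_def fun_eq_iff)
    have A: "h \<alpha> \<circ> x n = w \<circ> h \<alpha>"
      by (rule intertwine[OF xy(1) w, of _ n]) (use wp n comm(1) in \<open>auto simp: p_def\<close>)
    have "p \<circ> f n \<circ> y n = p \<circ> (x n \<circ> f n)" using xy(3)[of n] by (simp add: o_assoc[symmetric])
    also have "\<dots> = w \<circ> (p \<circ> f n)" using wp by (simp add: o_assoc)
    finally have B: "h \<beta> \<circ> y n = w \<circ> h \<beta>"
      by (intro intertwine[OF xy(2) w, of _ n]) (use n p comm(2) in auto)
    have B': "isoinv (h \<beta>) (w v) = y n (isoinv (h \<beta>) v)" for v
    proof -
      have "h \<beta> (y n (isoinv (h \<beta>) v)) = w v"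
        using fun_cong[OF B, of "isoinv (h \<beta>) v"] P_isoinv_cancel(2)[OF h(1)] by simp
      thus ?thesis using P_isoinv_cancel(1)[OF h(1)] by metis
    qed
    show "(isoinv (h \<beta>) \<circ> h \<alpha>) \<circ> x n = y n \<circ> (isoinv (h \<beta>) \<circ> h \<alpha>)"
    proof
      fix v
      have "h \<alpha> (x n v) = w (h \<alpha> v)" using fun_cong[OF A, of v] by simp
      thus "((isoinv (h \<beta>) \<circ> h \<alpha>) \<circ> x n) v = (y n \<circ> (isoinv (h \<beta>) \<circ> h \<alpha>)) v" using B' by simp
    qed
  qed
qed

text \<open>
  Choose \<open>y\<close> such that both \<open>y\<close> and \<open>b\<inverse> y\<close> are generic. If both were
  products of three elements of \<open>V\<close>, then \<open>b = y (b\<inverse> y)\<inverse>\<close> would be one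
  of six.
\<close>

lemma comeager_not_in_cube:
  assumes R: "comeager R" and A: "finite A" "A \<subseteq> D"
    and V: "V \<subseteq> isometries" "\<And>g. g \<in> V \<Longrightarrow> isoinv g \<in> V"
    and bad: "b \<in> P" "b \<in> fixator A" "b \<notin> npow V 6"
  shows "\<exists>y\<in>R. y \<in> P \<and> y \<in> fixator A \<and> y \<notin> npow V 3"
proof -
  obtain y where y: "y \<in> R" "isoinv b \<circ> y \<in> R" "y \<in> P" "\<forall>a\<in>A. y a = a"
    using comeager_meets_fixator[OF comeager_Int[OF R comeager_translate[OF bad(1) R]] A] by blast
  have y': "isoinv b \<circ> y \<in> P" using y(3) bad(1) P_comp P_isoinv by blast
  have fy: "y \<in> fixator A" using y(3,4) P_isometry by (simp add: fixator_def)
  have "isoinv b a = a" if "a \<in> A" for a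
    using P_isoinv_cancel(1)[OF bad(1), of a] bad(2) that by (simp add: fixator_def)
  hence fy': "isoinv b \<circ> y \<in> fixator A" using y' y(4) P_isometry by (simp add: fixator_def)
  show ?thesis
  proof (rule ccontr)
    assume "\<not> ?thesis"
    hence "y \<in> npow V 3" and c: "isoinv b \<circ> y \<in> npow V 3" using y y' fy fy' by blast+
    have "isoinv (isoinv b \<circ> y) \<in> npow V 3" using npow_isoinv[OF V(1) _ c] V(2) by blast
    with \<open>y \<in> npow V 3\<close> have "y \<circ> isoinv (isoinv b \<circ> y) \<in> npow V (3 + 3)" by (rule npow_comp)
    moreover have "y \<circ> isoinv (isoinv b \<circ> y) = b"
      by (rule comp_isoinv_isoinv_comp[OF P_isometry[OF bad(1)] P_isometry[OF y(3)]])
    ultimately show False using bad(3) by simp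
  qed
qed

text \<open>
  Stage \<open>n\<close> of the construction extends a tame system \<open>x 0, y 0, x 1, y 1, \<dots>\<close> of
  length \<open>2 * n\<close> by \<open>x n \<in> V m\<close> and \<open>y n \<notin> npow (V m) 3\<close>,
  where \<open>m \<ge> n\<close>. Both fix a finite set \<open>C'\<close> that is invariant under the system, and both
  are generic enough for \<open>(z, x n)\<close> and \<open>(z, y n)\<close> to be tame. Hence the identity of
  \<open>C'\<close> is a partial conjugacy between these systems and extends to \<open>f n\<close>, which commutes with
  \<open>z\<close>, conjugates \<open>y n\<close> to \<open>x n\<close> and fixes \<open>C'\<close>. In the end
  \<open>conjugating_tree\<close> applies.
\<close>

lemma fixator_subset_npow:
  assumes Vmono: "\<And>m. V m \<subseteq> V (Suc m)" and V: "\<And>m. V m \<subseteq> isometries" "\<And>m g. g \<in> V m \<Longrightarrow> isoinv g \<in> V m"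
    and large: "large_in P V"
  shows "\<exists>m c. finite c \<and> c \<subseteq> D \<and> fixator c \<inter> P \<subseteq> npow (V m) 6"
proof (rule ccontr)
  assume "\<not> ?thesis"
  hence bad: "\<exists>b. b \<in> P \<and> b \<in> fixator c \<and> b \<notin> npow (V m) 6" if "finite c" "c \<subseteq> D" for m c
    using that by blast
  have Vle: "V m \<subseteq> V n" if "m \<le> n" for m n using lift_Suc_mono_le[of V] Vmono that by blast
  \<comment> \<open>a state contains the tame system z, the finite set \<F> of all partial products so far, the set C
      of points fixed from now on, and the last conjugating isometry; entries 2 * n and 2 * n + 1
      of z are x n and y n, and \<F> is recorded to keep the limits surjective on D\<close>
  define Good where "Good n = (\<lambda>(z, \<F>, C, f :: 'u \<Rightarrow> 'u). tame (2 * n) z \<and> finite \<F> \<and> \<F> \<subseteq> P \<and>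
      (n = 0 \<longrightarrow> id \<in> \<F>) \<and> finite C \<and> C \<subseteq> D)" for n
  define Next where "Next n = (\<lambda>(z, \<F>, C, f :: 'u \<Rightarrow> 'u) (z', \<F>', C', f').
      (\<forall>i<2 * n. z' i = z i) \<and> (\<exists>m\<ge>n. z' (2 * n) \<in> V m \<and> z' (2 * n + 1) \<notin> npow (V m) 3) \<and>
      f' \<in> P \<and> (\<forall>c\<in>C'. f' c = c) \<and> f' \<circ> z' (2 * n + 1) = z' (2 * n) \<circ> f' \<and>
      (\<forall>i<2 * n. f' \<circ> z i = z i \<circ> f') \<and> C \<subseteq> C' \<and> D_seq n \<in> C' \<and>
      (\<forall>p\<in>\<F>. isoinv p (D_seq n) \<in> C' \<and> p \<in> \<F>' \<and> p \<circ> f' \<in> \<F>'))" for n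
  have step: "\<exists>s'. Good (Suc n) s' \<and> Next n s s'" if s: "Good n s" for n s
  proof -
    obtain z \<F> C f where se: "s = (z, \<F>, C, f)" by (metis surj_pair)
    have z: "tame (2 * n) z" and \<F>: "finite \<F>" "\<F> \<subseteq> P" and C: "finite C" "C \<subseteq> D"
      using s se by (auto simp: Good_def)
    have "finite (C \<union> {D_seq n} \<union> (\<lambda>p. isoinv p (D_seq n)) ` \<F>)" using \<F> C by simp
    moreover have "C \<union> {D_seq n} \<union> (\<lambda>p. isoinv p (D_seq n)) ` \<F> \<subseteq> D"
      using C(2) D_seq_in \<F>(2) P_mem[OF P_isoinv _] by auto
    ultimately obtain C' where C': "finite C'" "C \<union> {D_seq n} \<union> (\<lambda>p. isoinv p (D_seq n)) ` \<F> \<subseteq> C'"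
        "C' \<subseteq> D" "invariant (2 * n) z C'"
      using tame_invariant[OF z] by metis
    define R1 where "R1 = {x. tame (Suc (2 * n)) (z(2 * n := x))}"
    have R1: "comeager R1" unfolding R1_def by (rule comeager_tame[OF z])
    obtain h :: "(nat \<Rightarrow> bool) \<Rightarrow> 'u \<Rightarrow> 'u" where h: "\<And>\<alpha>. h \<alpha> \<in> P" "\<And>\<alpha> a. a \<in> C' \<Longrightarrow> h \<alpha> a = a"
      "\<And>\<alpha> \<beta>. \<alpha> \<noteq> \<beta> \<Longrightarrow> isoinv (h \<alpha>) \<circ> h \<beta> \<in> R1"
      using perfect_family[OF R1 C'(1,3)] by metis
    obtain \<alpha> \<beta> k where k: "\<forall>i<k. \<alpha> i = \<beta> i" "\<alpha> k \<noteq> \<beta> k" "isoinv (h \<alpha>) \<circ> h \<beta> \<in> V k"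
      by (rule large_inD[OF large, of h, OF h(1)]) (rule that)
    define x where "x = isoinv (h \<alpha>) \<circ> h \<beta>"
    \<comment> \<open>largeness determines the index k only after the h \<alpha> are fixed; y is chosen afterwards, against V m\<close>
    define m where "m = max n k"
    have x: "x \<in> P" "x \<in> V m" "x \<in> R1" "\<And>c. c \<in> C' \<Longrightarrow> x c = c"
    proof -
      show "x \<in> P" using h(1) P_comp P_isoinv by (simp add: x_def)
      show "x \<in> V m" using k(3) Vle[of k m] by (auto simp: x_def m_def)
      have "\<alpha> \<noteq> \<beta>" using k(2) by auto
      thus "x \<in> R1" using h(3) by (simp add: x_def)
      show "x c = c" if "c \<in> C'" for c
        using h(2)[OF that] P_isoinv_cancel(1)[OF h(1), of \<alpha> c] by (simp add: x_def)
    qed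
    define zx where "zx = z(2 * n := x)"
    have tzx: "tame (Suc (2 * n)) zx" using x(3) by (simp add: R1_def zx_def)
    \<comment> \<open>y must also be generic over (z, x), so that the system with both is tame at the next stage\<close>
    define R2 where "R2 = {y. tame (Suc (Suc (2 * n))) (zx(Suc (2 * n) := y))}"
    have R2: "comeager R2" unfolding R2_def by (rule comeager_tame[OF tzx])
    obtain b where "b \<in> P" "b \<in> fixator C'" "b \<notin> npow (V m) 6" using bad[OF C'(1,3)] by blast
    from comeager_not_in_cube[OF comeager_Int[OF R1 R2] C'(1,3) V(1) V(2) this]
    obtain y where y: "y \<in> R1" "y \<in> R2" "y \<in> P" "y \<in> fixator C'" "y \<notin> npow (V m) 3" by blast
    define zy where "zy = z(2 * n := y)"
    have tzy: "tame (Suc (2 * n)) zy" using y(1) by (simp add: R1_def zy_def)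
    have zC: "z i c \<in> C'" if "i < 2 * n" "c \<in> C'" for i c
    proof -
      have "z i ` C' = C'" using C'(4) that(1) by (simp add: invariant_def)
      thus ?thesis using that(2) by blast
    qed
    have "partial_conjugacy (Suc (2 * n)) zy zx (Id_on C')"
      unfolding partial_conjugacy_def
    proof (intro conjI allI impI)
      show "finite (Id_on C')" using C'(1) by (simp add: Id_on_def)
      show "Id_on C' \<subseteq> D \<times> D" using C'(3) by auto
      show "dist a a' = dist b b'" if "(a, b) \<in> Id_on C'" "(a', b') \<in> Id_on C'" for a b a' b'
        using that by auto
      fix i a b assume i: "i < Suc (2 * n)" and "(a, b) \<in> Id_on C'"
      hence ab: "a = b" "b \<in> C'" by auto
      show "(zy i a, zx i b) \<in> Id_on C'"
      proof (cases "i = 2 * n")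
        case True
        have "y b = b" using y(4) ab by (simp add: fixator_def)
        thus ?thesis using True ab x(4) by (simp add: zx_def zy_def Id_on_iff)
      next
        case False
        thus ?thesis using zC[of i b] i ab by (simp add: zx_def zy_def Id_on_iff)
      qed
    qed
    from tame_conjugate[OF tzy tzx this] obtain f' where
      f'0: "f' \<in> P" "\<forall>(a, b)\<in>Id_on C'. f' a = b" "\<forall>i<Suc (2 * n). f' \<circ> zy i = zx i \<circ> f'" by blast
    have "f' c = c" if "c \<in> C'" for c using bspec[OF f'0(2) Id_onI[OF that]] by simp
    note f' = f'0(1) this f'0(3)
    define z' where "z' = zx(Suc (2 * n) := y)"
    define \<F>' where "\<F>' = \<F> \<union> (\<lambda>p. p \<circ> f') ` \<F>"
    have "Next n s (z', \<F>', C', f')"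
      unfolding Next_def se prod.case
    proof (intro conjI allI impI ballI exI[of _ m])
      show "z' i = z i" if "i < 2 * n" for i using that by (simp add: z'_def zx_def)
      show "n \<le> m" by (simp add: m_def)
      show "z' (2 * n) \<in> V m" using x(2) by (simp add: z'_def zx_def)
      show "z' (2 * n + 1) \<notin> npow (V m) 3" using y(5) by (simp add: z'_def)
      show "f' \<circ> z' (2 * n + 1) = z' (2 * n) \<circ> f'"
        using f'(3)[rule_format, of "2 * n"] by (simp add: z'_def zx_def zy_def)
      show "f' \<circ> z i = z i \<circ> f'" if "i < 2 * n" for i
        using f'(3)[rule_format, of i] that by (simp add: zx_def zy_def)
      show "f' c = c" if "c \<in> C'" for c using f'(2)[OF that] .
      show "C \<subseteq> C'" "D_seq n \<in> C'" "\<And>p. p \<in> \<F> \<Longrightarrow> isoinv p (D_seq n) \<in> C'" using C'(2) by auto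
    qed (use f'(1) in \<open>auto simp: \<F>'_def\<close>)
    moreover have "Good (Suc n) (z', \<F>', C', f')"
      using y(2) \<F> C' f'(1) P_comp by (auto simp: Good_def R2_def z'_def \<F>'_def)
    ultimately show ?thesis by blast
  qed
  have "Good 0 (undefined, {id}, {}, id)" using tame_0 P_id by (simp add: Good_def)
  then obtain \<sigma> where \<sigma>: "\<And>n. Good n (\<sigma> n)" "\<And>n. Next n (\<sigma> n) (\<sigma> (Suc n))"
    using dependent_nat_choice[of Good Next] step by blast
  define z \<F> C f where "z n = fst (\<sigma> n)" and "\<F> n = fst (snd (\<sigma> n))" and "C n = fst (snd (snd (\<sigma> n)))"
    and "f n = snd (snd (snd (\<sigma> (Suc n))))" for n
  have G: "tame (2 * n) (z n)" "\<F> n \<subseteq> P" "id \<in> \<F> 0" for n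
    using \<sigma>(1)[of n] \<sigma>(1)[of 0] unfolding Good_def z_def \<F>_def by (simp_all add: case_prod_beta)
  have N: "i < 2 * n \<Longrightarrow> z (Suc n) i = z n i"
    "\<exists>m\<ge>n. z (Suc n) (2 * n) \<in> V m \<and> z (Suc n) (2 * n + 1) \<notin> npow (V m) 3"
    "f n \<in> P" "c \<in> C (Suc n) \<Longrightarrow> f n c = c"
    "f n \<circ> z (Suc n) (2 * n + 1) = z (Suc n) (2 * n) \<circ> f n"
    "i < 2 * n \<Longrightarrow> f n \<circ> z n i = z n i \<circ> f n"
    "C n \<subseteq> C (Suc n)" "D_seq n \<in> C (Suc n)" "p \<in> \<F> n \<Longrightarrow> isoinv p (D_seq n) \<in> C (Suc n)"
    "p \<in> \<F> n \<Longrightarrow> p \<in> \<F> (Suc n)" "p \<in> \<F> n \<Longrightarrow> p \<circ> f n \<in> \<F> (Suc n)" for n i c p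
    using \<sigma>(2)[of n] unfolding Next_def z_def \<F>_def C_def f_def case_prod_beta by simp_all
  define x y where "x n = z (Suc n) (2 * n)" and "y n = z (Suc n) (2 * n + 1)" for n
  have stable: "z (n + k) i = z n i" if "i < 2 * n" for n k i
    using that N(1)[of i "n + k" for k] by (induction k) auto
  have xyP: "x n \<in> P" "y n \<in> P" for n
    using tame_P[OF G(1)[of "Suc n"]] by (simp_all add: x_def y_def)
  have \<F>: "partial_product f \<alpha> n \<in> \<F> n" for \<alpha> n
  proof (induction n)
    case 0 show ?case using G(3) by (simp only: partial_product.simps)
  next
    case (Suc n) thus ?case using N(10,11) by simp
  qed
  have later: "z m (2 * n) = x n" "z m (2 * n + 1) = y n" if "n < m" for n m
    using stable[of "2 * n" "Suc n" "m - Suc n"] stable[of "2 * n + 1" "Suc n" "m - Suc n"] that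
    by (simp_all add: x_def y_def)
  obtain h where h: "\<And>\<alpha>. h \<alpha> \<in> P"
    "\<And>\<alpha> \<beta> n. (\<And>i. i < n \<Longrightarrow> \<alpha> i = \<beta> i) \<Longrightarrow> \<not> \<alpha> n \<Longrightarrow> \<beta> n \<Longrightarrow>
       (isoinv (h \<beta>) \<circ> h \<alpha>) \<circ> x n = y n \<circ> (isoinv (h \<beta>) \<circ> h \<alpha>)"
  proof (rule conjugating_tree[of f "\<lambda>n. C (Suc n)" x y])
    show "f n \<in> P" "x n \<in> P" "y n \<in> P" for n by (fact N(3) xyP)+
    show "C (Suc n) \<subseteq> C (Suc (Suc n))" "D_seq n \<in> C (Suc n)" for n by (fact N(7,8))+
    show "f n c = c" if "c \<in> C (Suc n)" for n c using N(4) that .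
    show "isoinv (partial_product f \<alpha> n) (D_seq n) \<in> C (Suc n)" for \<alpha> n using N(9)[OF \<F>] .
    show "f n \<circ> y n = x n \<circ> f n" for n using N(5) by (simp add: x_def y_def)
    show "f m \<circ> x n = x n \<circ> f m" "f m \<circ> y n = y n \<circ> f m" if "n < m" for n m
      using N(6)[of "2 * n" m] N(6)[of "2 * n + 1" m] later[OF that] that by simp_all
  qed blast
  obtain \<alpha> \<beta> n where ab: "\<forall>i<n. \<alpha> i = \<beta> i" "\<alpha> n \<noteq> \<beta> n" "isoinv (h \<alpha>) \<circ> h \<beta> \<in> V n"
    by (rule large_inD[OF large, of h, OF h(1)]) (rule that)
  have u_inv: "isoinv (isoinv (h \<alpha>) \<circ> h \<beta>) = isoinv (h \<beta>) \<circ> h \<alpha>" for \<alpha> \<beta>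
    by (rule isoinv_isoinv_comp[OF P_isometry[OF h(1)] P_isometry[OF h(1)]])
  have "\<exists>u\<in>V n. u \<circ> x n = y n \<circ> u"
  proof (cases "\<alpha> n")
    case True
    hence "(isoinv (h \<alpha>) \<circ> h \<beta>) \<circ> x n = y n \<circ> (isoinv (h \<alpha>) \<circ> h \<beta>)"
      using h(2)[of n \<beta> \<alpha>] ab by auto
    thus ?thesis using ab(3) by blast
  next
    case False
    hence "(isoinv (h \<beta>) \<circ> h \<alpha>) \<circ> x n = y n \<circ> (isoinv (h \<beta>) \<circ> h \<alpha>)"
      using h(2)[of n \<alpha> \<beta>] ab by auto
    moreover have "isoinv (h \<beta>) \<circ> h \<alpha> \<in> V n" using V(2)[OF ab(3)] u_inv by simp
    ultimately show ?thesis by blast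
  qed
  then obtain u where u: "u \<in> V n" "u \<circ> x n = y n \<circ> u" by blast
  obtain m where m: "n \<le> m" "x n \<in> V m" "y n \<notin> npow (V m) 3" using N(2)[of n] by (auto simp: x_def y_def)
  have um: "u \<in> V m" "isoinv u \<in> V m" "u \<in> isometries" using u(1) Vle[OF m(1)] V by blast+
  have "y n = u \<circ> (x n \<circ> (isoinv u \<circ> id))"
  proof
    fix v
    have "u (x n (isoinv u v)) = y n (u (isoinv u v))" using fun_cong[OF u(2), of "isoinv u v"] by simp
    thus "y n v = (u \<circ> (x n \<circ> (isoinv u \<circ> id))) v" using isoinv_cancel(2)[OF um(3)] by simp
  qed
  moreover have "u \<circ> (x n \<circ> (isoinv u \<circ> id)) \<in> npow (V m) 3"
    unfolding numeral_3_eq_3 npow.simps using um m(2) by blast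
  ultimately show False using m(3) by simp
qed

end

section \<open>Neighbourhoods of the identity in powers of a large chain\<close>

text \<open>
  The closing-off argument of the downward Loewenheim-Skolem theorem. The operator \<open>\<Phi>\<close> collects the
  values of countably many operations on a finite set.
\<close>

lemma countable_closure:
  fixes \<Phi> :: "'a set \<Rightarrow> 'a set"
  assumes \<Phi>: "\<And>r. finite r \<Longrightarrow> countable (\<Phi> r)" and X0: "countable X0"
  obtains X where "countable X" "X0 \<subseteq> X" "\<And>r. finite r \<Longrightarrow> r \<subseteq> X \<Longrightarrow> \<Phi> r \<subseteq> X"
proof -
  define F where "F X = X \<union> (\<Union>r\<in>{r. finite r \<and> r \<subseteq> X}. \<Phi> r)" for X
  have F: "countable (F X)" if "countable X" for X
    unfolding F_def using that \<Phi> by (intro countable_Un countable_UN countable_Collect_finite_subset) auto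
  define Y where "Y n = (F ^^ n) X0" for n
  have Y: "countable (Y n)" for n by (induction n) (auto simp: Y_def X0 F)
  have Suc: "Y (Suc n) = F (Y n)" for n by (simp add: Y_def)
  have mono: "Y m \<subseteq> Y n" if "m \<le> n" for m n
    by (rule lift_Suc_mono_le[OF _ that]) (auto simp: Suc F_def)
  show thesis
  proof
    show "countable (\<Union>n. Y n)" using Y by simp
    show "X0 \<subseteq> (\<Union>n. Y n)" using UN_upper[of 0 UNIV Y] by (simp add: Y_def)
    fix r assume r: "finite r" "r \<subseteq> (\<Union>n. Y n)"
    have "\<exists>n. r \<subseteq> Y n"
      using r
    proof (induction r)
      case (insert a r)
      then obtain m n where "r \<subseteq> Y n" "a \<in> Y m" by auto
      hence "insert a r \<subseteq> Y (max m n)" using mono[of m "max m n"] mono[of n "max m n"] by auto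
      thus ?case ..
    qed auto
    then obtain n where "r \<subseteq> Y n" ..
    hence "\<Phi> r \<subseteq> Y (Suc n)" using r(1) by (auto simp: Suc F_def)
    thus "\<Phi> r \<subseteq> (\<Union>n. Y n)" by blast
  qed
qed

text \<open>
  If no stabilizer of a finite set works, choose an isometry \<open>b m c\<close> witnessing this for every
  \<open>m\<close> and finite \<open>c\<close>. Closing off under the witnesses, their inverses, distances, sums of
  distances and solutions of one-point extension problems gives a countable \<open>D\<close> and \<open>S\<close> to
  which \<open>fixator_subset_npow\<close> applies, and the stabilizer in \<open>P\<close> that it provides contains a
  witness.
\<close>

lemma fixator_subset_npow_urysohn:
  fixes V :: "nat \<Rightarrow> ('u::polish_space \<Rightarrow> 'u) set"
  assumes U: "urysohn_space TYPE('u)"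
    and Vmono: "\<And>m. V m \<subseteq> V (Suc m)" and V: "\<And>m. V m \<subseteq> isometries" "\<And>m g. g \<in> V m \<Longrightarrow> isoinv g \<in> V m"
    and large: "large_in isometries V"
  shows "\<exists>m c. finite c \<and> fixator c \<subseteq> npow (V m) 6"
proof (rule ccontr)
  assume "\<not> ?thesis"
  hence ex: "\<exists>b. b \<in> fixator c \<and> b \<notin> npow (V m) 6" if "finite c" for m c using that by blast
  define b where "b m c = (SOME b. b \<in> fixator c \<and> b \<notin> npow (V m) 6)" for m c
  have b: "b m c \<in> fixator c" "b m c \<notin> npow (V m) 6" if "finite c" for m c
    using someI_ex[OF ex[OF that, of m]] by (simp_all add: b_def)
  have bI: "b m c \<in> isometries" if "finite c" for m c using b(1)[OF that] by (simp add: fixator_def)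
  \<comment> \<open>points and distances are closed off together, in the sum type; wit q solves the extension problem
      whose prescribed distances are the pairs in q\<close>
  define wit where "wit q = (SOME u. \<forall>(a, s)\<in>q. dist u a = s)" for q :: "('u \<times> real) set"
  define \<Phi> :: "('u + real) set \<Rightarrow> ('u + real) set" where
    "\<Phi> r = (\<Union>c\<in>Pow (Inl -` r). \<Union>m. Inl ` b m c ` (Inl -` r) \<union> Inl ` isoinv (b m c) ` (Inl -` r)) \<union>
      (\<lambda>(x, y). Inr (dist x y)) ` ((Inl -` r) \<times> (Inl -` r)) \<union>
      (\<lambda>(s, t). Inr (s + t)) ` ((Inr -` r) \<times> (Inr -` r)) \<union>
      Inl ` wit ` Pow ((Inl -` r) \<times> (Inr -` r))" for r
  have \<Phi>1: "Inl (b m c x) \<in> \<Phi> r" "Inl (isoinv (b m c) x) \<in> \<Phi> r"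
    if "c \<subseteq> Inl -` r" "x \<in> Inl -` r" for m c x r
    unfolding \<Phi>_def
    by (rule UnI1, rule UnI1, rule UnI1, rule UN_I[of c], rule PowI, rule that(1), rule UN_I[of m],
        rule UNIV_I, (rule UnI1 UnI2, rule imageI, rule imageI, rule that(2)))+
  have \<Phi>2: "Inr (dist x y) \<in> \<Phi> r" if "x \<in> Inl -` r" "y \<in> Inl -` r" for x y r
    unfolding \<Phi>_def by (rule UnI1, rule UnI1, rule UnI2, rule image_eqI[of _ _ "(x, y)"]) (use that in simp_all)
  have \<Phi>3: "Inr (s + t) \<in> \<Phi> r" if "s \<in> Inr -` r" "t \<in> Inr -` r" for s t r
    unfolding \<Phi>_def by (rule UnI1, rule UnI2, rule image_eqI[of _ _ "(s, t)"]) (use that in simp_all)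
  have \<Phi>4: "Inl (wit q) \<in> \<Phi> r" if "q \<subseteq> (Inl -` r) \<times> (Inr -` r)" for q r
    unfolding \<Phi>_def by (rule UnI2, rule imageI, rule imageI, rule PowI, rule that)
  have c\<Phi>: "countable (\<Phi> r)" if "finite r" for r
  proof -
    have "finite (Inl -` r)" "finite (Inr -` r)" using that by (auto intro!: finite_vimageI simp: inj_def)
    thus ?thesis unfolding \<Phi>_def by (intro countable_Un countable_UN countable_image) (auto intro: countable_finite)
  qed
  obtain D0 :: "'u set" where D0: "countable D0" "\<And>X. open X \<Longrightarrow> X \<noteq> {} \<Longrightarrow> \<exists>d\<in>D0. d \<in> X"
    by (rule countable_dense_setE) blast
  have "countable (Inl ` D0 \<union> Inr ` {0, 1 :: real} :: ('u + real) set)" using D0(1) by simp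
  then obtain X where X: "countable X" "Inl ` D0 \<union> Inr ` {0, 1} \<subseteq> X"
      "\<And>r. finite r \<Longrightarrow> r \<subseteq> X \<Longrightarrow> \<Phi> r \<subseteq> X"
    using countable_closure[of \<Phi>] c\<Phi> by metis
  define D S where "D = Inl -` X" and "S = Inr -` X"
  have DX: "Inl x \<in> X \<longleftrightarrow> x \<in> D" and SX: "Inr s \<in> X \<longleftrightarrow> s \<in> S" for x s
    by (simp_all add: D_def S_def)
  have cD: "countable D"
  proof -
    have "countable (Inl ` D :: ('u + real) set)" by (rule countable_subset[OF _ X(1)]) (auto simp: D_def)
    thus ?thesis by (rule countable_image_inj_on) simp
  qed
  have closed: "Inl ` c \<union> Inr ` s \<subseteq> X \<Longrightarrow> finite c \<Longrightarrow> finite s \<Longrightarrow> \<Phi> (Inl ` c \<union> Inr ` s) \<subseteq> X" for c s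
    by (rule X(3)) auto
  have bD: "b m c x \<in> D" "isoinv (b m c) x \<in> D" if c: "finite c" "c \<subseteq> D" and x: "x \<in> D" for m c x
  proof -
    have "Inl ` insert x c \<union> Inr ` {} \<subseteq> X" using c x DX by auto
    from closed[OF this] have "\<Phi> (Inl ` insert x c \<union> Inr ` {}) \<subseteq> X" using c(1) by simp
    moreover have "Inl (b m c x) \<in> \<Phi> (Inl ` insert x c \<union> Inr ` {})" "Inl (isoinv (b m c) x) \<in> \<Phi> (Inl ` insert x c \<union> Inr ` {})"
      by (rule \<Phi>1; force)+
    ultimately show "b m c x \<in> D" "isoinv (b m c) x \<in> D" using DX by blast+
  qed
  interpret dense_injective D S
  proof
    show "countable D" by (rule cD)
    have "D0 \<subseteq> D" using X(2) by (auto simp: D_def)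
    moreover have "closure D0 = UNIV"
    proof (rule ccontr)
      assume "closure D0 \<noteq> UNIV"
      then obtain d where "d \<in> D0" "d \<in> - closure D0" using D0(2)[of "- closure D0"] by auto
      thus False using closure_subset by blast
    qed
    ultimately show "closure D = UNIV" using closure_mono by blast
    show "0 \<in> S" "\<exists>s\<in>S. 0 < s" using X(2) by (auto simp: S_def intro!: bexI[of _ 1])
    show "dist x y \<in> S" if "x \<in> D" "y \<in> D" for x y
    proof -
      have "Inl ` {x, y} \<union> Inr ` {} \<subseteq> X" using that DX by auto
      from closed[OF this] have "\<Phi> (Inl ` {x, y} \<union> Inr ` {}) \<subseteq> X" by simp
      moreover have "Inr (dist x y) \<in> \<Phi> (Inl ` {x, y} \<union> Inr ` {})" by (rule \<Phi>2) auto
      ultimately show ?thesis using SX by blast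
    qed
    show "s + t \<in> S" if "s \<in> S" "t \<in> S" for s t
    proof -
      have "Inl ` {} \<union> Inr ` {s, t} \<subseteq> X" using that SX by auto
      from closed[OF this] have "\<Phi> (Inl ` {} \<union> Inr ` {s, t}) \<subseteq> X" by simp
      moreover have "Inr (s + t) \<in> \<Phi> (Inl ` {} \<union> Inr ` {s, t})" by (rule \<Phi>3) auto
      ultimately show ?thesis using SX by blast
    qed
    show "finitely_injective D S"
      unfolding finitely_injective_def
    proof (intro allI impI, elim conjE)
      fix A :: "'u set" and f assume A: "finite A" "A \<subseteq> D" "f ` A \<subseteq> S" "\<forall>a\<in>A. 0 < f a"
        "\<forall>a\<in>A. \<forall>b\<in>A. \<bar>f a - f b\<bar> \<le> dist a b \<and> dist a b \<le> f a + f b"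
      obtain u where u: "\<And>a. a \<in> A \<Longrightarrow> dist u a = f a"
        using finitely_injectiveD[OF urysohn_finitely_injective[OF U] A(1), of f] A(4,5) by auto
      define q where "q = (\<lambda>a. (a, f a)) ` A"
      have "\<forall>(a, s)\<in>q. dist u a = s" using u by (auto simp: q_def)
      hence "\<forall>(a, s)\<in>q. dist (wit q) a = s" unfolding wit_def by (rule someI)
      hence "\<forall>a\<in>A. dist (wit q) a = f a" by (auto simp: q_def)
      moreover have "wit q \<in> D"
      proof -
        have "Inl ` A \<union> Inr ` f ` A \<subseteq> X" using A(2,3) DX SX by auto
        from closed[OF this] have "\<Phi> (Inl ` A \<union> Inr ` f ` A) \<subseteq> X" using A(1) by simp
        moreover have "Inl (wit q) \<in> \<Phi> (Inl ` A \<union> Inr ` f ` A)" by (rule \<Phi>4) (auto simp: q_def)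
        ultimately show ?thesis using DX by blast
      qed
      ultimately show "\<exists>u\<in>D. \<forall>a\<in>A. dist u a = f a" by blast
    qed
  qed
  have bP: "b m c \<in> P" if "finite c" "c \<subseteq> D" for m c
  proof -
    have "b m c ` D = D"
    proof
      show "b m c ` D \<subseteq> D" using bD(1)[OF that] by auto
      show "D \<subseteq> b m c ` D"
      proof
        fix x assume "x \<in> D"
        hence "isoinv (b m c) x \<in> D" using bD(2)[OF that] by blast
        moreover have "x = b m c (isoinv (b m c) x)" using isoinv_cancel(2)[OF bI[OF that(1)]] by simp
        ultimately show "x \<in> b m c ` D" by blast
      qed
    qed
    thus ?thesis using bI[OF that(1)] by (simp add: P_def)
  qed
  have "\<exists>m c. finite c \<and> c \<subseteq> D \<and> fixator c \<inter> P \<subseteq> npow (V m) 6"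
  proof (rule fixator_subset_npow[of V])
    show "V m \<subseteq> V (Suc m)" "V m \<subseteq> isometries" for m by (fact Vmono V(1))+
    show "isoinv g \<in> V m" if "g \<in> V m" for m g using V(2)[OF that] .
    show "large_in P V" by (rule large_in_mono[OF large]) (use P_isometry in blast)
  qed
  then obtain m c where "finite c" "c \<subseteq> D" "fixator c \<inter> P \<subseteq> npow (V m) 6" by blast
  thus False using b bP by blast
qed

lemma inj_sequences_unit_interval:
  obtains \<tau> :: "(nat \<Rightarrow> bool) \<Rightarrow> real" where "inj \<tau>" "range \<tau> \<subseteq> {0..1}"
proof -
  obtain f :: "nat set \<Rightarrow> real" where f: "inj f" "range f \<subseteq> {0..<1}"
    using nat_sets_lepoll_reals01 by (auto simp: lepoll_def)
  have "inj (\<lambda>\<alpha>. f {n. \<alpha> n})"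
    using f(1) by (auto simp: inj_def fun_eq_iff set_eq_iff)
  moreover have "f A \<in> {0..1}" for A
  proof -
    have "f A \<in> {0..<1}" using f(2) by blast
    thus ?thesis by simp
  qed
  hence "range (\<lambda>\<alpha>. f {n. \<alpha> n}) \<subseteq> {0..1}" by blast
  ultimately show thesis by (rule that)
qed

text \<open>
  Apply largeness to the isometries along a path of copies of \<open>c\<close>, indexed by distinct parameters in the
  unit interval; the relative position of the two copies it finds is that of \<open>moves_less_subset_npow\<close>. The
  exponent is \<open>4 * 6 + 2\<close>.
\<close>

theorem moves_less_subset_npow_urysohn:
  fixes V :: "nat \<Rightarrow> ('u::polish_space \<Rightarrow> 'u) set"
  assumes U: "urysohn_space TYPE('u)"
    and Vmono: "\<And>m. V m \<subseteq> V (Suc m)" and V: "\<And>m. V m \<subseteq> isometries" "\<And>m g. g \<in> V m \<Longrightarrow> isoinv g \<in> V m"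
    and large: "large_in isometries V"
  shows "\<exists>m c \<epsilon>. finite c \<and> 0 < \<epsilon> \<and> moves_less c \<epsilon> \<subseteq> npow (V m) 26"
proof -
  obtain m c where c: "finite c" "fixator c \<subseteq> npow (V m) 6"
    using fixator_subset_npow_urysohn[OF U Vmono V large] by blast
  obtain C where C: "0 < C" "\<And>x y. x \<in> c \<Longrightarrow> y \<in> c \<Longrightarrow> dist x y \<le> C"
    using finite_diameter_bound[OF c(1)] by blast
  obtain \<gamma> :: "real \<Rightarrow> 'u \<Rightarrow> 'u" where \<gamma>: "\<And>t. t \<in> {0..1} \<Longrightarrow> \<gamma> t \<in> isometries"
    "\<And>s t a b. s \<in> {0..1} \<Longrightarrow> t \<in> {0..1} \<Longrightarrow> a \<in> c \<Longrightarrow> b \<in> c \<Longrightarrow>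
        dist (\<gamma> s a) (\<gamma> t b) = (1 - \<bar>s - t\<bar>) * dist a b + C * \<bar>s - t\<bar>"
    using path_of_copies[OF U c(1) C] by blast
  obtain \<tau> :: "(nat \<Rightarrow> bool) \<Rightarrow> real" where \<tau>: "inj \<tau>" "range \<tau> \<subseteq> {0..1}"
    by (rule inj_sequences_unit_interval) blast
  have \<tau>01: "\<tau> \<alpha> \<in> {0..1}" for \<alpha> using \<tau>(2) by blast
  obtain \<alpha> \<beta> k where k: "\<forall>i<k. \<alpha> i = \<beta> i" "\<alpha> k \<noteq> \<beta> k"
      "isoinv (\<gamma> (\<tau> \<alpha>)) \<circ> \<gamma> (\<tau> \<beta>) \<in> V k"
    by (rule large_inD[OF large, of "\<lambda>\<alpha>. \<gamma> (\<tau> \<alpha>)", OF \<gamma>(1)[OF \<tau>01]]) (rule that)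
  define g where "g = isoinv (\<gamma> (\<tau> \<alpha>)) \<circ> \<gamma> (\<tau> \<beta>)"
  define z where "z = \<bar>\<tau> \<alpha> - \<tau> \<beta>\<bar>"
  have "\<tau> \<alpha> \<noteq> \<tau> \<beta>" using \<tau>(1) k(2) by (auto dest: injD)
  hence z: "0 < z" "z \<le> 1" using \<tau>01[of \<alpha>] \<tau>01[of \<beta>] by (auto simp: z_def abs_if)
  define M where "M = max m k"
  have Vle: "V m \<subseteq> V M" "V k \<subseteq> V M" using lift_Suc_mono_le[of V] Vmono by (auto simp: M_def)
  have fx: "fixator c \<subseteq> npow (V M) 6" using c(2) npow_mono[OF Vle(1)] by blast
  have gV: "g \<in> V M" using k(3) Vle(2) by (auto simp: g_def)
  have gd: "dist a (g b) = (1 - z) * dist a b + C * z" if "a \<in> c" "b \<in> c" for a b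
    unfolding g_def z_def dist_isoinv_comp[OF \<gamma>(1)[OF \<tau>01]] by (rule \<gamma>(2)[OF \<tau>01 \<tau>01 that])
  have "\<exists>\<epsilon>>0. moves_less c \<epsilon> \<subseteq> npow (V M) (4 * 6 + 2)"
    using moves_less_subset_npow[OF U c(1) C z V(1) _ fx gV gd] V(2) by blast
  thus ?thesis using c(1) by auto
qed

section \<open>The three properties\<close>

lemma uncountable_sequences: "uncountable (UNIV :: (nat \<Rightarrow> bool) set)"
proof
  assume "countable (UNIV :: (nat \<Rightarrow> bool) set)"
  hence "countable (range (\<lambda>\<alpha> :: nat \<Rightarrow> bool. {n. \<alpha> n}))" by simp
  moreover have "range (\<lambda>\<alpha> :: nat \<Rightarrow> bool. {n. \<alpha> n}) = UNIV"
  proof (intro equalityI subsetI UNIV_I)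
    fix A :: "nat set"
    show "A \<in> range (\<lambda>\<alpha> :: nat \<Rightarrow> bool. {n. \<alpha> n})" by (rule range_eqI[of _ _ "\<lambda>n. n \<in> A"]) simp
  qed
  ultimately have "countable (UNIV :: nat set set)" by simp
  thus False using countable_eqpoll[OF _ nat_sets_eqpoll_reals[THEN eqpoll_sym]] uncountable_UNIV_real by blast
qed

lemma countable_colouring:
  fixes q :: "(nat \<Rightarrow> bool) \<Rightarrow> 'b"
  assumes "countable (range q)"
  obtains \<alpha> \<beta> where "\<alpha> \<noteq> \<beta>" "q \<alpha> = q \<beta>"
proof -
  have "\<not> inj q" using assms uncountable_sequences countable_image_inj_on by blast
  thus thesis using that by (auto simp: inj_def)
qed

lemma Iso_simps: "carrier Iso = isometries" "mult Iso g h = g \<circ> h" "one Iso = id"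
  by (simp_all add: Iso_def)

lemma m_inv_Iso:
  assumes "g \<in> isometries" shows "inv\<^bsub>Iso\<^esub> g = isoinv g"
  using group.inv_equality[OF group_Iso, of "isoinv g" g] assms
  by (simp add: Iso_simps isoinv_comp isoinv_in_isometries)

lemma subgroup_Iso:
  assumes "subgroup H Iso"
  shows "H \<subseteq> isometries" "id \<in> H" "\<And>g h. g \<in> H \<Longrightarrow> h \<in> H \<Longrightarrow> g \<circ> h \<in> H" "\<And>g. g \<in> H \<Longrightarrow> isoinv g \<in> H"
proof -
  show H: "H \<subseteq> isometries" using subgroup.subset[OF assms] by (simp add: Iso_simps)
  show "id \<in> H" using subgroup.one_closed[OF assms] by (simp add: Iso_simps)
  show "g \<circ> h \<in> H" if "g \<in> H" "h \<in> H" for g h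
    using subgroup.m_closed[OF assms that] by (simp add: Iso_simps)
  show "isoinv g \<in> H" if "g \<in> H" for g
    using subgroup.m_inv_closed[OF assms that] m_inv_Iso[of g] H that by auto
qed

lemma npow_subgroup:
  assumes "subgroup H Iso" shows "npow H n \<subseteq> H"
  by (induction n) (use subgroup_Iso[OF assms] in auto)

text \<open>
  A subgroup contains its own powers, and the isometry group has no proper open subgroup.
\<close>

lemma subgroup_chain_Iso:
  fixes V :: "nat \<Rightarrow> ('u::polish_space \<Rightarrow> 'u) set"
  assumes U: "urysohn_space TYPE('u)" and sub: "\<And>m. subgroup (V m) Iso" and Vmono: "\<And>m. V m \<subseteq> V (Suc m)"
    and large: "large_in isometries V"
  shows "\<exists>m. V m = isometries"
proof -
  obtain m c \<epsilon> where m: "finite c" "0 < \<epsilon>" "moves_less c \<epsilon> \<subseteq> npow (V m) 26"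
    using moves_less_subset_npow_urysohn[OF U Vmono subgroup_Iso(1)[OF sub] subgroup_Iso(4)[OF sub] large]
    by blast
  have "moves_less c \<epsilon> \<subseteq> V m" using m(3) npow_subgroup[OF sub] by blast
  hence "isometries \<subseteq> V m"
    using subgroup_containing_moves_less[OF U m(1,2)] subgroup_Iso[OF sub[of m]] by blast
  thus ?thesis using subgroup_Iso(1)[OF sub] by blast
qed

text \<open>
  If \<open>h \<alpha>\<inverse>\<close> and \<open>h \<beta>\<inverse>\<close> lie in the same right coset of
  \<open>H\<close>, then \<open>h \<alpha>\<inverse> h \<beta> \<in> H\<close>; fewer cosets than sequences force
  such a pair. So \<open>H\<close> is not only open but the whole group.
\<close>

theorem small_index_property_Iso:
  assumes U: "urysohn_space TYPE('u::polish_space)"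
  shows "small_index_property (Iso :: ('u \<Rightarrow> 'u) monoid) Iso_topology"
  unfolding small_index_property_def
proof (intro allI impI, elim conjE)
  fix H :: "('u \<Rightarrow> 'u) set"
  assume H: "subgroup H Iso" and small: "rcosets\<^bsub>Iso\<^esub> H \<prec> (UNIV :: nat set set)"
  note sub = subgroup_Iso[OF H]
  have "\<exists>m :: nat. H = isometries"
  proof (rule subgroup_chain_Iso[OF U, of "\<lambda>_. H"], use H in simp, simp, rule large_inI)
    fix h :: "(nat \<Rightarrow> bool) \<Rightarrow> 'u \<Rightarrow> 'u" assume h: "\<forall>\<alpha>. h \<alpha> \<in> isometries"
    define q where "q \<alpha> = H #>\<^bsub>Iso\<^esub> isoinv (h \<alpha>)" for \<alpha>
    have iI: "isoinv (h \<alpha>) \<in> isometries" for \<alpha> using h isoinv_in_isometries by blast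
    have "q \<alpha> \<in> rcosets\<^bsub>Iso\<^esub> H" for \<alpha> using iI by (auto simp: q_def RCOSETS_def Iso_simps)
    have "\<not> inj q"
    proof
      assume "inj q"
      hence "inj (\<lambda>A :: nat set. q (\<lambda>n. n \<in> A))" by (auto simp: inj_def fun_eq_iff)
      hence "(UNIV :: nat set set) \<lesssim> rcosets\<^bsub>Iso\<^esub> H"
        unfolding lepoll_def using \<open>\<And>\<alpha>. q \<alpha> \<in> rcosets\<^bsub>Iso\<^esub> H\<close> by blast
      thus False using small by (meson lesspoll_trans1 lesspoll_trans2 less_irrefl lesspoll_def lepoll_antisym)
    qed
    then obtain \<alpha> \<beta> where ne: "\<alpha> \<noteq> \<beta>" and eq: "q \<alpha> = q \<beta>" by (auto simp: inj_def)
    have "isoinv (h \<alpha>) \<in> q \<alpha>" unfolding q_def r_coset_def by (rule UN_I[OF sub(2)]) (simp add: Iso_simps)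
    then obtain k where k: "k \<in> H" "isoinv (h \<alpha>) = k \<circ> isoinv (h \<beta>)"
      using eq unfolding q_def r_coset_def by (auto simp: Iso_simps)
    have "isoinv (h \<alpha>) \<circ> h \<beta> = k" using k(2) isoinv_comp(1)[of "h \<beta>"] h by (simp add: o_assoc[symmetric])
    thus "\<exists>\<alpha> \<beta>. \<alpha> \<noteq> \<beta> \<and> (\<forall>n. \<alpha> n \<noteq> \<beta> n \<longrightarrow> isoinv (h \<alpha>) \<circ> h \<beta> \<in> H)"
      using ne k(1) by blast
  qed
  hence "H = topspace Iso_topology" by (simp add: topspace_Iso_topology Iso_simps)
  thus "openin Iso_topology H" by simp
qed

text \<open>
  Colour a sequence by the least \<open>N\<close> such that its isometry lies in \<open>C N\<close>, together with its
  initial segment of length \<open>N\<close>. There are only countably many colours. Two sequences of the same colour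
  differ only at places \<open>n \<ge> N\<close>, where \<open>C N \<subseteq> C n\<close>.
\<close>

theorem uncountable_cofinality_Iso:
  assumes U: "urysohn_space TYPE('u::polish_space)"
  shows "uncountable_cofinality (Iso :: ('u \<Rightarrow> 'u) monoid)"
  unfolding uncountable_cofinality_def
proof (rule notI, elim exE conjE)
  fix C :: "nat \<Rightarrow> ('u \<Rightarrow> 'u) set"
  assume C: "\<forall>n. subgroup (C n) Iso \<and> C n \<noteq> carrier Iso" "\<forall>n. C n \<subseteq> C (Suc n)" "(\<Union>n. C n) = carrier Iso"
  have Cle: "C m \<subseteq> C n" if "m \<le> n" for m n using lift_Suc_mono_le[of C] C(2) that by blast
  have "\<exists>m. C m = isometries"
  proof (rule subgroup_chain_Iso[OF U])
    show "subgroup (C m) Iso" "C m \<subseteq> C (Suc m)" for m using C by auto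
    show "large_in isometries C"
    proof (rule large_inI)
      fix h :: "(nat \<Rightarrow> bool) \<Rightarrow> 'u \<Rightarrow> 'u" assume h: "\<forall>\<alpha>. h \<alpha> \<in> isometries"
      define N where "N \<alpha> = (LEAST m. h \<alpha> \<in> C m)" for \<alpha>
      have N: "h \<alpha> \<in> C (N \<alpha>)" for \<alpha>
      proof -
        have "h \<alpha> \<in> (\<Union>n. C n)" using h C(3) by (simp add: Iso_simps)
        thus ?thesis unfolding N_def by (auto intro: LeastI)
      qed
      obtain \<alpha> \<beta> where ne: "\<alpha> \<noteq> \<beta>" and eq: "(N \<alpha>, map \<alpha> [0..<N \<alpha>]) = (N \<beta>, map \<beta> [0..<N \<beta>])"
        by (rule countable_colouring[of "\<lambda>\<alpha>. (N \<alpha>, map \<alpha> [0..<N \<alpha>])"]) auto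
      have "isoinv (h \<alpha>) \<circ> h \<beta> \<in> C n" if n: "\<alpha> n \<noteq> \<beta> n" for n
      proof -
        have "N \<alpha> \<le> n"
        proof (rule ccontr)
          assume "\<not> N \<alpha> \<le> n"
          hence "\<alpha> n = \<beta> n" using eq by auto
          thus False using n by simp
        qed
        hence "h \<alpha> \<in> C n" "h \<beta> \<in> C n" using N[of \<alpha>] N[of \<beta>] Cle[of "N \<alpha>" n] eq by auto
        thus ?thesis using subgroup_Iso(3,4)[of "C n"] C(1) by blast
      qed
      thus "\<exists>\<alpha> \<beta>. \<alpha> \<noteq> \<beta> \<and> (\<forall>n. \<alpha> n \<noteq> \<beta> n \<longrightarrow> isoinv (h \<alpha>) \<circ> h \<beta> \<in> C n)" using ne by blast
    qed
  qed
  thus False using C(1) by (auto simp: Iso_simps)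
qed

lemma topological_group_product_nbhd:
  assumes G: "topological_group G T" and W: "openin T W" "\<one>\<^bsub>G\<^esub> \<in> W"
  obtains X where "openin T X" "\<one>\<^bsub>G\<^esub> \<in> X" "\<And>a b. a \<in> X \<Longrightarrow> b \<in> X \<Longrightarrow> a \<otimes>\<^bsub>G\<^esub> b \<in> W"
proof -
  interpret group G using G by (simp add: topological_group_def)
  have top: "topspace T = carrier G" and cont: "continuous_map (prod_topology T T) T (\<lambda>(x, y). x \<otimes>\<^bsub>G\<^esub> y)"
    using G by (simp_all add: topological_group_def)
  have op: "openin (prod_topology T T) {p \<in> topspace (prod_topology T T). (\<lambda>(x, y). x \<otimes>\<^bsub>G\<^esub> y) p \<in> W}"
    by (rule openin_continuous_map_preimage[OF cont W(1)])
  have mem: "(\<one>\<^bsub>G\<^esub>, \<one>\<^bsub>G\<^esub>) \<in> {p \<in> topspace (prod_topology T T). (\<lambda>(x, y). x \<otimes>\<^bsub>G\<^esub> y) p \<in> W}"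
    using W(2) by (simp add: top)
  from op[unfolded openin_prod_topology_alt, rule_format, OF mem]
  obtain A B where AB: "openin T A" "openin T B" "\<one>\<^bsub>G\<^esub> \<in> A" "\<one>\<^bsub>G\<^esub> \<in> B"
    "A \<times> B \<subseteq> {p \<in> topspace (prod_topology T T). (\<lambda>(x, y). x \<otimes>\<^bsub>G\<^esub> y) p \<in> W}"
    by (elim exE conjE) (rule that)
  show thesis
  proof (rule that[of "A \<inter> B"])
    show "openin T (A \<inter> B)" "\<one>\<^bsub>G\<^esub> \<in> A \<inter> B" using AB by auto
    show "a \<otimes>\<^bsub>G\<^esub> b \<in> W" if "a \<in> A \<inter> B" "b \<in> A \<inter> B" for a b using AB(5) that by auto
  qed
qed

text \<open>
  The preimage of a small neighbourhood of the identity has all its products of \<open>n\<close> elements mapped into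
  \<open>W\<close>.
\<close>

lemma topological_group_power_nbhd:
  fixes \<phi> :: "('u::metric_space \<Rightarrow> 'u) \<Rightarrow> 'h"
  assumes G: "topological_group G T" and \<phi>: "\<phi> \<in> hom Iso G" and W: "openin T W" "\<one>\<^bsub>G\<^esub> \<in> W"
  shows "\<exists>X. openin T X \<and> \<one>\<^bsub>G\<^esub> \<in> X \<and> (\<forall>V. V \<subseteq> isometries \<and> \<phi> ` V \<subseteq> X \<longrightarrow> \<phi> ` npow V n \<subseteq> W)"
  using W
proof (induction n arbitrary: W)
  case 0
  have "group_hom Iso G \<phi>" using G \<phi> group_Iso by (simp add: group_hom_def group_hom_axioms_def topological_group_def)
  hence one: "\<phi> id = \<one>\<^bsub>G\<^esub>" using group_hom.hom_one by (fastforce simp: Iso_simps)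
  have n0: "\<phi> ` npow V 0 \<subseteq> W" for V
    unfolding npow.simps image_insert image_empty one using 0(2) by blast
  show ?case using 0 by (intro exI[of _ W] conjI allI impI n0)
next
  case (Suc n)
  obtain Y where Y: "openin T Y" "\<one>\<^bsub>G\<^esub> \<in> Y" "\<And>a b. a \<in> Y \<Longrightarrow> b \<in> Y \<Longrightarrow> a \<otimes>\<^bsub>G\<^esub> b \<in> W"
    by (rule topological_group_product_nbhd[OF G Suc.prems]) blast
  obtain X where X: "openin T X" "\<one>\<^bsub>G\<^esub> \<in> X" "\<forall>V. V \<subseteq> isometries \<and> \<phi> ` V \<subseteq> X \<longrightarrow> \<phi> ` npow V n \<subseteq> Y"
    using Suc.IH[OF Y(1,2)] by blast
  have "\<phi> ` npow V (Suc n) \<subseteq> W" if V: "V \<subseteq> isometries" "\<phi> ` V \<subseteq> X \<inter> Y" for V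
  proof
    fix w assume "w \<in> \<phi> ` npow V (Suc n)"
    then obtain g h where gh: "w = \<phi> (g \<circ> h)" "g \<in> V" "h \<in> npow V n" by auto
    have "g \<in> isometries" "h \<in> isometries" using gh V(1) npow_isometries[OF V(1)] by blast+
    hence "w = \<phi> g \<otimes>\<^bsub>G\<^esub> \<phi> h" using gh(1) hom_mult[OF \<phi>, of g h] by (simp add: Iso_simps)
    moreover have "\<phi> g \<in> Y" "\<phi> h \<in> Y" using gh V X(3) by blast+
    ultimately show "w \<in> W" using Y(3) by simp
  qed
  moreover have "openin T (X \<inter> Y)" "\<one>\<^bsub>G\<^esub> \<in> X \<inter> Y" using X Y by auto
  ultimately show ?case by (intro exI[of _ "X \<inter> Y"] conjI allI impI) simp_all
qed

text \<open>
  For a neighbourhood \<open>Z\<close> of the identity, countably many translates of \<open>Z\<close> cover the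
  separable target, so among uncountably many isometries two have images in the same translate. Their quotient is mapped
  into \<open>Z\<inverse> Z\<close>, whose preimage \<open>V\<close> thus gives a large constant chain.
\<close>

theorem automatic_continuity_Iso:
  assumes U: "urysohn_space TYPE('u::polish_space)"
  shows "automatic_continuity_property TYPE('h) (Iso :: ('u \<Rightarrow> 'u) monoid) Iso_topology"
  unfolding automatic_continuity_property_def
proof (intro allI impI ballI, elim conjE)
  fix G :: "'h monoid" and T and \<phi> :: "('u \<Rightarrow> 'u) \<Rightarrow> 'h"
  assume G: "topological_group G T" and sep: "separable_space T" and \<phi>: "\<phi> \<in> hom Iso G"
  interpret group G using G by (simp add: topological_group_def)
  have top: "topspace T = carrier G" and invc: "continuous_map T T (\<lambda>x. inv\<^bsub>G\<^esub> x)"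
    and cont: "continuous_map (prod_topology T T) T (\<lambda>(x, y). x \<otimes>\<^bsub>G\<^esub> y)"
    using G by (simp_all add: topological_group_def)
  have \<phi>c: "\<phi> g \<in> carrier G" if "g \<in> isometries" for g
    using \<phi> that by (auto simp: hom_def Iso_simps)
  have \<phi>m: "\<phi> (g \<circ> h) = \<phi> g \<otimes>\<^bsub>G\<^esub> \<phi> h" if "g \<in> isometries" "h \<in> isometries" for g h
    using hom_mult[OF \<phi>, of g h] that by (simp add: Iso_simps)
  have gh: "group_hom Iso G \<phi>" using \<phi> group_Iso is_group by (simp add: group_hom_def group_hom_axioms_def)
  have \<phi>i: "\<phi> (isoinv g) = inv\<^bsub>G\<^esub> \<phi> g" if "g \<in> isometries" for g
    using group_hom.hom_inv[OF gh, of g] m_inv_Iso[OF that] that by (simp add: Iso_simps)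
  have left: "openin T {x \<in> carrier G. k \<otimes>\<^bsub>G\<^esub> x \<in> W}" if k: "k \<in> carrier G" and W: "openin T W" for k W
  proof -
    have "continuous_map T T ((\<lambda>(x, y). x \<otimes>\<^bsub>G\<^esub> y) \<circ> (\<lambda>x. (k, x)))"
      by (rule continuous_map_compose[OF _ cont]) (use k top in \<open>simp add: continuous_map_pairedI\<close>)
    from openin_continuous_map_preimage[OF this W] show ?thesis by (simp add: top)
  qed
  have right: "openin T {x \<in> carrier G. inv\<^bsub>G\<^esub> x \<otimes>\<^bsub>G\<^esub> k \<in> W}" if k: "k \<in> carrier G" and W: "openin T W" for k W
  proof -
    have "continuous_map T T ((\<lambda>(x, y). x \<otimes>\<^bsub>G\<^esub> y) \<circ> (\<lambda>x. (inv\<^bsub>G\<^esub> x, k)))"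
      by (rule continuous_map_compose[OF _ cont]) (use k top invc in \<open>simp add: continuous_map_pairedI\<close>)
    from openin_continuous_map_preimage[OF this W] show ?thesis by (simp add: top)
  qed
  \<comment> \<open>continuity at the identity, from which translation gives continuity everywhere\<close>
  have main: "\<exists>c \<epsilon>. finite c \<and> 0 < \<epsilon> \<and> \<phi> ` moves_less c \<epsilon> \<subseteq> W"
    if W: "openin T W" "\<one>\<^bsub>G\<^esub> \<in> W" for W
  proof -
    obtain X where X: "openin T X" "\<one>\<^bsub>G\<^esub> \<in> X"
      "\<forall>V. V \<subseteq> isometries \<and> \<phi> ` V \<subseteq> X \<longrightarrow> \<phi> ` npow V 26 \<subseteq> W"
      using topological_group_power_nbhd[OF G \<phi> W, of 26] by (elim exE conjE) (rule that)
    obtain Z where Z: "openin T Z" "\<one>\<^bsub>G\<^esub> \<in> Z" "\<And>a b. a \<in> Z \<Longrightarrow> b \<in> Z \<Longrightarrow> inv\<^bsub>G\<^esub> a \<otimes>\<^bsub>G\<^esub> b \<in> X"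
    proof -
      obtain Y where Y: "openin T Y" "\<one>\<^bsub>G\<^esub> \<in> Y" "\<And>a b. a \<in> Y \<Longrightarrow> b \<in> Y \<Longrightarrow> a \<otimes>\<^bsub>G\<^esub> b \<in> X"
        by (rule topological_group_product_nbhd[OF G X(1,2)]) blast
      have "openin T {x \<in> topspace T. inv\<^bsub>G\<^esub> x \<in> Y}"
        by (rule openin_continuous_map_preimage[OF invc Y(1)])
      thus thesis using Y by (intro that[of "{x \<in> topspace T. inv\<^bsub>G\<^esub> x \<in> Y} \<inter> Y"]) (auto simp: top)
    qed
    have Zc: "Z \<subseteq> carrier G" using openin_subset[OF Z(1)] top by simp
    define V where "V = {g \<in> isometries. \<exists>a\<in>Z. \<exists>b\<in>Z. \<phi> g = inv\<^bsub>G\<^esub> a \<otimes>\<^bsub>G\<^esub> b}"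
    have VX: "V \<subseteq> isometries" "\<phi> ` V \<subseteq> X" using Z(3) by (auto simp: V_def)
    have Vinv: "isoinv g \<in> V" if g: "g \<in> V" for g
    proof -
      obtain a b where ab: "a \<in> Z" "b \<in> Z" "\<phi> g = inv\<^bsub>G\<^esub> a \<otimes>\<^bsub>G\<^esub> b" "g \<in> isometries" using g by (auto simp: V_def)
      have "\<phi> (isoinv g) = inv\<^bsub>G\<^esub> b \<otimes>\<^bsub>G\<^esub> a"
        using \<phi>i[OF ab(4)] ab(1-3) Zc by (simp add: inv_mult_group subset_iff)
      thus ?thesis using ab isoinv_in_isometries by (auto simp: V_def)
    qed
    obtain Q where Q: "countable Q" "Q \<subseteq> carrier G" "T closure_of Q = carrier G"
      using sep top by (auto simp: separable_space_def)
    have "\<exists>(m :: nat) c \<epsilon>. finite c \<and> 0 < \<epsilon> \<and> moves_less c \<epsilon> \<subseteq> npow V 26"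
    proof (rule moves_less_subset_npow_urysohn[OF U, of "\<lambda>_. V"])
      show "large_in isometries (\<lambda>_. V)"
      proof (rule large_inI)
        fix h :: "(nat \<Rightarrow> bool) \<Rightarrow> 'u \<Rightarrow> 'u" assume h: "\<forall>\<alpha>. h \<alpha> \<in> isometries"
        have hI: "h \<alpha> \<in> isometries" and iI: "isoinv (h \<alpha>) \<in> isometries" for \<alpha>
          using h isoinv_in_isometries by blast+
        have "\<exists>x\<in>Q. inv\<^bsub>G\<^esub> x \<otimes>\<^bsub>G\<^esub> \<phi> (h \<alpha>) \<in> Z" for \<alpha>
        proof -
          let ?N = "{x \<in> carrier G. inv\<^bsub>G\<^esub> x \<otimes>\<^bsub>G\<^esub> \<phi> (h \<alpha>) \<in> Z}"
          have "\<phi> (h \<alpha>) \<in> T closure_of Q" using Q(3) \<phi>c[OF hI] by simp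
          hence cl: "\<forall>N. \<phi> (h \<alpha>) \<in> N \<and> openin T N \<longrightarrow> (\<exists>y. y \<in> Q \<and> y \<in> N)" by (simp add: in_closure_of)
          have "\<phi> (h \<alpha>) \<in> ?N" using Z(2) \<phi>c[OF hI] by simp
          from cl[THEN spec, THEN mp, OF conjI[OF this right[OF \<phi>c[OF hI] Z(1)]]]
          have "\<exists>y. y \<in> Q \<and> y \<in> ?N" .
          thus ?thesis by blast
        qed
        then obtain q where q: "\<And>\<alpha>. q \<alpha> \<in> Q" "\<And>\<alpha>. inv\<^bsub>G\<^esub> q \<alpha> \<otimes>\<^bsub>G\<^esub> \<phi> (h \<alpha>) \<in> Z" by metis
        have "countable (range q)" by (rule countable_subset[OF _ Q(1)]) (use q in auto)
        then obtain \<alpha> \<beta> where ne: "\<alpha> \<noteq> \<beta>" and eq: "q \<alpha> = q \<beta>" by (rule countable_colouring) blast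
        have c: "q \<beta> \<in> carrier G" "\<phi> (h \<alpha>) \<in> carrier G" "\<phi> (h \<beta>) \<in> carrier G" using q(1) Q(2) \<phi>c h by auto
        have "\<phi> (isoinv (h \<alpha>) \<circ> h \<beta>) = inv\<^bsub>G\<^esub> \<phi> (h \<alpha>) \<otimes>\<^bsub>G\<^esub> \<phi> (h \<beta>)"
          using \<phi>m[OF iI hI, of \<alpha> \<beta>] \<phi>i[OF hI, of \<alpha>] by simp
        also have "\<dots> = inv\<^bsub>G\<^esub> (inv\<^bsub>G\<^esub> q \<beta> \<otimes>\<^bsub>G\<^esub> \<phi> (h \<alpha>)) \<otimes>\<^bsub>G\<^esub> (inv\<^bsub>G\<^esub> q \<beta> \<otimes>\<^bsub>G\<^esub> \<phi> (h \<beta>))"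
        proof -
          have "q \<beta> \<otimes>\<^bsub>G\<^esub> (inv\<^bsub>G\<^esub> q \<beta> \<otimes>\<^bsub>G\<^esub> \<phi> (h \<beta>)) = \<phi> (h \<beta>)"
            using c by (simp add: m_assoc[symmetric])
          thus ?thesis using c by (simp add: inv_mult_group m_assoc)
        qed
        finally have "isoinv (h \<alpha>) \<circ> h \<beta> \<in> V"
          unfolding V_def using q(2)[of \<alpha>] q(2)[of \<beta>] eq comp_in_isometries[OF iI hI] by auto
        thus "\<exists>\<alpha> \<beta>. \<alpha> \<noteq> \<beta> \<and> (\<forall>n. \<alpha> n \<noteq> \<beta> n \<longrightarrow> isoinv (h \<alpha>) \<circ> h \<beta> \<in> V)" using ne by blast
      qed
    qed (use VX Vinv in auto)
    then obtain c \<epsilon> where "finite c" "0 < \<epsilon>" "moves_less c \<epsilon> \<subseteq> npow V 26" by blast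
    moreover have "\<phi> ` npow V 26 \<subseteq> W" using X(3) VX by blast
    ultimately show ?thesis by blast
  qed
  show "continuous_map Iso_topology T \<phi>"
    unfolding continuous_map_eq_topcontinuous_at topcontinuous_at_def
  proof (intro ballI conjI allI impI)
    fix g assume "g \<in> topspace (Iso_topology :: ('u \<Rightarrow> 'u) topology)"
    hence g: "g \<in> isometries" by (simp add: topspace_Iso_topology Iso_simps)
    show "g \<in> topspace Iso_topology" using g by (simp add: topspace_Iso_topology Iso_simps)
    show "\<phi> \<in> topspace Iso_topology \<rightarrow> topspace T"
      using \<phi>c by (auto simp: topspace_Iso_topology Iso_simps top)
    fix W assume W: "openin T W \<and> \<phi> g \<in> W"
    define Y where "Y = {x \<in> carrier G. \<phi> g \<otimes>\<^bsub>G\<^esub> x \<in> W}"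
    have Y1: "openin T Y" unfolding Y_def by (rule left) (use \<phi>c g W in auto)
    have Y2: "\<one>\<^bsub>G\<^esub> \<in> Y" using W \<phi>c[OF g] by (simp add: Y_def)
    from main[OF Y1 Y2] obtain c \<epsilon> where c: "finite c" "0 < \<epsilon>" "\<phi> ` moves_less c \<epsilon> \<subseteq> Y"
      by (elim exE conjE) (rule that)
    define N where "N = topspace Iso_topology \<inter> \<Inter>((\<lambda>a. {h \<in> isometries. dist (h a) (g a) < \<epsilon>}) ` c)"
    have "openin Iso_topology N"
    proof (cases "c = {}")
      case False
      thus ?thesis unfolding N_def using c(1) openin_Iso_eval by (intro openin_Int openin_Inter openin_topspace) auto
    qed (simp add: N_def)
    moreover have "g \<in> N" using g c(2) by (auto simp: N_def topspace_Iso_topology Iso_simps)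
    moreover have "\<phi> h \<in> W" if hN: "h \<in> N" for h
    proof -
      have h: "h \<in> isometries" "\<And>a. a \<in> c \<Longrightarrow> dist (h a) (g a) < \<epsilon>"
        using hN by (auto simp: N_def topspace_Iso_topology Iso_simps)
      define k where "k = isoinv g \<circ> h"
      have kI: "k \<in> isometries" using comp_in_isometries[OF isoinv_in_isometries[OF g] h(1)] by (simp add: k_def)
      have gk: "g \<circ> k = h" using isoinv_cancel(2)[OF g] by (simp add: k_def fun_eq_iff)
      have "dist (k a) a < \<epsilon>" if "a \<in> c" for a
        using h(2)[OF that] isometry_dist[OF g, of "k a" a] fun_cong[OF gk, of a] by simp
      hence "k \<in> moves_less c \<epsilon>" using kI by (simp add: moves_less_def)
      hence "\<phi> k \<in> Y" using c(3) by blast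
      thus ?thesis using \<phi>m[OF g kI] gk by (simp add: Y_def)
    qed
    ultimately show "\<exists>U. openin Iso_topology U \<and> g \<in> U \<and> (\<forall>h\<in>U. \<phi> h \<in> W)" by blast
  qed
qed

theorem theorem8:
  assumes "urysohn_space TYPE('u::polish_space)"
  shows "automatic_continuity_property TYPE('h) (Iso :: ('u \<Rightarrow> 'u) monoid) Iso_topology \<and>
         small_index_property (Iso :: ('u \<Rightarrow> 'u) monoid) Iso_topology \<and>
         uncountable_cofinality (Iso :: ('u \<Rightarrow> 'u) monoid)"
  using automatic_continuity_Iso[OF assms] small_index_property_Iso[OF assms]
    uncountable_cofinality_Iso[OF assms] by blast

end
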